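(* Let $E=\overline{\mathbb R}\setminus\{0\}$. Let $(\xi_j)_{j\ge1}$ be a stationary sequence of random variables with values in $\mathbb R\setminus\{0\}$ and $(a_n)_n$ a sequence of positive real numbers such that $\lim_{n\to\infty}nP(|\xi_1|>a_n)=1$. Suppose that $\xi_1$ has regularly varying tail probabilities of order $\alpha>0$, i.e. $P(|\xi_1|>x)=x^{-\alpha}L(x)$ with $L$ slowly varying, $\lim_{x\to\infty}P(\xi_1>x)/P(|\xi_1|>x)=p$ and $\lim_{x\to\infty}P(\xi_1<-x)/P(|\xi_1|>x)=q$, where $p\in[0,1]$, $q=1-p$. Let $N_n=\sum_{j=1}^n\delta_{\xi_j/a_n}$. Let $k_n\to\infty$ be integers with $r_n=[n/k_n]\to\infty$, $J_{i,n}=((i-1)r_n,ir_n]$ (viewed as a set of integers), and $N_{i,n}=\sum_{j\in J_{i,n}}\delta_{\xi_j/a_n}$, $1\le i\le k_n$. Suppose that $\lim_{n\to\infty}\max_{i\le k_n}P(N_{i,n}(B)>0)=0$ for every $B\in\mathcal B$, and that $\lim_{n\to\infty}\big|E(e^{-N_n(f)})-\prod_{i=1}^{k_n}E(e^{-N_{i,n}(f)})\big|=0$ for every $f\in C_K^+(E)$. Let $\theta\in(0,1]$ and let $\mathcal Q$ be a probability measure on $\tilde M=\{\mu\in M_p(E):\mu([-1,1]^c)=0,\ \mu(\{-1,1\})>0\}$. Define $$\nu(dy)=\theta\alpha y^{-\alpha-1}dy\ \text{ on }(0,\infty),\qquad K(y,M)=\mathcal Q\big(\pi_y^{-1}(M)\cap\tilde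 M\big),\qquad \lambda(M)=\int_0^\infty K(y,M)\,\nu(dy),$$ for $y>0$ and $M\in\mathcal M_p(E)$, where $\pi_y:M_0\to M_0$ is $\pi_y(\sum_j\delta_{t_j})=\sum_j\delta_{yt_j}$, so that $\lambda(M_x)=\nu(x,\infty)$ and $\lambda(M\cap M_x)=\int_x^\infty K(y,M)\nu(dy)$. Let $Y_{i,n}=\max_{j\in J_{i,n}}|\xi_j|/a_n$ and let $\xi_{1,n}=\sum_{j=1}^{r_n}\delta_{\xi_j/\max_{i\le r_n}|\xi_i|}$, a point process with values in $\tilde M$. Then the pair of conditions (1) $k_nP(\max_{j\le r_n}|\xi_j|>a_nx)\to\theta x^{-\alpha}$ for all $x>0$, (2) $P(\xi_{1,n}\in\cdot\ |\ \max_{j\le r_n}|\xi_j|>a_nx)\stackrel{w}{\to}\mathcal Q(\cdot)$ for all $x>0$, is equivalent to the pair of conditions (a) $\sum_{i=1}^{k_n}P(Y_{i,n}>x)\to\lambda(M_x)$ for every $x>0$, (b) $\sum_{i=1}^{k_n}P(Y_{i,n}>x,\ N_{i,n}\in M)\to\lambda(M\cap M_x)$ for every $x>0$ with $\lambda(M_x)>0$ and every $M\in\mathcal M_0$ such that $\lambda(\partial M\cap M_x)=0$.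
   Context: $\overline{\mathbb R}=\mathbb R\cup\{\pm\infty\}$. $\mathcal B$ is the class of relatively compact Borel subsets of $E=\overline{\mathbb R}\setminus\{0\}$ (so sets bounded away from $0$ are relatively compact). $M_p(E)$ is the set of Radon measures on $E$ taking values in $\mathbb Z_+$ on sets of $\mathcal B$, endowed with the topology of vague convergence ($\mu_n\to\mu$ iff $\mu_n(f)\to\mu(f)$ for all $f\in C_K^+(E)$, where $\mu(f)=\int f\,d\mu$ and $C_K^+(E)$ is the set of continuous compactly supported $f:E\to[0,\infty)$) and its Borel $\sigma$-field $\mathcal M_p(E)$. A point process on $E$ is a random element of $M_p(E)$. $\tilde M$ carries the subspace topology, and $\stackrel w\to$ is weak convergence of probability measures on $\tilde M$. Notation: $o$ is the null measure; $M_0=M_p(E)\setminus\{o\}$; $\mathcal M_0=\{M\in\mathcal M_p(E): M\subset M_0\}$; for $x>0$, $[-x,x]^c:=\{y\in E:|y|>x\}$ and $M_x=\{\mu\in M_0:\mu([-x,x]^c)>0\}$. $\partial M$ is the topological boundary of $M$; $[n/k_n]$ is the integer part. *)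

theory Defs
  imports "HOL-Probability.Probability"
begin

section \<open>Borel sets and weak convergence for an abstract topology\<close>

definition borel_of :: "'a topology \<Rightarrow> 'a measure" where
  "borel_of X = sigma (topspace X) {U. openin X U}"

definition weak_convergence_on :: "'a topology \<Rightarrow> (nat \<Rightarrow> 'a measure) \<Rightarrow> 'a measure \<Rightarrow> bool" where
  "weak_convergence_on X Ps Q \<longleftrightarrow>
     (\<forall>g :: 'a \<Rightarrow> real. continuous_map X euclideanreal g \<and> bounded (g ` topspace X)
        \<longrightarrow> (\<lambda>n. \<integral>x. g x \<partial>Ps n) \<longlonglongrightarrow> (\<integral>x. g x \<partial>Q))"


section \<open>Point measures on the punctured extended real line\<close>

definition E :: "ereal set" where
  "E = UNIV - {0}"

definition borel_E :: "ereal measure" where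
  "borel_E = restrict_space borel E"

text \<open>Relative compactness refers to the closure in \<^term>\<open>E\<close>, not in \<^typ>\<open>ereal\<close>: the
  members are the Borel sets bounded away from 0, and they may contain the points at infinity.\<close>

definition rel_compact_borel :: "ereal set set" where
  "rel_compact_borel =
     {B \<in> sets borel_E. compactin (top_of_set E) (top_of_set E closure_of B)}"

definition CK_plus :: "(ereal \<Rightarrow> real) set" where
  "CK_plus = {f. continuous_on E f \<and> (\<forall>x\<in>E. 0 \<le> f x) \<and>
     compactin (top_of_set E) (top_of_set E closure_of {x \<in> E. f x \<noteq> 0})}"

text \<open>A Radon measure is a Borel measure that is finite on compact sets; regularity is then
  automatic, since \<^term>\<open>E\<close> is locally compact with a countable base.\<close>

definition radon_E :: "ereal measure set" where
  "radon_E = {\<mu>. sets \<mu> = sets borel_E \<and> (\<forall>C. compactin (top_of_set E) C \<longrightarrow> emeasure \<mu> C < \<infinity>)}"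

definition Mp :: "ereal measure set" where
  "Mp = {\<mu> \<in> radon_E. \<forall>B\<in>rel_compact_borel. emeasure \<mu> B \<in> range (of_nat :: nat \<Rightarrow> ennreal)}"

text \<open>The coarsest topology on \<^term>\<open>Mp\<close> that makes every evaluation
  \<open>\<mu> \<mapsto> \<integral> f d\<mu>\<close> with \<open>f\<close> in \<^term>\<open>CK_plus\<close> continuous.\<close>

definition vague :: "ereal measure topology" where
  "vague = topology_generated_by
     {{\<mu> \<in> Mp. (\<integral>t. f t \<partial>\<mu>) \<in> U} | (f :: ereal \<Rightarrow> real) (U :: real set). f \<in> CK_plus \<and> open U}"

definition M0 :: "ereal measure set" where
  "M0 = Mp - {null_measure borel_E}"

definition meas_sets_M0 :: "ereal measure set set" where
  "meas_sets_M0 = {M \<in> sets (borel_of vague). M \<subseteq> M0}"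

definition outside :: "real \<Rightarrow> ereal set" where
  "outside x = {y \<in> E. \<bar>y\<bar> > ereal x}"

definition M_exceed :: "real \<Rightarrow> ereal measure set" where
  "M_exceed x = {\<mu> \<in> M0. emeasure \<mu> (outside x) > 0}"

definition Mtilde :: "ereal measure set" where
  "Mtilde = {\<mu> \<in> Mp. emeasure \<mu> (outside 1) = 0 \<and> emeasure \<mu> {-1, 1} > 0}"

text \<open>The sum over \<open>j \<in> J\<close> of the Dirac measures at \<open>x j\<close>, as the image of the counting measure
  on \<open>J\<close> under \<open>x\<close>; see \<open>emeasure_sum_dirac\<close> below.\<close>

definition sum_dirac :: "nat set \<Rightarrow> (nat \<Rightarrow> ereal) \<Rightarrow> ereal measure" where
  "sum_dirac J x = distr (count_space J) borel_E x"

text \<open>Multiplying every atom by \<open>y\<close> is taking the image measure under \<open>t \<mapsto> y t\<close>.\<close>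

definition scale :: "real \<Rightarrow> ereal measure \<Rightarrow> ereal measure" where
  "scale y \<mu> = distr \<mu> borel_E (\<lambda>t. ereal y * t)"

lemma emeasure_sum_dirac:
  assumes "finite J" "x ` J \<subseteq> E" "A \<in> sets borel_E"
  shows "emeasure (sum_dirac J x) A = (\<Sum>j\<in>J. emeasure (return borel_E (x j)) A)"
proof -
  have "x \<in> measurable (count_space J) borel_E"
    using assms(2) by (auto simp: borel_E_def space_restrict_space)
  then have "emeasure (sum_dirac J x) A = emeasure (count_space J) (x -` A \<inter> J)"
    using assms(3) by (simp add: sum_dirac_def emeasure_distr)
  also have "\<dots> = of_nat (card (x -` A \<inter> J))"
    using assms(1) by (simp add: emeasure_count_space)
  also have "\<dots> = (\<Sum>j\<in>J. indicator A (x j))"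
    using assms(1) by (simp add: indicator_def sum.If_cases vimage_def Int_commute Collect_conj_eq)
  finally show ?thesis
    using assms(3) by (simp add: emeasure_return)
qed

lemma topspace_vague: "topspace vague = Mp"
proof -
  have "(\<lambda>_. 0) \<in> CK_plus"
    by (simp add: CK_plus_def)
  then have "Mp \<in> {{\<mu> \<in> Mp. (\<integral>t. f t \<partial>\<mu>) \<in> U} | (f :: ereal \<Rightarrow> real) (U :: real set).
      f \<in> CK_plus \<and> open U}"
    by (intro CollectI exI[of _ "\<lambda>_. 0"] exI[of _ UNIV]) auto
  then show ?thesis
    unfolding vague_def topology_generated_by_topspace by blast
qed


section \<open>The limiting intensity\<close>

definition nu :: "real \<Rightarrow> real \<Rightarrow> real measure" where
  "nu \<theta> \<alpha> = density (restrict_space lborel {0<..}) (\<lambda>y. ennreal (\<theta> * \<alpha> * y powr (- \<alpha> - 1)))"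

definition K :: "ereal measure measure \<Rightarrow> real \<Rightarrow> ereal measure set \<Rightarrow> ennreal" where
  "K Q y M = emeasure Q ({\<mu> \<in> M0. scale y \<mu> \<in> M} \<inter> Mtilde)"

definition lam :: "real \<Rightarrow> real \<Rightarrow> ereal measure measure \<Rightarrow> ereal measure set \<Rightarrow> ennreal" where
  "lam \<theta> \<alpha> Q M = (\<integral>\<^sup>+ y. K Q y M \<partial>nu \<theta> \<alpha>)"


section \<open>Stationary, regularly varying sequences\<close>

text \<open>Sequences are indexed by the positive integers; the value at index 0 is irrelevant.\<close>

definition stationary :: "'a measure \<Rightarrow> (nat \<Rightarrow> 'a \<Rightarrow> real) \<Rightarrow> bool" where
  "stationary P \<xi> \<longleftrightarrow>
     (\<forall>h. distr P (PiM {1..} (\<lambda>_. borel)) (\<lambda>\<omega>. \<lambda>j\<in>{1..}. \<xi> (j + h) \<omega>) =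
          distr P (PiM {1..} (\<lambda>_. borel)) (\<lambda>\<omega>. \<lambda>j\<in>{1..}. \<xi> j \<omega>))"

definition slowly_varying :: "(real \<Rightarrow> real) \<Rightarrow> bool" where
  "slowly_varying L \<longleftrightarrow>
     L \<in> borel_measurable (restrict_space borel {0<..}) \<and>
     (\<forall>\<^sub>F x in at_top. L x > 0) \<and>
     (\<forall>c>0. ((\<lambda>x. L (c * x) / L x) \<longlongrightarrow> 1) at_top)"

definition block :: "nat \<Rightarrow> nat \<Rightarrow> nat set" where
  "block r i = {(i - 1) * r <.. i * r}"

definition max_abs :: "(nat \<Rightarrow> 'a \<Rightarrow> real) \<Rightarrow> nat set \<Rightarrow> 'a \<Rightarrow> real" where
  "max_abs \<xi> J \<omega> = Max ((\<lambda>j. \<bar>\<xi> j \<omega>\<bar>) ` J)"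

definition scaled_pp :: "(nat \<Rightarrow> 'a \<Rightarrow> real) \<Rightarrow> real \<Rightarrow> nat set \<Rightarrow> 'a \<Rightarrow> ereal measure" where
  "scaled_pp \<xi> c J \<omega> = sum_dirac J (\<lambda>j. ereal (\<xi> j \<omega> / c))"

definition self_normalized_pp :: "(nat \<Rightarrow> 'a \<Rightarrow> real) \<Rightarrow> nat \<Rightarrow> 'a \<Rightarrow> ereal measure" where
  "self_normalized_pp \<xi> r \<omega> = sum_dirac {1..r} (\<lambda>j. ereal (\<xi> j \<omega> / max_abs \<xi> {1..r} \<omega>))"

text \<open>\<^const>\<open>uniform_measure\<close> normalises the restriction of \<open>P\<close> to the given event, so this is the
  law of the self-normalised point process under \<open>P\<close> conditioned on that event.\<close>

definition cond_law_self_normalized ::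
    "'a measure \<Rightarrow> (nat \<Rightarrow> 'a \<Rightarrow> real) \<Rightarrow> nat \<Rightarrow> real \<Rightarrow> ereal measure measure" where
  "cond_law_self_normalized P \<xi> r u =
     distr (uniform_measure P {\<omega> \<in> space P. max_abs \<xi> {1..r} \<omega> > u})
       (borel_of (subtopology vague Mtilde)) (self_normalized_pp \<xi> r)"

end

theory Submission
  imports Defs
begin

text \<open>A point measure \<open>\<mu>\<close> that is neither null nor charges the points at infinity has a largest modulus
  \<open>y\<close> of its atoms, and \<open>\<mu> \<mapsto> (y, y\<^sup>-\<^sup>1\<mu>)\<close> is a homeomorphism onto \<open>(0,\<infinity>) \<times> Mtilde\<close>, under which
  \<open>\<lambda>\<close> is the product of \<open>\<nu>\<close> and \<open>Q\<close>. Stationarity turns the sums over blocks into \<open>k\<^sub>n\<close> times the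
  probability for the first block, whose polar coordinates are the normalized maximum and the
  self-normalized process; so (a) and (1) are the same statement. Given (1), condition (2) makes
  \<open>k\<^sub>n P((Y, Z) \<in> \<cdot>)\<close> converge on slabs \<open>(a, b] \<times> Mtilde\<close> to the product measure. An open set of
  point measures is exhausted by disjoint products of dyadic slabs with open subsets of \<open>Mtilde\<close>,
  which gives the lower bound of the portmanteau theorem for open sets, hence (b). Conversely, (b)
  for the sets where a continuous function \<open>g\<close> of the self-normalized process exceeds a level that \<open>g\<close> attains
  with \<open>Q\<close>-probability zero is convergence in distribution of that function, hence (2).\<close>

section \<open>Continuous functions with compact support and point measures\<close>

text \<open>The vague topology is given by a subbase only, so two tools that a metric would supply
  have to be made: measurability of point processes into its Borel field, and continuous functions
  that approach the indicator of an open set from below. Both come from a sequence of test functions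
  \<open>d i\<close>: every vaguely open set is the preimage, under \<mu> \<mapsto> (\<mu>(d i)), of
  an open set of real sequences.

  The points at infinity are the obstacle to polar coordinates, since a measure that charges them
  has no largest finite modulus. Hence the open set \<open>Mfin\<close>: it contains all nonempty
  finite sums of Dirac measures at nonzero reals and all positive multiples of elements of
  \<open>Mtilde\<close>, so both the processes and the limit live there.

  Lower bounds for open sets are enough for (b): the total mass of the exceedances converges by (1),
  so lower bounds for the interior and the exterior of M leave no room for M to deviate. The
  exhaustion by dyadic slabs also shows that K(y, G) is measurable in y for open G, and the frontier
  is reached from there by subtraction.\<close>

definition away :: "real \<Rightarrow> ereal set" where
  "away c = {t. ereal c \<le> \<bar>t\<bar>}"

lemma space_borel_E [simp]: "space borel_E = E"
  by (simp add: borel_E_def space_restrict_space)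

lemma open_E: "open E"
  by (simp add: E_def open_delete)

lemma sets_borel_E_iff: "A \<in> sets borel_E \<longleftrightarrow> A \<in> sets borel \<and> A \<subseteq> E"
  using open_E by (auto simp: borel_E_def sets_restrict_space_iff)

lemma closed_away: "closed (away c)"
proof -
  have "closed {t::ereal. ereal c \<le> \<bar>t\<bar>}"
    by (intro closed_Collect_le continuous_intros)
  then show ?thesis by (simp add: away_def)
qed

lemma away_subset_E: "c > 0 \<Longrightarrow> away c \<subseteq> E"
  by (auto simp: away_def E_def)

lemma away_mono: "c \<le> d \<Longrightarrow> away d \<subseteq> away c"
  by (auto simp: away_def intro: order_trans[of "ereal c" "ereal d"])

lemma away_in_sets: "c > 0 \<Longrightarrow> away c \<in> sets borel_E"
  using closed_away away_subset_E by (auto simp: sets_borel_E_iff)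

lemma outside_in_sets: "outside c \<in> sets borel_E"
proof -
  have "open {t::ereal. ereal c < \<bar>t\<bar>}"
    by (intro open_Collect_less continuous_intros)
  then have "open ({t::ereal. ereal c < \<bar>t\<bar>} \<inter> E)"
    using open_E by blast
  moreover have "outside c = {t::ereal. ereal c < \<bar>t\<bar>} \<inter> E"
    by (auto simp: outside_def)
  ultimately show ?thesis by (auto simp: sets_borel_E_iff)
qed

lemma outside_subset_away: "outside c \<subseteq> away c"
  by (auto simp: outside_def away_def)

lemma compactin_E: "compactin (top_of_set E) C \<longleftrightarrow> C \<subseteq> E \<and> compact C"
  by (simp add: compactin_subtopology conj_commute)

text \<open>\<open>ereal\<close> is compact, so a subset of \<open>E\<close> is compact exactly when
  it is closed in \<open>ereal\<close>; closed and missing 0, it misses an interval around 0. From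
  here on the concrete sets \<open>away c\<close>, which contain both infinities, stand for
  compactness in \<open>E\<close>.\<close>

lemma compact_closure_E_iff:
  assumes "S \<subseteq> E"
  shows "compactin (top_of_set E) (top_of_set E closure_of S) \<longleftrightarrow> (\<exists>c>0. S \<subseteq> away c)"
proof
  let ?C = "top_of_set E closure_of S"
  assume "compactin (top_of_set E) ?C"
  then have "?C \<subseteq> E" "compact ?C"
    by (simp_all add: compactin_E)
  then have "open (- ?C)" "0 \<in> - ?C"
    by (auto simp: E_def compact_imp_closed open_closed)
  then obtain e where e: "e > 0" "{0-e<..<0+e} \<subseteq> - ?C"
    using ereal_open_cont_interval[of "- ?C" 0] by auto
  then obtain c where c: "0 < ereal c" "ereal c < e"
    using ereal_dense2[of 0 e] by (metis order_less_trans)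
  have "S \<subseteq> ?C"
    using assms by (simp add: closure_of_subset)
  have "\<bar>t\<bar> \<ge> ereal c" if "t \<in> S" for t
  proof (rule ccontr)
    assume "\<not> ?thesis"
    then have "\<bar>t\<bar> < e" using c by simp
    then have "t \<in> {0-e<..<0+e}" by (cases t; cases e) (auto simp: abs_less_iff)
    with e \<open>S \<subseteq> ?C\<close> that show False by blast
  qed
  then show "\<exists>c>0. S \<subseteq> away c"
    using c by (auto simp: away_def)
next
  assume "\<exists>c>0. S \<subseteq> away c"
  then obtain c where c: "c > 0" "S \<subseteq> away c" by blast
  have "closure S \<subseteq> away c"
    using c closed_away by (simp add: closure_minimal)
  then have "top_of_set E closure_of S = closure S"
    using assms away_subset_E[OF c(1)] by (auto simp: closure_of_subtopology Int_absorb1)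
  moreover have "compact (closure S)"
    by (simp add: compact_eq_closed)
  ultimately show "compactin (top_of_set E) (top_of_set E closure_of S)"
    using \<open>closure S \<subseteq> away c\<close> away_subset_E[OF c(1)] by (simp add: compactin_E)
qed

lemma rel_compact_borel_iff:
  "B \<in> rel_compact_borel \<longleftrightarrow> B \<in> sets borel_E \<and> (\<exists>c>0. B \<subseteq> away c)"
  using compact_closure_E_iff[of B] sets_borel_E_iff by (auto simp: rel_compact_borel_def)

lemma CK_plus_iff:
  "f \<in> CK_plus \<longleftrightarrow> continuous_on E f \<and> (\<forall>t\<in>E. 0 \<le> f t) \<and> (\<exists>c>0. \<forall>t\<in>E. f t \<noteq> 0 \<longrightarrow> t \<in> away c)"
  using compact_closure_E_iff[of "{x \<in> E. f x \<noteq> 0}"] by (auto simp: CK_plus_def subset_eq)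

lemma CK_plus_measurable: "f \<in> CK_plus \<Longrightarrow> f \<in> borel_measurable borel_E"
  by (simp add: CK_plus_iff borel_E_def borel_measurable_continuous_on_restrict)

text \<open>The support lies in some \<open>away c\<close>, which is compact because it is closed in
  \<open>ereal\<close>; outside it \<open>f\<close> is 0, whence the bound
  \<open>max C 0\<close>.\<close>

lemma CK_plus_bounded:
  assumes "f \<in> CK_plus"
  shows "\<exists>C\<ge>0. \<forall>t\<in>E. f t \<le> C"
proof -
  obtain c where c: "c > 0" "\<forall>t\<in>E. f t \<noteq> 0 \<longrightarrow> t \<in> away c" and "continuous_on E f"
    using assms by (auto simp: CK_plus_iff)
  then have "continuous_on (away c) f"
    using away_subset_E continuous_on_subset by blast
  then have "compact (f ` away c)"
    using closed_away by (intro compact_continuous_image) (auto simp: compact_eq_closed)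
  then have "bounded (f ` away c)" by (rule compact_imp_bounded)
  then obtain C where "\<forall>t\<in>away c. \<bar>f t\<bar> \<le> C"
    by (auto simp: bounded_iff)
  then have "\<forall>t\<in>E. f t \<le> max C 0"
    using c by (metis abs_le_D1 max.coboundedI1 max.coboundedI2 order_refl)
  then show ?thesis
    by (intro exI[of _ "max C 0"]) auto
qed

lemma of_nat_less_top_ennreal: "x \<in> range (of_nat :: nat \<Rightarrow> ennreal) \<Longrightarrow> x < \<infinity>"
  by (auto simp: of_nat_less_top)

text \<open>Compact subsets of \<open>E\<close> are Borel and bounded away from 0, so their masses
  are natural numbers and hence finite.\<close>

lemma Mp_iff:
  "\<mu> \<in> Mp \<longleftrightarrow> sets \<mu> = sets borel_E \<and>
     (\<forall>B\<in>sets borel_E. \<forall>c>0. B \<subseteq> away c \<longrightarrow> emeasure \<mu> B \<in> range (of_nat :: nat \<Rightarrow> ennreal))"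
proof -
  have "emeasure \<mu> C < \<infinity>" if "compactin (top_of_set E) C" and
    *: "\<forall>B\<in>sets borel_E. \<forall>c>0. B \<subseteq> away c \<longrightarrow> emeasure \<mu> B \<in> range (of_nat :: nat \<Rightarrow> ennreal)" for C
  proof -
    have C: "C \<subseteq> E" "compact C" using that by (auto simp: compactin_E)
    then have "top_of_set E closure_of C = C"
      by (simp add: closure_of_closedin closed_subset compact_imp_closed)
    with that C obtain c where "c > 0" "C \<subseteq> away c"
      using compact_closure_E_iff[of C] by auto
    moreover have "C \<in> sets borel_E"
      using C by (auto simp: sets_borel_E_iff intro: borel_compact)
    ultimately show ?thesis using * of_nat_less_top_ennreal by blast
  qed
  then show ?thesis
    by (auto simp: Mp_def radon_E_def rel_compact_borel_iff)
qed

lemma sets_Mp: "\<mu> \<in> Mp \<Longrightarrow> sets \<mu> = sets borel_E"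
  by (simp add: Mp_iff)

lemma space_Mp: "\<mu> \<in> Mp \<Longrightarrow> space \<mu> = E"
  using sets_eq_imp_space_eq[of \<mu> borel_E] by (simp add: sets_Mp)

lemma Mp_finite:
  assumes "\<mu> \<in> Mp" "c > 0" "B \<in> sets borel_E" "B \<subseteq> away c"
  shows "emeasure \<mu> B < \<infinity>"
  using assms by (intro of_nat_less_top_ennreal) (auto simp: Mp_iff)

text \<open>The way integrality is exploited: a bound below 1, read off from a limit or from the
  integral of a test function, already forces mass 0.\<close>

lemma Mp_less_one_imp_zero:
  assumes "\<mu> \<in> Mp" "c > 0" "B \<in> sets borel_E" "B \<subseteq> away c" "emeasure \<mu> B < 1"
  shows "emeasure \<mu> B = 0"
proof -
  have "emeasure \<mu> B \<in> range (of_nat :: nat \<Rightarrow> ennreal)"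
    using assms(1-4) unfolding Mp_iff by blast
  then obtain n where "emeasure \<mu> B = of_nat n" by blast
  with assms(5) show ?thesis by (cases n) auto
qed

lemma CK_plus_integrable:
  assumes "\<mu> \<in> Mp" "f \<in> CK_plus"
  shows "integrable \<mu> f"
proof -
  obtain c where c: "c > 0" "\<forall>t\<in>E. f t \<noteq> 0 \<longrightarrow> t \<in> away c"
    using assms(2) by (auto simp: CK_plus_iff)
  obtain C where C: "\<forall>t\<in>E. f t \<le> C"
    using CK_plus_bounded[OF assms(2)] by auto
  have [measurable]: "f \<in> borel_measurable \<mu>"
    using CK_plus_measurable[OF assms(2)] measurable_cong_sets[OF sets_Mp[OF assms(1)] refl] by blast
  show ?thesis
  proof (rule integrableI_bounded_set[where A = "away c" and B = C, OF _ \<open>f \<in> borel_measurable \<mu>\<close>])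
    show "away c \<in> sets \<mu>" using away_in_sets[OF c(1)] sets_Mp[OF assms(1)] by simp
    show "emeasure \<mu> (away c) < \<infinity>"
      using Mp_finite[OF assms(1) c(1) away_in_sets[OF c(1)]] by simp
    show "AE t in \<mu>. t \<in> away c \<longrightarrow> norm (f t) \<le> C"
      using assms C by (intro AE_I2) (auto simp: space_Mp CK_plus_iff)
    show "AE t in \<mu>. t \<notin> away c \<longrightarrow> f t = 0"
      using assms c by (intro AE_I2) (auto simp: space_Mp)
  qed
qed

text \<open>The clamp to [a, b] precedes the conversion because \<open>real_of_ereal\<close> sends
  both infinities to 0; in this order the function is continuous at infinity, with value 1
  there.\<close>

definition ramp :: "real \<Rightarrow> real \<Rightarrow> ereal \<Rightarrow> real" where
  "ramp a b t = (real_of_ereal (max (ereal a) (min (ereal b) \<bar>t\<bar>)) - a) / (b - a)"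

lemma ramp_props:
  assumes "0 < a" "a < b"
  shows "ramp a b \<in> CK_plus" "0 \<le> ramp a b t" "ramp a b t \<le> 1"
    "\<bar>t\<bar> \<le> ereal a \<Longrightarrow> ramp a b t = 0" "\<bar>t\<bar> \<ge> ereal b \<Longrightarrow> ramp a b t = 1"
    "\<bar>t\<bar> > ereal a \<Longrightarrow> ramp a b t > 0"
proof -
  let ?m = "\<lambda>t. max (ereal a) (min (ereal b) \<bar>t\<bar>)"
  have m: "ereal a \<le> ?m t" "?m t \<le> ereal b" for t
    using assms by auto
  have fin: "\<bar>?m t\<bar> \<noteq> \<infinity>" for t
    using m[of t] by (metis ereal_infty_less_eq(1) ereal_infty_less_eq(2) MInfty_neq_ereal(1)
        PInfty_neq_ereal(1) abs_ereal.elims)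
  have rm: "a \<le> real_of_ereal (?m t)" "real_of_ereal (?m t) \<le> b" for t
    using m[of t] fin[of t] by (metis ereal_less_eq(3) ereal_real')+
  show nonneg: "0 \<le> ramp a b t" for t using rm[of t] assms by (simp add: ramp_def)
  show "ramp a b t \<le> 1" using rm[of t] assms by (simp add: ramp_def)
  show zero: "ramp a b t = 0" if "\<bar>t\<bar> \<le> ereal a" for t
  proof -
    have "\<bar>t\<bar> \<le> ereal b" using that assms by (meson ereal_less_eq(3) less_imp_le order_trans)
    then have "?m t = ereal a" using that by (simp add: max_def min_def)
    then show ?thesis unfolding ramp_def by simp
  qed
  show "ramp a b t = 1" if "\<bar>t\<bar> \<ge> ereal b"
  proof -
    have "?m t = ereal b" using that assms by (auto simp: max_def min_def)
    then show ?thesis using assms unfolding ramp_def by simp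
  qed
  show "ramp a b t > 0" if "\<bar>t\<bar> > ereal a"
  proof -
    have "?m t > ereal a" using that assms by (auto simp: max_def min_def)
    then have "real_of_ereal (?m t) > a"
      using fin[of t] by (metis ereal_real' less_ereal.simps(1))
    then show ?thesis unfolding ramp_def using assms by simp
  qed
  have "continuous_on UNIV (\<lambda>t. real_of_ereal (?m t))"
  proof (intro continuous_at_imp_continuous_on ballI)
    fix t :: ereal
    have "continuous_on UNIV ?m" by (intro continuous_intros)
    then have "isCont ?m t" by (simp add: continuous_on_eq_continuous_at)
    then have "(?m \<longlongrightarrow> ereal (real_of_ereal (?m t))) (at t)"
      using fin[of t] by (simp add: isCont_def ereal_real')
    then show "isCont (\<lambda>t. real_of_ereal (?m t)) t"
      unfolding isCont_def by (rule lim_real_of_ereal)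
  qed
  then have "continuous_on UNIV (ramp a b)"
    unfolding ramp_def using assms by (intro continuous_intros) auto
  then have "continuous_on E (ramp a b)" using continuous_on_subset by blast
  moreover have "\<forall>t\<in>E. ramp a b t \<noteq> 0 \<longrightarrow> t \<in> away a"
    using zero by (force simp: away_def)
  ultimately show "ramp a b \<in> CK_plus"
    using nonneg assms by (auto simp: CK_plus_iff)
qed

lemma vague_integral_open:
  assumes "f \<in> CK_plus" "open U"
  shows "openin vague {\<mu> \<in> Mp. (\<integral>t. f t \<partial>\<mu>) \<in> U}"
  unfolding vague_def using assms by (intro topology_generated_by_Basis) blast

lemma continuous_map_vague_integral:
  assumes "f \<in> CK_plus"
  shows "continuous_map vague euclideanreal (\<lambda>\<mu>. \<integral>t. f t \<partial>\<mu>)"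
  using vague_integral_open[OF assms] by (auto simp: continuous_map_def topspace_vague)

lemma continuous_map_into_vague:
  assumes "\<And>x. x \<in> topspace X \<Longrightarrow> h x \<in> Mp"
    and "\<And>f. f \<in> CK_plus \<Longrightarrow> continuous_map X euclideanreal (\<lambda>x. \<integral>t. f t \<partial>h x)"
  shows "continuous_map X vague h"
  unfolding vague_def
proof (rule continuous_on_generated_topo)
  fix U assume "U \<in> {{\<mu> \<in> Mp. (\<integral>t. f t \<partial>\<mu>) \<in> U} |f U. f \<in> CK_plus \<and> open U}"
  then obtain f V where U: "U = {\<mu> \<in> Mp. (\<integral>t. f t \<partial>\<mu>) \<in> V}" "f \<in> CK_plus" "open V" by blast
  have "h -` U \<inter> topspace X = {x \<in> topspace X. (\<integral>t. f t \<partial>h x) \<in> V}"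
    using assms(1) U by auto
  then show "openin X (h -` U \<inter> topspace X)"
    using openin_continuous_map_preimage[OF assms(2)[OF U(2)]] U(3) by simp
next
  show "h ` topspace X \<subseteq> \<Union> {{\<mu> \<in> Mp. (\<integral>t. f t \<partial>\<mu>) \<in> U} |f U. f \<in> CK_plus \<and> open U}"
  proof -
    have "Mp \<subseteq> topspace (topology_generated_by {{\<mu> \<in> Mp. (\<integral>t. f t \<partial>\<mu>) \<in> U} |f U. f \<in> CK_plus \<and> open U})"
      using topspace_vague by (simp add: vague_def)
    then show ?thesis using assms(1) unfolding topology_generated_by_topspace by blast
  qed
qed

section \<open>A countable subbase of the vague topology\<close>

lemma Hausdorff_euclidean: "Hausdorff_space (euclidean :: 'a::t2_space topology)"
  unfolding Hausdorff_space_def disjnt_def by simp (meson hausdorff)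

text \<open>At a point x take a rational r between q and f(x) and multiply it by a Urysohn function
  that is 1 near x and 0 off {r < f}: the product stays below \<open>f\<close> and exceeds q at x.
  Urysohn functions exist since \<open>ereal\<close> is compact Hausdorff, and selecting one per
  pair of basic open sets keeps the family countable.\<close>

lemma countable_lower_family:
  "\<exists>D \<subseteq> CK_plus. countable D \<and>
     (\<forall>f\<in>CK_plus. \<forall>x\<in>E. \<forall>q<f x. \<exists>g\<in>D. (\<forall>t\<in>E. g t \<le> f t) \<and> q < g x)"
proof -
  obtain B :: "ereal set set" where B: "countable B" "topological_basis B"
    using ex_countable_basis by blast
  define is_bump where "is_bump U V \<phi> \<longleftrightarrow> continuous_on UNIV \<phi> \<and> (\<forall>t. 0 \<le> \<phi> t \<and> \<phi> t \<le> 1) \<and>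
    (\<forall>t\<in>V. \<phi> t = 1) \<and> (\<forall>t. t \<notin> U \<longrightarrow> \<phi> t = 0)" for U V :: "ereal set" and \<phi> :: "ereal \<Rightarrow> real"
  define bump where "bump U V = (SOME \<phi>. is_bump U V \<phi>)" for U V
  have normal: "normal_space (euclidean :: ereal topology)"
    by (intro compact_Hausdorff_or_regular_imp_normal_space)
       (simp_all add: compact_space_def compact_UNIV Hausdorff_euclidean)
  have bump: "is_bump U V (bump U V)" if "open U" "closure V \<subseteq> U" for U V
  proof -
    have "\<exists>\<phi>. is_bump U V \<phi>"
    proof -
      have "closedin euclidean (- U)" "closedin euclidean (closure V)" "disjnt (- U) (closure V)"
        using that by (auto simp: disjnt_def)
      then obtain \<phi> where "continuous_map euclidean (top_of_set {0..1::real}) \<phi>" "\<phi> ` (- U) \<subseteq> {0}" "\<phi> ` closure V \<subseteq> {1}"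
        using Urysohn_lemma[OF normal, of "- U" "closure V" 0 1] by (metis zero_le_one)
      then have "is_bump U V \<phi>"
        unfolding is_bump_def using closure_subset[of V]
        by (auto simp: continuous_map_in_subtopology image_subset_iff)
      then show ?thesis by blast
    qed
    then show ?thesis unfolding bump_def by (rule someI_ex)
  qed
  \<comment> \<open>For pairs without \<open>closure V \<subseteq> U\<close> the function chosen by
    \<open>SOME\<close> is arbitrary; restricting to \<open>CK_plus\<close> discards the bad ones.
    The zero function serves the case q < 0.\<close>
  define D where "D = {g \<in> CK_plus. \<exists>r\<in>\<rat>. \<exists>U\<in>B. \<exists>V\<in>B. g = (\<lambda>t. r * bump U V t)} \<union> {\<lambda>_. 0}"
  have zero: "(\<lambda>_. 0) \<in> CK_plus" by (auto simp: CK_plus_iff intro: exI[of _ 1])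
  have "countable {g. \<exists>r\<in>\<rat>. \<exists>U\<in>B. \<exists>V\<in>B. g = (\<lambda>t. r * bump U V t)}"
  proof -
    have "{g. \<exists>r\<in>\<rat>. \<exists>U\<in>B. \<exists>V\<in>B. g = (\<lambda>t. r * bump U V t)} =
        (\<lambda>(r, U, V). (\<lambda>t. r * bump U V t)) ` (\<rat> \<times> B \<times> B)" by force
    moreover have "countable (\<rat> \<times> B \<times> B :: (real \<times> ereal set \<times> ereal set) set)"
      using B countable_rat by (intro countable_SIGMA) auto
    ultimately show ?thesis by (simp only: countable_image)
  qed
  then have D1: "countable D"
    unfolding D_def by (auto intro: countable_subset[rotated])
  have D2: "D \<subseteq> CK_plus" using zero by (auto simp: D_def)
  have main: "\<exists>g\<in>D. (\<forall>t\<in>E. g t \<le> f t) \<and> q < g x" if f: "f \<in> CK_plus" and x: "x \<in> E" and q: "q < f x" for f x q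
  proof (cases "q < 0")
    case True
    then show ?thesis using f by (intro bexI[of _ "\<lambda>_. 0"]) (auto simp: D_def CK_plus_iff)
  next
    case False
    obtain r where r: "r \<in> \<rat>" "q < r" "r < f x" using q Rats_dense_in_real by blast
    have "continuous_on E f" using f by (simp add: CK_plus_iff)
    then have "open (f -` {r<..} \<inter> E)"
      using continuous_on_open_vimage[OF open_E, of f] open_greaterThan by blast
    moreover have "f -` {r<..} \<inter> E = {t\<in>E. r < f t}" by auto
    ultimately have "open {t\<in>E. r < f t}" by simp
    then obtain U where U: "U \<in> B" "x \<in> U" "U \<subseteq> {t\<in>E. r < f t}"
      using B(2) x r by (metis (mono_tags, lifting) mem_Collect_eq topological_basisE)
    have "open U" using U(1) B(2) topological_basis_open by blast
    \<comment> \<open>Regularity puts a closed set between a neighbourhood of x and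
      \<open>U\<close>, which is what makes the closure of the smaller basic set \<open>V\<close>
      lie inside \<open>U\<close>.\<close>
    have "regular_space (euclidean :: ereal topology)"
      using normal by (simp add: normal_t1_imp_regular_space Hausdorff_imp_t1_space Hausdorff_euclidean)
    then obtain W C where W: "open W" "closed C" "x \<in> W" "W \<subseteq> C" "C \<subseteq> U"
      using \<open>open U\<close> U(2) unfolding neighbourhood_base_of_closedin[symmetric] neighbourhood_base_of
      by (metis closed_closedin open_openin)
    obtain V where V: "V \<in> B" "x \<in> V" "V \<subseteq> W"
      using B(2) W by (meson topological_basisE)
    have "closure V \<subseteq> U" using V W by (meson closure_minimal order_trans)
    then have b: "is_bump U V (bump U V)" using bump \<open>open U\<close> by blast
    define g where "g = (\<lambda>t. r * bump U V t)"
    have gf: "g t \<le> f t" if "t \<in> E" for t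
    proof (cases "t \<in> U")
      case True
      then have "r < f t" using U by auto
      moreover have "g t \<le> r * 1" unfolding g_def using False r b
        by (intro mult_left_mono) (auto simp: is_bump_def)
      ultimately show ?thesis by simp
    next
      case False
      then show ?thesis using b f that by (simp add: g_def is_bump_def CK_plus_iff)
    qed
    have "continuous_on E g" unfolding g_def using b
      by (intro continuous_intros) (auto simp: is_bump_def intro: continuous_on_subset)
    moreover have g0: "0 \<le> g t" for t
      unfolding g_def using False r b by (intro mult_nonneg_nonneg) (auto simp: is_bump_def)
    moreover obtain c where "c > 0" "\<forall>t\<in>E. f t \<noteq> 0 \<longrightarrow> t \<in> away c"
      using f by (auto simp: CK_plus_iff)
    moreover have "\<forall>t\<in>E. g t \<noteq> 0 \<longrightarrow> f t \<noteq> 0" using gf g0 by (metis order_antisym)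
    ultimately have "g \<in> CK_plus" unfolding CK_plus_iff by blast
    then have "g \<in> D" using r(1) U(1) V(1) unfolding D_def g_def by blast
    moreover have "q < g x" using b V r by (simp add: g_def is_bump_def)
    ultimately show ?thesis using gf by blast
  qed
  show ?thesis by (intro exI[of _ D] conjI ballI allI impI D1 D2 main)
qed

text \<open>The base value 0 does not affect maxima of nonnegative functions and keeps the empty
  list inside \<open>CK_plus\<close>.\<close>

fun max_list_fun :: "('a \<Rightarrow> real) list \<Rightarrow> 'a \<Rightarrow> real" where
  "max_list_fun [] t = 0"
| "max_list_fun (g # gs) t = max (g t) (max_list_fun gs t)"

lemma max_list_fun_le_iff: "max_list_fun gs t \<le> y \<longleftrightarrow> 0 \<le> y \<and> (\<forall>g\<in>set gs. g t \<le> y)"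
  by (induction gs) auto

lemma CK_plus_max:
  assumes "f \<in> CK_plus" "g \<in> CK_plus"
  shows "(\<lambda>t. max (f t) (g t)) \<in> CK_plus"
proof -
  obtain c d where "c > 0" "d > 0" "\<forall>t\<in>E. f t \<noteq> 0 \<longrightarrow> t \<in> away c" "\<forall>t\<in>E. g t \<noteq> 0 \<longrightarrow> t \<in> away d"
    using assms unfolding CK_plus_iff by blast
  then have "\<forall>t\<in>E. max (f t) (g t) \<noteq> 0 \<longrightarrow> t \<in> away (min c d)" "min c d > 0"
    using away_mono[of "min c d" c] away_mono[of "min c d" d] by (auto simp: max_def)
  then show ?thesis
    using assms unfolding CK_plus_iff
    by (intro conjI continuous_intros ballI exI[of _ "min c d"]) (auto simp: max.coboundedI1)
qed

lemma max_list_fun_CK_plus: "set gs \<subseteq> CK_plus \<Longrightarrow> max_list_fun gs \<in> CK_plus"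
proof (induction gs)
  case Nil
  have "max_list_fun [] = (\<lambda>_::ereal. 0)" by auto
  then show ?case by (auto simp: CK_plus_iff intro: exI[of _ 1])
next
  case (Cons g gs)
  have "max_list_fun (g # gs) = (\<lambda>t. max (g t) (max_list_fun gs t))" by auto
  then show ?case using Cons CK_plus_max by simp
qed

text \<open>\<open>f\<close> is the pointwise supremum of the members of the lower family below it;
  finite maxima along an enumeration of these members increase to \<open>f\<close>. Finite lists
  over a countable set are countable.\<close>

lemma countable_monotone_family:
  "\<exists>D \<subseteq> CK_plus. countable D \<and>
     (\<forall>f\<in>CK_plus. \<exists>F::nat \<Rightarrow> ereal \<Rightarrow> real. range F \<subseteq> D \<and>
        (\<forall>t\<in>E. (\<forall>n. F n t \<le> f t) \<and> (\<lambda>n. F n t) \<longlonglongrightarrow> f t))"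
proof -
  obtain D0 where D0: "D0 \<subseteq> CK_plus" "countable D0"
    "\<And>f x q. f\<in>CK_plus \<Longrightarrow> x\<in>E \<Longrightarrow> q<f x \<Longrightarrow> \<exists>g\<in>D0. (\<forall>t\<in>E. g t \<le> f t) \<and> q < g x"
    using countable_lower_family by metis
  define D where "D = max_list_fun ` lists D0"
  have D1: "D \<subseteq> CK_plus"
    unfolding D_def using D0(1) by (intro image_subsetI max_list_fun_CK_plus) auto
  have D2: "countable D" unfolding D_def using D0 by auto
  have main: "\<exists>F::nat \<Rightarrow> ereal \<Rightarrow> real. range F \<subseteq> D \<and>
        (\<forall>t\<in>E. (\<forall>n. F n t \<le> f t) \<and> (\<lambda>n. F n t) \<longlonglongrightarrow> f t)" if f: "f \<in> CK_plus" for f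
  proof -
    define S where "S = {g\<in>D0. \<forall>t\<in>E. g t \<le> f t}"
    \<comment> \<open>Any point of \<open>E\<close> would do: it serves to show that
      \<open>S\<close> is nonempty, so that \<open>from_nat_into\<close> enumerates it.\<close>
    have "1 \<in> E" by (simp add: E_def)
    then have "S \<noteq> {}" using D0(3)[OF f, of 1 "f 1 - 1"] by (auto simp: S_def)
    moreover have "countable S" using D0 by (auto simp: S_def intro: countable_subset)
    ultimately have e: "range (from_nat_into S) = S" by (rule range_from_nat_into)
    define e where "e = from_nat_into S"
    note e = e[folded e_def]
    define F where "F n = max_list_fun (map e [0..<n])" for n
    have "set (map e [0..<n]) \<subseteq> D0" for n using e by (auto simp: S_def)
    then have "range F \<subseteq> D" unfolding F_def D_def by (intro image_subsetI imageI) (metis in_listsI subsetD)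
    moreover have le: "F n t \<le> f t" if "t \<in> E" for n t
      using e that f by (auto simp: F_def max_list_fun_le_iff S_def CK_plus_iff)
    moreover have "(\<lambda>n. F n t) \<longlonglongrightarrow> f t" if t: "t \<in> E" for t
    proof (rule order_tendstoI)
      fix a assume "a < f t"
      then obtain g where "g \<in> S" "a < g t" using D0(3)[OF f t] by (auto simp: S_def)
      then obtain i where i: "a < e i t" using e by (metis rangeE)
      have "a < F n t" if "n \<ge> Suc i" for n
      proof -
        have "e i t \<le> F n t"
          using max_list_fun_le_iff[of "map e [0..<n]" t "F n t"] that by (auto simp: F_def)
        then show ?thesis using i by simp
      qed
      then show "\<forall>\<^sub>F n in sequentially. a < F n t" by (auto simp: eventually_sequentially)
    next
      fix a assume "f t < a"
      then show "\<forall>\<^sub>F n in sequentially. F n t < a"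
        by (intro always_eventually allI le_less_trans[OF le[OF t]])
    qed
    ultimately show ?thesis by blast
  qed
  show ?thesis by (intro exI[of _ D] conjI ballI D1 D2 main)
qed

lemma CK_plus_integral_convergence:
  assumes "\<mu> \<in> Mp" "f \<in> CK_plus" "range F \<subseteq> CK_plus"
    and "\<And>t n. t \<in> E \<Longrightarrow> F n t \<le> f t" "\<And>t. t \<in> E \<Longrightarrow> (\<lambda>n. F n t) \<longlonglongrightarrow> f t"
  shows "(\<lambda>n. \<integral>t. F n t \<partial>\<mu>) \<longlonglongrightarrow> (\<integral>t. f t \<partial>\<mu>)"
proof (rule integral_dominated_convergence[where w = f])
  show "f \<in> borel_measurable \<mu>" "integrable \<mu> f"
    using CK_plus_integrable[OF assms(1,2)] by auto
  show "F n \<in> borel_measurable \<mu>" for n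
    using CK_plus_integrable[OF assms(1), of "F n"] assms(3) by auto
  show "AE t in \<mu>. (\<lambda>n. F n t) \<longlonglongrightarrow> f t"
    using assms by (auto simp: space_Mp)
  show "AE t in \<mu>. norm (F n t) \<le> f t" for n
  proof -
    have "F n \<in> CK_plus" using assms(3) by auto
    then show ?thesis using assms by (auto simp: space_Mp CK_plus_iff)
  qed
qed

text \<open>The family \<open>d\<close> approximates every \<open>f\<close> from below, so \<open>\<mu> \<mapsto> \<mu>(f)\<close> is lower semicontinuous in the
  topology it generates; applied to \<open>C h - f\<close> with a plateau function \<open>h\<close> of the family, the same
  gives upper semicontinuity.\<close>

lemma vague_embedding:
  "\<exists>d :: nat \<Rightarrow> ereal \<Rightarrow> real. range d \<subseteq> CK_plus \<and>
     (\<forall>S. openin vague S \<longrightarrow> (\<exists>V. open V \<and> S = {\<mu> \<in> Mp. (\<lambda>i. \<integral>t. d i t \<partial>\<mu>) \<in> V}))"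
proof -
  obtain D0 where D0: "D0 \<subseteq> CK_plus" "countable D0"
    "\<And>f. f\<in>CK_plus \<Longrightarrow> \<exists>F::nat \<Rightarrow> ereal \<Rightarrow> real. range F \<subseteq> D0 \<and>
        (\<forall>t\<in>E. (\<forall>n. F n t \<le> f t) \<and> (\<lambda>n. F n t) \<longlonglongrightarrow> f t)"
    using countable_monotone_family by metis
  \<comment> \<open>Plateau functions whose plateaus exhaust \<open>E\<close>: for each
    \<open>f\<close> in \<open>CK_plus\<close> some \<open>R n\<close> equals 1 on the support of
    \<open>f\<close>.\<close>
  define R where "R n = ramp (1 / real (n + 2)) (1 / real (n + 1))" for n
  have R: "R n \<in> CK_plus" "\<And>t. 0 \<le> R n t" "\<And>t. ereal (1 / real (n + 1)) \<le> \<bar>t\<bar> \<Longrightarrow> R n t = 1" for n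
    unfolding R_def by (rule ramp_props; simp add: frac_less2)+
  define D where "D = D0 \<union> range R"
  have "countable D" "D \<noteq> {}" "D \<subseteq> CK_plus" using D0 R by (auto simp: D_def)
  then have d: "range (from_nat_into D) = D" by (intro range_from_nat_into)
  define d where "d = from_nat_into D"
  note d = d[folded d_def]
  define \<Phi> where "\<Phi> \<mu> = (\<lambda>i. \<integral>t. d i t \<partial>\<mu>)" for \<mu>
  define good where "good S \<longleftrightarrow> (\<exists>V. open V \<and> S = {\<mu> \<in> Mp. \<Phi> \<mu> \<in> V})" for S
  have good_Int: "good (S \<inter> T)" if S: "good S" and T: "good T" for S T
  proof -
    obtain V where V: "open V" "S = {\<mu> \<in> Mp. \<Phi> \<mu> \<in> V}"
      using S unfolding good_def by blast
    obtain W where W: "open W" "T = {\<mu> \<in> Mp. \<Phi> \<mu> \<in> W}"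
      using T unfolding good_def by blast
    show ?thesis unfolding good_def V(2) W(2) using V(1) W(1) by (intro exI[of _ "V \<inter> W"]) auto
  qed
  have good_Union: "good (\<Union>\<K>)" if "\<And>S. S \<in> \<K> \<Longrightarrow> good S" for \<K>
  proof -
    have "\<forall>S\<in>\<K>. \<exists>V. open V \<and> S = {\<mu> \<in> Mp. \<Phi> \<mu> \<in> V}"
      using that by (simp add: good_def)
    then obtain v where v: "\<forall>S\<in>\<K>. open (v S) \<and> S = {\<mu> \<in> Mp. \<Phi> \<mu> \<in> v S}"
      by (rule bchoice[THEN exE])
    have "\<Union>\<K> = {\<mu> \<in> Mp. \<Phi> \<mu> \<in> \<Union>(v ` \<K>)}"
    proof (intro set_eqI iffI)
      fix \<mu> assume "\<mu> \<in> \<Union>\<K>"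
      then obtain S where "S \<in> \<K>" "\<mu> \<in> S" by blast
      then show "\<mu> \<in> {\<mu> \<in> Mp. \<Phi> \<mu> \<in> \<Union>(v ` \<K>)}" using v by auto
    next
      fix \<mu> assume "\<mu> \<in> {\<mu> \<in> Mp. \<Phi> \<mu> \<in> \<Union>(v ` \<K>)}"
      then obtain S where "S \<in> \<K>" "\<mu> \<in> Mp" "\<Phi> \<mu> \<in> v S" by auto
      moreover from this have "S = {\<mu> \<in> Mp. \<Phi> \<mu> \<in> v S}" using v by blast
      ultimately show "\<mu> \<in> \<Union>\<K>" by blast
    qed
    moreover have "open (\<Union>(v ` \<K>))" using v by (intro open_UN) blast
    ultimately show ?thesis unfolding good_def by (intro exI conjI)
  qed
  have good_coord: "good {\<mu> \<in> Mp. (\<integral>t. g t \<partial>\<mu>) \<in> U}" if g: "g \<in> D" and U: "open U" for g U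
  proof -
    obtain i where i: "g = d i" using d g by auto
    have "open ((\<lambda>z::nat \<Rightarrow> real. z i) -` U)"
      using U by (intro open_vimage continuous_on_product_coordinates)
    then show ?thesis unfolding good_def by (auto simp: i \<Phi>_def intro!: exI)
  qed
  have good_gt: "good {\<mu> \<in> Mp. c < (\<integral>t. f t \<partial>\<mu>)}" if f: "f \<in> CK_plus" for f c
  proof -
    obtain F where F: "range F \<subseteq> D0" "\<And>t n. t \<in> E \<Longrightarrow> F n t \<le> f t"
      "\<And>t. t \<in> E \<Longrightarrow> (\<lambda>n. F n t) \<longlonglongrightarrow> f t"
      using D0(3)[OF f] by metis
    have F': "range F \<subseteq> CK_plus" using F D0 by auto
    have "(c < (\<integral>t. f t \<partial>\<mu>)) \<longleftrightarrow> (\<exists>n. c < (\<integral>t. F n t \<partial>\<mu>))" if \<mu>: "\<mu> \<in> Mp" for \<mu>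
    proof
      assume "c < (\<integral>t. f t \<partial>\<mu>)"
      then have "\<forall>\<^sub>F n in sequentially. c < (\<integral>t. F n t \<partial>\<mu>)"
        using CK_plus_integral_convergence[OF \<mu> f F' F(2,3)] order_tendstoD(1) by blast
      then show "\<exists>n. c < (\<integral>t. F n t \<partial>\<mu>)" by (auto dest: eventually_happens)
    next
      assume "\<exists>n. c < (\<integral>t. F n t \<partial>\<mu>)"
      then obtain n where n: "c < (\<integral>t. F n t \<partial>\<mu>)" ..
      have "(\<integral>t. F n t \<partial>\<mu>) \<le> (\<integral>t. f t \<partial>\<mu>)"
        using F F' \<mu> f by (intro integral_mono CK_plus_integrable) (auto simp: space_Mp)
      with n show "c < (\<integral>t. f t \<partial>\<mu>)" by simp
    qed
    then have "{\<mu> \<in> Mp. c < (\<integral>t. f t \<partial>\<mu>)} = \<Union>(range (\<lambda>n. {\<mu> \<in> Mp. (\<integral>t. F n t \<partial>\<mu>) \<in> {c<..}}))"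
      by auto
    also have "good \<dots>" using F
      by (intro good_Union) (auto intro!: good_coord[of _ "{c<..}", simplified] simp: D_def)
    finally show ?thesis .
  qed
  have good_lt: "good {\<mu> \<in> Mp. (\<integral>t. f t \<partial>\<mu>) < c}" if f: "f \<in> CK_plus" for f c
  proof -
    obtain c0 where c0: "c0 > 0" "\<forall>t\<in>E. f t \<noteq> 0 \<longrightarrow> t \<in> away c0"
      using f by (auto simp: CK_plus_iff)
    obtain C where C: "C \<ge> 0" "\<forall>t\<in>E. f t \<le> C" using CK_plus_bounded[OF f] by auto
    obtain n where n: "1 / real (n + 1) < c0"
      using nat_approx_posE[OF c0(1)] by auto
    have R1: "R n t = 1" if "t \<in> E" "f t \<noteq> 0" for t
    proof -
      have "ereal c0 \<le> \<bar>t\<bar>" using c0 that by (auto simp: away_def)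
      then have "ereal (1 / real (n + 1)) \<le> \<bar>t\<bar>" using n
        by (meson ereal_less_eq(3) less_imp_le order_trans)
      then show ?thesis by (rule R(3))
    qed
    define f' where "f' t = C * R n t - f t" for t
    have "continuous_on E f'" unfolding f'_def
      using f R(1)[of n] by (intro continuous_intros) (auto simp: CK_plus_iff)
    moreover have "0 \<le> f' t" if "t \<in> E" for t
      using R1[OF that] C that R(2)[of n t] by (cases "f t = 0") (auto simp: f'_def)
    moreover have "\<exists>c>0. \<forall>t\<in>E. f' t \<noteq> 0 \<longrightarrow> t \<in> away c"
    proof -
      obtain c where c: "c > 0" "\<forall>t\<in>E. R n t \<noteq> 0 \<longrightarrow> t \<in> away c"
        using R(1)[of n] by (auto simp: CK_plus_iff)
      have "R n t \<noteq> 0" if "t \<in> E" "f' t \<noteq> 0" for t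
        using R1[OF that(1)] that(2) by (cases "f t = 0") (auto simp: f'_def)
      then show ?thesis using c by blast
    qed
    ultimately have f': "f' \<in> CK_plus" by (simp add: CK_plus_iff)
    have int_f': "(\<integral>t. f' t \<partial>\<mu>) = C * (\<integral>t. R n t \<partial>\<mu>) - (\<integral>t. f t \<partial>\<mu>)" if "\<mu> \<in> Mp" for \<mu>
      unfolding f'_def using CK_plus_integrable[OF that] f R(1)[of n] by (subst Bochner_Integration.integral_diff) auto
    \<comment> \<open>With \<mu>(f) = C \<mu>(R n) - \<mu>(f'), a threshold s between C \<mu>(R n)
      and c + \<mu>(f') splits \<mu>(f) < c into a condition on a coordinate and a lower
      semicontinuous one. The witness gives half of the slack c - \<mu>(f) to each.\<close>
    have eq: "{\<mu> \<in> Mp. (\<integral>t. f t \<partial>\<mu>) < c} =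
      \<Union>(range (\<lambda>s. {\<mu> \<in> Mp. (\<integral>t. R n t \<partial>\<mu>) \<in> {z. C * z < s}} \<inter> {\<mu> \<in> Mp. s - c < (\<integral>t. f' t \<partial>\<mu>)}))"
      (is "?L = ?R")
    proof
      show "?L \<subseteq> ?R"
      proof
        fix \<mu> assume \<mu>: "\<mu> \<in> ?L"
        let ?s = "C * (\<integral>t. R n t \<partial>\<mu>) + (c - (\<integral>t. f t \<partial>\<mu>)) / 2"
        have "\<mu> \<in> {\<mu> \<in> Mp. (\<integral>t. R n t \<partial>\<mu>) \<in> {z. C * z < ?s}} \<inter> {\<mu> \<in> Mp. ?s - c < (\<integral>t. f' t \<partial>\<mu>)}"
          using \<mu> int_f'[of \<mu>] by (auto simp: field_simps)
        then show "\<mu> \<in> ?R" by blast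
      qed
      show "?R \<subseteq> ?L" using int_f' by auto
    qed
    have "open {z. C * z < s}" for s
      by (intro open_Collect_less continuous_intros)
    then have "good ?R"
      by (intro good_Union) (auto intro!: good_Int good_coord[of "R n" "{z. C * z < _}", simplified] good_gt f' simp: D_def)
    then show ?thesis by (simp only: eq)
  qed
  have good_basis: "good {\<mu> \<in> Mp. (\<integral>t. f t \<partial>\<mu>) \<in> U}" if f: "f \<in> CK_plus" and "open U" for f and U :: "real set"
  proof -
    let ?I = "\<lambda>a b. {\<mu> \<in> Mp. a < (\<integral>t. f t \<partial>\<mu>)} \<inter> {\<mu> \<in> Mp. (\<integral>t. f t \<partial>\<mu>) < b}"
    let ?K = "(\<lambda>(a, b). ?I a b) ` {(a, b). {a<..<b} \<subseteq> U}"
    have "{\<mu> \<in> Mp. (\<integral>t. f t \<partial>\<mu>) \<in> U} = \<Union>?K"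
    proof (intro set_eqI iffI)
      fix \<mu> assume \<mu>: "\<mu> \<in> {\<mu> \<in> Mp. (\<integral>t. f t \<partial>\<mu>) \<in> U}"
      then obtain e where e: "e > 0" "ball (\<integral>t. f t \<partial>\<mu>) e \<subseteq> U"
        using \<open>open U\<close> open_contains_ball by blast
      let ?a = "(\<integral>t. f t \<partial>\<mu>) - e" and ?b = "(\<integral>t. f t \<partial>\<mu>) + e"
      have "{?a<..<?b} \<subseteq> U" using e by (simp add: ball_eq_greaterThanLessThan)
      moreover have "\<mu> \<in> ?I ?a ?b" using \<mu> e by auto
      ultimately show "\<mu> \<in> \<Union>?K" by blast
    qed auto
    moreover have "good (\<Union>?K)"
      by (intro good_Union) (auto intro!: good_Int good_gt good_lt f)
    ultimately show ?thesis by simp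
  qed
  have "good S" if "openin vague S" for S
  proof -
    have "generate_topology_on {{\<mu> \<in> Mp. (\<integral>t. f t \<partial>\<mu>) \<in> U} | f U. f \<in> CK_plus \<and> open U} S"
      using that unfolding vague_def by (simp add: openin_topology_generated_by_iff)
    then show ?thesis
    proof induction
      case Empty
      show ?case unfolding good_def by (intro exI[of _ "{}"]) auto
    next
      case (UN K) then show ?case using good_Union by blast
    qed (auto intro: good_Int good_basis)
  qed
  then show ?thesis
    using d \<open>D \<subseteq> CK_plus\<close> unfolding good_def \<Phi>_def by (intro exI[of _ d]) auto
qed

section \<open>Measurability and approximation of open sets in the vague topology\<close>

lemma openin_subset_Pow: "{U. openin X U} \<subseteq> Pow (topspace X)"
  using openin_subset by blast

lemma space_borel_of [simp]: "space (borel_of X) = topspace X"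
  unfolding borel_of_def using openin_subset_Pow by (rule space_measure_of)

lemma borel_of_open: "openin X U \<Longrightarrow> U \<in> sets (borel_of X)"
  unfolding borel_of_def by (simp add: sets_measure_of[OF openin_subset_Pow] sigma_sets.Basic)

lemma vague_embeddingE:
  obtains d :: "nat \<Rightarrow> ereal \<Rightarrow> real" where "range d \<subseteq> CK_plus"
    "\<And>S. openin vague S \<Longrightarrow> \<exists>V. open V \<and> S = {\<mu> \<in> Mp. (\<lambda>i. \<integral>t. d i t \<partial>\<mu>) \<in> V}"
proof -
  obtain d :: "nat \<Rightarrow> ereal \<Rightarrow> real" where d: "range d \<subseteq> CK_plus \<and>
     (\<forall>S. openin vague S \<longrightarrow> (\<exists>V. open V \<and> S = {\<mu> \<in> Mp. (\<lambda>i. \<integral>t. d i t \<partial>\<mu>) \<in> V}))"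
    using vague_embedding by (rule exE)
  show thesis by (rule that[of d]) (use d in simp_all)
qed

lemma measurable_borel_ofI:
  assumes "h \<in> space N \<rightarrow> topspace X" "\<And>U. openin X U \<Longrightarrow> h -` U \<inter> space N \<in> sets N"
  shows "h \<in> measurable N (borel_of X)"
  unfolding borel_of_def by (rule measurable_measure_of) (use assms in \<open>auto dest: openin_subset\<close>)

lemma continuous_map_measurable_borel_of:
  assumes "continuous_map X Y h"
  shows "h \<in> measurable (borel_of X) (borel_of Y)"
proof (rule measurable_borel_ofI)
  show "h \<in> space (borel_of X) \<rightarrow> topspace Y"
    using assms by (auto simp: continuous_map_def)
  fix U assume "openin Y U"
  then have "openin X {x \<in> topspace X. h x \<in> U}"
    using assms by (simp add: openin_continuous_map_preimage)
  moreover have "h -` U \<inter> topspace X = {x \<in> topspace X. h x \<in> U}" by auto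
  ultimately show "h -` U \<inter> space (borel_of X) \<in> sets (borel_of X)"
    by (simp add: borel_of_open)
qed

lemma continuous_map_real_measurable:
  fixes h :: "'a \<Rightarrow> real"
  assumes "continuous_map X euclideanreal h"
  shows "h \<in> borel_measurable (borel_of X)"
proof (rule borel_measurableI)
  fix U :: "real set" assume "open U"
  then have "openin X {x \<in> topspace X. h x \<in> U}"
    using assms by (simp add: openin_continuous_map_preimage)
  moreover have "h -` U \<inter> topspace X = {x \<in> topspace X. h x \<in> U}" by auto
  ultimately show "h -` U \<inter> space (borel_of X) \<in> sets (borel_of X)"
    by (simp add: borel_of_open)
qed

text \<open>A vaguely open set may be an uncountable union of basic ones, so measurability of the
  integrals does not pass to it directly. It is, however, a preimage of an open set of real
  sequences, and the Borel field there is generated by the countably many coordinates.\<close>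

lemma measurable_into_vague:
  assumes h: "\<And>\<omega>. \<omega> \<in> space N \<Longrightarrow> h \<omega> \<in> Mp \<inter> S"
    and int: "\<And>f. f \<in> CK_plus \<Longrightarrow> (\<lambda>\<omega>. \<integral>t. f t \<partial>h \<omega>) \<in> borel_measurable N"
  shows "h \<in> measurable N (borel_of (subtopology vague S))"
proof (rule measurable_borel_ofI)
  show "h \<in> space N \<rightarrow> topspace (subtopology vague S)"
    using h by (auto simp: topspace_vague)
  fix U assume "openin (subtopology vague S) U"
  then obtain O' where O': "openin vague O'" "U = O' \<inter> S" by (auto simp: openin_subtopology)
  obtain d :: "nat \<Rightarrow> ereal \<Rightarrow> real" where d: "range d \<subseteq> CK_plus"
    "\<And>S. openin vague S \<Longrightarrow> \<exists>V. open V \<and> S = {\<mu> \<in> Mp. (\<lambda>i. \<integral>t. d i t \<partial>\<mu>) \<in> V}"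
    using vague_embeddingE by blast
  obtain V where V: "open V" "O' = {\<mu> \<in> Mp. (\<lambda>i. \<integral>t. d i t \<partial>\<mu>) \<in> V}"
    using d(2)[OF O'(1)] by blast
  have "(\<lambda>\<omega> i. \<integral>t. d i t \<partial>h \<omega>) \<in> borel_measurable N"
    using d(1) by (intro measurable_coordinatewise_then_product int) auto
  then have "(\<lambda>\<omega> i. \<integral>t. d i t \<partial>h \<omega>) -` V \<inter> space N \<in> sets N"
    by (rule measurable_sets) (simp add: borel_open V(1))
  also have "(\<lambda>\<omega> i. \<integral>t. d i t \<partial>h \<omega>) -` V \<inter> space N = h -` U \<inter> space N"
    using h O' V by auto
  finally show "h -` U \<inter> space N \<in> sets N" .
qed

text \<open>Stands in for a metric on \<open>Mp\<close>: the truncated distance to the closed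
  complement is taken in the space of real sequences and pulled back along the integrals.\<close>

lemma vague_open_approx:
  assumes "openin (subtopology vague S) A"
  shows "\<exists>g :: nat \<Rightarrow> ereal measure \<Rightarrow> real.
    (\<forall>k. continuous_map (subtopology vague S) euclideanreal (g k)) \<and>
    (\<forall>k \<mu>. \<mu> \<in> Mp \<inter> S \<longrightarrow> 0 \<le> g k \<mu> \<and> g k \<mu> \<le> indicator A \<mu>) \<and>
    (\<forall>\<mu>\<in>Mp \<inter> S. (\<lambda>k. g k \<mu>) \<longlonglongrightarrow> indicator A \<mu>)"
proof -
  obtain O' where O': "openin vague O'" "A = O' \<inter> S"
    using assms by (auto simp: openin_subtopology)
  obtain d :: "nat \<Rightarrow> ereal \<Rightarrow> real" where d: "range d \<subseteq> CK_plus"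
    "\<And>S. openin vague S \<Longrightarrow> \<exists>V. open V \<and> S = {\<mu> \<in> Mp. (\<lambda>i. \<integral>t. d i t \<partial>\<mu>) \<in> V}"
    using vague_embeddingE by blast
  obtain V where V: "open V" "O' = {\<mu> \<in> Mp. (\<lambda>i. \<integral>t. d i t \<partial>\<mu>) \<in> V}"
    using d(2)[OF O'(1)] by blast
  define \<Phi> where "\<Phi> \<mu> = (\<lambda>i. \<integral>t. d i t \<partial>\<mu>)" for \<mu>
  have A_iff: "\<mu> \<in> A \<longleftrightarrow> \<Phi> \<mu> \<in> V" if "\<mu> \<in> Mp \<inter> S" for \<mu>
    using that O' V by (auto simp: \<Phi>_def)
  show ?thesis
  \<comment> \<open>\<open>infdist\<close> to the empty set is 0, so the distance formula would give
    the zero function when the complement of \<open>V\<close> is empty.\<close>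
  proof (cases "V = UNIV")
    case True
    then have "\<forall>\<mu>\<in>Mp \<inter> S. indicator A \<mu> = (1::real)" using A_iff by auto
    then show ?thesis by (intro exI[of _ "\<lambda>_ _. 1"]) auto
  next
    case False
    have cl: "closed (- V)" "- V \<noteq> {}" using V(1) False by auto
    define g where "g k \<mu> = min 1 (real k * infdist (\<Phi> \<mu>) (- V))" for k \<mu>
    have "continuous_map vague euclidean \<Phi>"
      unfolding euclidean_product_topology[symmetric] continuous_map_componentwise_UNIV \<Phi>_def
      using d(1) by (auto intro: continuous_map_vague_integral)
    moreover have "continuous_map euclidean euclideanreal (\<lambda>z. min 1 (real k * infdist z (- V)))" for k
      by (auto intro!: continuous_intros)
    ultimately have "continuous_map vague euclideanreal (g k)" for k
      unfolding g_def by (rule continuous_map_compose[unfolded o_def])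
    then have "continuous_map (subtopology vague S) euclideanreal (g k)" for k
      by (rule continuous_map_from_subtopology)
    moreover have "0 \<le> g k \<mu> \<and> g k \<mu> \<le> indicator A \<mu>" if "\<mu> \<in> Mp \<inter> S" for k \<mu>
      using A_iff[OF that] by (auto simp: g_def infdist_nonneg indicator_def)
    moreover have "(\<lambda>k. g k \<mu>) \<longlonglongrightarrow> indicator A \<mu>" if \<mu>: "\<mu> \<in> Mp \<inter> S" for \<mu>
    proof (cases "\<mu> \<in> A")
      case True
      then have "infdist (\<Phi> \<mu>) (- V) > 0"
        using A_iff[OF \<mu>] cl in_closed_iff_infdist_zero[OF cl, of "\<Phi> \<mu>"] infdist_nonneg[of "\<Phi> \<mu>" "- V"]
        by auto
      then obtain N where N: "1 < real N * infdist (\<Phi> \<mu>) (- V)"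
        using reals_Archimedean3 by blast
      have "g k \<mu> = 1" if "k \<ge> N" for k
      proof -
        have "real N * infdist (\<Phi> \<mu>) (- V) \<le> real k * infdist (\<Phi> \<mu>) (- V)"
          using that infdist_nonneg by (intro mult_right_mono) auto
        then show ?thesis using N by (simp add: g_def)
      qed
      then have "\<forall>\<^sub>F k in sequentially. g k \<mu> = 1" by (auto simp: eventually_sequentially)
      then show ?thesis using True by (simp add: tendsto_eventually)
    next
      case False
      then have "g k \<mu> = 0" for k using A_iff[OF \<mu>] by (simp add: g_def)
      then show ?thesis using False by simp
    qed
    ultimately show ?thesis by blast
  qed
qed

section \<open>Scaling and polar coordinates\<close>

lemma scale_in_E: "y > 0 \<Longrightarrow> t \<in> E \<Longrightarrow> ereal y * t \<in> E"
  by (cases t) (auto simp: E_def)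

lemma away_scale_iff: "y > 0 \<Longrightarrow> ereal y * t \<in> away c \<longleftrightarrow> t \<in> away (c / y)"
  by (cases t) (auto simp: away_def field_simps abs_mult)

lemma outside_scale_iff: "y > 0 \<Longrightarrow> t \<in> E \<Longrightarrow> ereal y * t \<in> outside c \<longleftrightarrow> t \<in> outside (c / y)"
  using scale_in_E[of y t] by (cases t) (auto simp: outside_def field_simps abs_mult)

text \<open>The critical product 0 * \<infinity> does not occur, as y is positive and finite and t
  is nonzero.\<close>

lemma continuous_on_scale:
  "continuous_on ({0<..} \<times> E) (\<lambda>(y, t). ereal y * t)"
  unfolding continuous_on_def
proof
  fix p assume "p \<in> {0::real<..} \<times> E"
  then show "((\<lambda>(y, t). ereal y * t) \<longlongrightarrow> (case p of (y, t) \<Rightarrow> ereal y * t)) (at p within {0<..} \<times> E)"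
    unfolding case_prod_beta
    by (intro tendsto_mult_ereal tendsto_intros) (auto simp: E_def)
qed

lemma measurable_scale: "y > 0 \<Longrightarrow> (\<lambda>t. ereal y * t) \<in> measurable borel_E borel_E"
  unfolding borel_E_def using scale_in_E
  by (intro measurable_restrict_space2 measurable_restrict_space1) (auto simp: space_restrict_space)

lemma measurable_scale_Mp: "\<mu> \<in> Mp \<Longrightarrow> y > 0 \<Longrightarrow> (\<lambda>t. ereal y * t) \<in> measurable \<mu> borel_E"
  using measurable_scale measurable_cong_sets[OF sets_Mp refl] by blast

lemma emeasure_scale:
  assumes "\<mu> \<in> Mp" "y > 0" "A \<in> sets borel_E"
  shows "emeasure (scale y \<mu>) A = emeasure \<mu> {t \<in> E. ereal y * t \<in> A}"
proof -
  have "(\<lambda>t. ereal y * t) -` A \<inter> E = {t \<in> E. ereal y * t \<in> A}" by auto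
  then show ?thesis
    unfolding scale_def using assms by (simp add: emeasure_distr measurable_scale_Mp space_Mp)
qed

lemma scale_preimage_sets:
  assumes "y > 0" "A \<in> sets borel_E"
  shows "{t \<in> E. ereal y * t \<in> A} \<in> sets borel_E"
proof -
  have "(\<lambda>t. ereal y * t) -` A \<inter> space borel_E \<in> sets borel_E"
    using measurable_scale assms by (intro measurable_sets)
  moreover have "(\<lambda>t. ereal y * t) -` A \<inter> space borel_E = {t \<in> E. ereal y * t \<in> A}" by auto
  ultimately show ?thesis by simp
qed

lemma scale_Mp:
  assumes "\<mu> \<in> Mp" "y > 0"
  shows "scale y \<mu> \<in> Mp"
  unfolding Mp_iff
proof (intro conjI ballI allI impI)
  show "sets (scale y \<mu>) = sets borel_E" by (simp add: scale_def)
  fix B c assume B: "B \<in> sets borel_E" "c > (0::real)" "B \<subseteq> away c"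
  have "{t \<in> E. ereal y * t \<in> B} \<subseteq> away (c / y)"
    using B(3) away_scale_iff[OF assms(2)] by blast
  moreover have "c / y > 0" using B assms by simp
  ultimately show "emeasure (scale y \<mu>) B \<in> range (of_nat :: nat \<Rightarrow> ennreal)"
    using assms(1) scale_preimage_sets[OF assms(2) B(1)]
    unfolding emeasure_scale[OF assms B(1)] Mp_iff by blast
qed

lemma CK_plus_scale:
  assumes "f \<in> CK_plus" "y > 0"
  shows "(\<lambda>t. f (ereal y * t)) \<in> CK_plus"
proof -
  obtain c where c: "c > 0" "\<forall>t\<in>E. f t \<noteq> 0 \<longrightarrow> t \<in> away c"
    using assms by (auto simp: CK_plus_iff)
  have "continuous_on E (\<lambda>t. ereal y * t)"
    unfolding continuous_on_def by (intro ballI tendsto_cmult_ereal tendsto_ident_at) simp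
  moreover have cf: "continuous_on E f" using assms by (simp add: CK_plus_iff)
  ultimately have "continuous_on E (\<lambda>t. f (ereal y * t))"
    using scale_in_E[OF assms(2)] by (intro continuous_on_compose2[OF cf]) auto
  moreover have "c / y > 0" using c assms by simp
  moreover have "\<forall>t\<in>E. f (ereal y * t) \<noteq> 0 \<longrightarrow> t \<in> away (c / y)"
    using c(2) away_scale_iff[OF assms(2)] scale_in_E[OF assms(2)] by blast
  ultimately show ?thesis
    using assms scale_in_E[OF assms(2)] unfolding CK_plus_iff by blast
qed

lemma integral_scale:
  assumes "\<mu> \<in> Mp" "y > 0" "f \<in> CK_plus"
  shows "(\<integral>t. f t \<partial>scale y \<mu>) = (\<integral>t. f (ereal y * t) \<partial>\<mu>)"
  unfolding scale_def using measurable_scale_Mp[OF assms(1,2)] CK_plus_measurable[OF assms(3)]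
  by (rule integral_distr)

lemma scale_scale:
  assumes "\<mu> \<in> Mp" "y > 0" "z > 0"
  shows "scale y (scale z \<mu>) = scale (y * z) \<mu>"
proof -
  have "scale y (scale z \<mu>) = distr \<mu> borel_E ((\<lambda>t. ereal y * t) \<circ> (\<lambda>t. ereal z * t))"
    unfolding scale_def using assms by (intro distr_distr measurable_scale measurable_scale_Mp)
  also have "(\<lambda>t. ereal y * t) \<circ> (\<lambda>t. ereal z * t) = (\<lambda>t. ereal (y * z) * t)"
    by (auto simp: fun_eq_iff mult.assoc[symmetric])
  finally show ?thesis by (simp add: scale_def)
qed

lemma times_ereal_1: "(*) (1::ereal) = (\<lambda>t. t)"
  by auto

lemma scale_1: "\<mu> \<in> Mp \<Longrightarrow> scale 1 \<mu> = \<mu>"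
  unfolding scale_def using distr_id2[of borel_E \<mu>] sets_Mp[of \<mu>]
  by (simp flip: one_ereal_def add: times_ereal_1)

text \<open>The dominating function \<open>h\<close> is fixed before \<epsilon>, so after
  integration the change of \<open>y\<close> costs at most \<epsilon> \<mu>(h), uniformly over all
  \<mu> with \<mu>(h) bounded. Compactness of \<open>away b\<close> gives uniformity in t,
  infinities included; closer to 0 both terms vanish.\<close>

lemma uniform_scale:
  assumes f: "f \<in> CK_plus" and "y0 > 0"
  shows "\<exists>h\<in>CK_plus. (\<forall>\<epsilon>>0. \<exists>X0. open X0 \<and> y0 \<in> X0 \<and>
     (\<forall>y\<in>X0. y > 0 \<longrightarrow> (\<forall>t\<in>E. \<bar>f (ereal y * t) - f (ereal y0 * t)\<bar> \<le> \<epsilon> * h t)))"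
proof -
  obtain c where c: "c > 0" "\<forall>t\<in>E. f t \<noteq> 0 \<longrightarrow> t \<in> away c"
    using f by (auto simp: CK_plus_iff)
  \<comment> \<open>For y < 2 y0, a point t with modulus below b = c / (2 y0) has \<bar>y t\<bar> <
    c, hence lies off the support after scaling.\<close>
  define b where "b = c / (2 * y0)"
  have b: "b > 0" using c assms by (simp add: b_def)
  define h where "h = ramp (b / 2) b"
  have h: "h \<in> CK_plus" "\<And>t. 0 \<le> h t" "\<And>t. t \<in> away b \<Longrightarrow> h t = 1"
    using b ramp_props[of "b / 2" b] by (auto simp: h_def away_def)
  show ?thesis
  proof (intro bexI[OF _ h(1)] allI impI)
    fix \<epsilon> :: real assume "\<epsilon> > 0"
    define F where "F = (\<lambda>(y, t). \<bar>f (ereal y * t) - f (ereal y0 * t)\<bar>)"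
    have fE: "continuous_on E f" using f by (simp add: CK_plus_iff)
    have sc: "(\<lambda>(y, t). ereal y * t) ` ({0<..} \<times> E) \<subseteq> E" using scale_in_E by auto
    have c1: "continuous_on ({0<..} \<times> E) (\<lambda>p. f (case p of (y, t) \<Rightarrow> ereal y * t))"
      by (rule continuous_on_compose2[OF fE continuous_on_scale sc])
    have c2: "continuous_on ({0::real<..} \<times> E) (\<lambda>p. f (ereal y0 * snd p))"
    proof (rule continuous_on_compose2[where g = "\<lambda>t. f (ereal y0 * t)" and f = snd])
      show "continuous_on E (\<lambda>t. f (ereal y0 * t))"
        using CK_plus_scale[OF f \<open>y0 > 0\<close>] by (simp add: CK_plus_iff)
      show "continuous_on ({0::real<..} \<times> E) snd" by (intro continuous_on_snd continuous_on_id)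
    qed auto
    have "continuous_on ({0<..} \<times> E) F"
      unfolding F_def case_prod_beta
      using continuous_on_diff[OF c1 c2] by (auto simp: case_prod_beta intro: continuous_on_rabs)
    moreover have "open ({0::real<..} \<times> E)" using open_E by (intro open_Times) auto
    ultimately have W: "open (F -` {..<\<epsilon>} \<inter> ({0<..} \<times> E))"
      using continuous_on_open_vimage open_lessThan by blast
    have sub: "{y0} \<times> away b \<subseteq> F -` {..<\<epsilon>} \<inter> ({0<..} \<times> E)"
      using \<open>\<epsilon> > 0\<close> \<open>y0 > 0\<close> away_subset_E[OF b] by (auto simp: F_def)
    \<comment> \<open>Tube lemma: the open set where the difference is below \<epsilon> contains the
      slice over y0, hence a product neighbourhood of it.\<close>
    have "compact (away b)" using closed_away by (simp add: compact_eq_closed)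
    from Elementary_Topology.tube_lemma[OF this W sub]
    obtain X0 where X0: "y0 \<in> X0" "open X0" "X0 \<times> away b \<subseteq> F -` {..<\<epsilon>} \<inter> ({0<..} \<times> E)"
      by blast
    show "\<exists>X0. open X0 \<and> y0 \<in> X0 \<and>
       (\<forall>y\<in>X0. y > 0 \<longrightarrow> (\<forall>t\<in>E. \<bar>f (ereal y * t) - f (ereal y0 * t)\<bar> \<le> \<epsilon> * h t))"
    proof (intro exI[of _ "X0 \<inter> {..<2 * y0}"] conjI ballI impI)
      show "open (X0 \<inter> {..<2 * y0})" "y0 \<in> X0 \<inter> {..<2 * y0}" using X0 assms by auto
      fix y t assume y: "y \<in> X0 \<inter> {..<2 * y0}" "y > 0" and t: "t \<in> E"
      show "\<bar>f (ereal y * t) - f (ereal y0 * t)\<bar> \<le> \<epsilon> * h t"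
      proof (cases "t \<in> away b")
        case True
        then have "(y, t) \<in> F -` {..<\<epsilon>}" using X0(3) y by blast
        then show ?thesis using h(3)[OF True] by (simp add: F_def)
      next
        case False
        have "f (ereal z * t) = 0" if z: "0 < z" "z < 2 * y0" for z
        proof (rule ccontr)
          assume "f (ereal z * t) \<noteq> 0"
          then have "t \<in> away (c / z)" using c z t scale_in_E away_scale_iff by blast
          moreover have "b \<le> c / z" unfolding b_def using z c by (intro divide_left_mono) auto
          ultimately show False using False away_mono by blast
        qed
        then have "f (ereal y * t) = 0" "f (ereal y0 * t) = 0" using y assms(2) by auto
        then show ?thesis using h(2)[of t] \<open>\<epsilon> > 0\<close> by simp
      qed
    qed
  qed
qed

text \<open>Factor and measure vary together. The error is split into \<epsilon> \<mu>(h) for the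
  change of the factor and \<bar>\<mu>(f0) - \<mu>0(f0)\<bar> for the change of the measure; both
  are controlled on a vague neighbourhood of \<mu>0.\<close>

lemma continuous_map_scale:
  "continuous_map (prod_topology (top_of_set {0<..}) vague) vague (\<lambda>(y, \<mu>). scale y \<mu>)"
proof (rule continuous_map_into_vague)
  fix p :: "real \<times> ereal measure" assume "p \<in> topspace (prod_topology (top_of_set {0<..}) vague)"
  then show "(case p of (y, \<mu>) \<Rightarrow> scale y \<mu>) \<in> Mp" by (auto simp: topspace_vague scale_Mp)
next
  fix f assume f: "f \<in> CK_plus"
  let ?X = "prod_topology (top_of_set {0::real<..}) vague"
  show "continuous_map ?X euclideanreal (\<lambda>p. \<integral>t. f t \<partial>(case p of (y, \<mu>) \<Rightarrow> scale y \<mu>))"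
    unfolding continuous_map_def
  proof (intro conjI allI impI)
    fix U :: "real set" assume "openin euclideanreal U"
    then have "open U" by simp
    let ?S = "{p \<in> topspace ?X. (\<integral>t. f t \<partial>(case p of (y, \<mu>) \<Rightarrow> scale y \<mu>)) \<in> U}"
    show "openin ?X ?S"
      unfolding openin_prod_topology_alt
    proof (intro allI impI)
      fix y0 \<mu>0 assume "(y0, \<mu>0) \<in> ?S"
      then have 0: "y0 > 0" "\<mu>0 \<in> Mp" "(\<integral>t. f (ereal y0 * t) \<partial>\<mu>0) \<in> U"
        using f by (auto simp: topspace_vague integral_scale)
      obtain e where e: "e > 0" "ball (\<integral>t. f (ereal y0 * t) \<partial>\<mu>0) e \<subseteq> U"
        using \<open>open U\<close> 0(3) open_contains_ball by blast
      obtain h where h: "h \<in> CK_plus" "\<And>\<epsilon>. \<epsilon> > 0 \<Longrightarrow> \<exists>X0. open X0 \<and> y0 \<in> X0 \<and>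
         (\<forall>y\<in>X0. y > 0 \<longrightarrow> (\<forall>t\<in>E. \<bar>f (ereal y * t) - f (ereal y0 * t)\<bar> \<le> \<epsilon> * h t))"
        using uniform_scale[OF f 0(1)] by metis
      \<comment> \<open>The added 1 makes {\<mu>(h) < m} an open neighbourhood of \<mu>0; with
        \<epsilon> = e / (2 m) the change of the factor then costs at most e / 2.\<close>
      define m where "m = (\<integral>t. h t \<partial>\<mu>0) + 1"
      have h_nonneg: "0 \<le> (\<integral>t. h t \<partial>\<mu>)" if "\<mu> \<in> Mp" for \<mu>
        using h(1) that by (intro integral_nonneg_AE) (auto simp: CK_plus_iff space_Mp)
      have m: "m > 0" using h_nonneg[OF 0(2)] by (simp add: m_def)
      define \<epsilon> where "\<epsilon> = e / (2 * m)"
      have "\<epsilon> > 0" using e m by (simp add: \<epsilon>_def)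
      then obtain X0 where X0: "open X0" "y0 \<in> X0"
        "\<And>y t. y \<in> X0 \<Longrightarrow> y > 0 \<Longrightarrow> t \<in> E \<Longrightarrow> \<bar>f (ereal y * t) - f (ereal y0 * t)\<bar> \<le> \<epsilon> * h t"
        using h(2) by metis
      define f0 where "f0 t = f (ereal y0 * t)" for t
      have f0: "f0 \<in> CK_plus" unfolding f0_def using CK_plus_scale[OF f 0(1)] .
      define V where "V = {\<mu> \<in> Mp. (\<integral>t. h t \<partial>\<mu>) \<in> {..<m}} \<inter> {\<mu> \<in> Mp. (\<integral>t. f0 t \<partial>\<mu>) \<in> ball (\<integral>t. f0 t \<partial>\<mu>0) (e / 2)}"
      have "openin vague V" unfolding V_def
        using h(1) f0 by (intro openin_Int vague_integral_open) auto
      moreover have "\<mu>0 \<in> V" using 0 e by (auto simp: V_def m_def)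
      moreover have "openin (top_of_set {0<..}) (X0 \<inter> {0<..})" "y0 \<in> X0 \<inter> {0<..}"
        using X0 0 by (auto simp: openin_open)
      moreover have "(X0 \<inter> {0<..}) \<times> V \<subseteq> ?S"
      proof
        fix p assume "p \<in> (X0 \<inter> {0<..}) \<times> V"
        then obtain y \<mu> where p: "p = (y, \<mu>)" and y: "y \<in> X0" "y \<in> {0<..}" and "\<mu> \<in> V" by blast
        then have \<mu>: "\<mu> \<in> Mp" "(\<integral>t. h t \<partial>\<mu>) < m" "\<bar>(\<integral>t. f0 t \<partial>\<mu>) - (\<integral>t. f0 t \<partial>\<mu>0)\<bar> < e / 2"
          by (auto simp: V_def dist_real_def abs_minus_commute)
        have y': "y > 0" using y by simp
        have fy: "(\<lambda>t. f (ereal y * t)) \<in> CK_plus" using CK_plus_scale[OF f y'] .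
        note ints = CK_plus_integrable[OF \<mu>(1)]
        have "\<bar>(\<integral>t. f (ereal y * t) \<partial>\<mu>) - (\<integral>t. f0 t \<partial>\<mu>)\<bar> = \<bar>\<integral>t. f (ereal y * t) - f0 t \<partial>\<mu>\<bar>"
          using ints[OF fy] ints[OF f0] by (subst Bochner_Integration.integral_diff) auto
        also have "\<dots> \<le> (\<integral>t. \<bar>f (ereal y * t) - f0 t\<bar> \<partial>\<mu>)" by (rule integral_abs_bound)
        also have "\<dots> \<le> (\<integral>t. \<epsilon> * h t \<partial>\<mu>)"
          using ints[OF fy] ints[OF f0, unfolded f0_def] ints[OF h(1)] X0(3)[OF y(1) y'] \<mu>(1)
          by (intro integral_mono) (auto simp: f0_def space_Mp)
        also have "\<dots> \<le> \<epsilon> * m" using \<mu>(2) \<open>\<epsilon> > 0\<close> by simp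
        also have "\<dots> = e / 2" using m by (simp add: \<epsilon>_def)
        finally have "\<bar>(\<integral>t. f (ereal y * t) \<partial>\<mu>) - (\<integral>t. f0 t \<partial>\<mu>0)\<bar> < e" using \<mu>(3) by linarith
        then have "(\<integral>t. f (ereal y * t) \<partial>\<mu>) \<in> U"
          using e(2) by (auto simp: f0_def dist_real_def abs_minus_commute)
        then show "p \<in> ?S" unfolding p using \<mu>(1) y' f by (simp add: topspace_vague integral_scale)
      qed
      ultimately show "\<exists>U V. openin (top_of_set {0<..}) U \<and> openin vague V \<and> y0 \<in> U \<and> \<mu>0 \<in> V \<and> U \<times> V \<subseteq> ?S"
        by blast
    qed
  qed auto
qed

section \<open>The largest modulus of the atoms\<close>

text \<open>Outside \<open>Mfin\<close> the supremum in \<open>max_modulus\<close> is over an empty or unbounded set, and its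
  value is meaningless.\<close>

definition Mfin :: "ereal measure set" where
  "Mfin = {\<mu> \<in> M0. emeasure \<mu> {\<infinity>, -\<infinity>} = 0}"

definition max_modulus :: "ereal measure \<Rightarrow> real" where
  "max_modulus \<mu> = Sup {c. 0 < c \<and> emeasure \<mu> (outside c) \<noteq> 0}"

definition normalized :: "ereal measure \<Rightarrow> ereal measure" where
  "normalized \<mu> = scale (1 / max_modulus \<mu>) \<mu>"

text \<open>Since \<open>\<mu>\<close> is integer-valued, decreasing limits of its values are attained.\<close>

lemma away_zero_smaller:
  assumes "\<mu> \<in> Mp" "c > 0" "emeasure \<mu> (away c) = 0"
  shows "\<exists>b. 0 < b \<and> b < c \<and> emeasure \<mu> (away b) = 0"
proof -
  \<comment> \<open>The shift by 2 keeps all radii at least c / 2, so every set in the decreasing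
    sequence is bounded away from 0 and has finite mass, as continuity from above requires.\<close>
  define b where "b n = c - c / real (n + 2)" for n
  have b: "c / 2 \<le> b n" "0 < b n" "b n < c" for n
  proof -
    have "c / real (n + 2) \<le> c / 2" "0 < c / real (n + 2)"
      using assms(2) by (auto simp: field_simps)
    then show "c / 2 \<le> b n" "0 < b n" "b n < c" using assms(2) unfolding b_def by linarith+
  qed
  have "decseq (\<lambda>n. away (b n))"
    using assms(2) by (intro antimonoI away_mono) (auto simp: b_def intro!: divide_left_mono)
  moreover have "range (\<lambda>n. away (b n)) \<subseteq> sets \<mu>"
    using away_in_sets b(2) by (auto simp: sets_Mp[OF assms(1)])
  moreover have "emeasure \<mu> (away (b n)) \<noteq> \<infinity>" for n
    using Mp_finite[OF assms(1) b(2)[of n] away_in_sets[OF b(2)[of n]]] by (simp add: less_top[symmetric])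
  ultimately have "(\<lambda>n. emeasure \<mu> (away (b n))) \<longlonglongrightarrow> emeasure \<mu> (\<Inter>n. away (b n))"
    by (intro Lim_emeasure_decseq)
  also have "(\<Inter>n. away (b n)) = away c"
  proof
    show "away c \<subseteq> (\<Inter>n. away (b n))" using away_mono b(3) by (simp add: INT_greatest less_imp_le)
    show "(\<Inter>n. away (b n)) \<subseteq> away c"
    proof
      fix t assume t: "t \<in> (\<Inter>n. away (b n))"
      have "(\<lambda>n. ereal (b n)) \<longlonglongrightarrow> ereal (c - 0)"
        unfolding b_def using LIMSEQ_ignore_initial_segment[OF lim_const_over_n[of c], of 2]
        by (intro tendsto_intros) simp
      then have lim: "(\<lambda>n. ereal (b n)) \<longlonglongrightarrow> ereal c" by simp
      have "ereal c \<le> \<bar>t\<bar>" by (rule LIMSEQ_le_const2[OF lim]) (use t in \<open>auto simp: away_def\<close>)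
      then show "t \<in> away c" by (simp add: away_def)
    qed
  qed
  finally have "\<forall>\<^sub>F n in sequentially. emeasure \<mu> (away (b n)) < 1"
    using assms(3) by (intro order_tendstoD(2)) auto
  then obtain n where "emeasure \<mu> (away (b n)) < 1" by (auto dest: eventually_happens)
  then have "emeasure \<mu> (away (b n)) = 0"
    using Mp_less_one_imp_zero[OF assms(1) b(2) away_in_sets[OF b(2)]] by blast
  then show ?thesis using b by blast
qed

text \<open>The sets \<open>away (n + 1)\<close> decrease to the two points at infinity, so their
  integer masses tend to 0 and are eventually 0: no atom is far out.\<close>

lemma away_zero_at_infinity:
  assumes "\<mu> \<in> Mp" "emeasure \<mu> {\<infinity>, -\<infinity>} = 0"
  shows "\<exists>c>0. emeasure \<mu> (away c) = 0"
proof -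
  define b where "b n = real n + 1" for n
  have b: "0 < b n" for n by (simp add: b_def)
  have "decseq (\<lambda>n. away (b n))"
    by (intro antimonoI away_mono) (auto simp: b_def)
  moreover have "range (\<lambda>n. away (b n)) \<subseteq> sets \<mu>"
    using away_in_sets b by (auto simp: sets_Mp[OF assms(1)])
  moreover have "emeasure \<mu> (away (b n)) \<noteq> \<infinity>" for n
    using Mp_finite[OF assms(1) b[of n] away_in_sets[OF b[of n]]] by (simp add: less_top[symmetric])
  ultimately have "(\<lambda>n. emeasure \<mu> (away (b n))) \<longlonglongrightarrow> emeasure \<mu> (\<Inter>n. away (b n))"
    by (intro Lim_emeasure_decseq)
  also have "(\<Inter>n. away (b n)) = {\<infinity>, -\<infinity>}"
  proof (intro equalityI subsetI)
    fix t assume t: "t \<in> (\<Inter>n. away (b n))"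
    show "t \<in> {\<infinity>, -\<infinity>}"
    proof (cases t)
      case (real r)
      obtain n where "\<bar>r\<bar> < real n" using reals_Archimedean2 by blast
      moreover have "t \<in> away (b n)" using t by blast
      ultimately show ?thesis using real by (auto simp: away_def b_def)
    qed auto
  qed (auto simp: away_def)
  finally have "\<forall>\<^sub>F n in sequentially. emeasure \<mu> (away (b n)) < 1"
    using assms(2) by (intro order_tendstoD(2)) auto
  then obtain n where "emeasure \<mu> (away (b n)) < 1" by (auto dest: eventually_happens)
  then have "emeasure \<mu> (away (b n)) = 0"
    using Mp_less_one_imp_zero[OF assms(1) b away_in_sets[OF b]] by blast
  then show ?thesis using b by blast
qed

lemma emeasure_eq_0_mono:
  assumes "\<mu> \<in> Mp" "B \<in> sets borel_E" "emeasure \<mu> B = 0" "A \<subseteq> B"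
  shows "emeasure \<mu> A = 0"
  using assms emeasure_mono[of A B \<mu>] by (simp add: sets_Mp)

lemma outside_mono: "c \<le> d \<Longrightarrow> outside d \<subseteq> outside c"
  by (auto simp: outside_def intro: order.strict_trans1[of "ereal c" "ereal d"])

lemma away_subset_outside: "c < d \<Longrightarrow> 0 < d \<Longrightarrow> away d \<subseteq> outside c"
  using away_subset_E by (auto simp: away_def outside_def intro: order.strict_trans2[of "ereal c" "ereal d"])

text \<open>\<open>E\<close> is a countable union of sets \<open>outside (1 / (n + 1))\<close>, and
  a measure that vanishes on each of them is null.\<close>

lemma M0_iff: "\<mu> \<in> M0 \<longleftrightarrow> \<mu> \<in> Mp \<and> (\<exists>c>0. emeasure \<mu> (outside c) \<noteq> 0)"
proof
  assume "\<mu> \<in> M0"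
  then have \<mu>: "\<mu> \<in> Mp" "\<mu> \<noteq> null_measure borel_E" by (auto simp: M0_def)
  have "\<exists>c>0. emeasure \<mu> (outside c) \<noteq> 0"
  proof (rule ccontr)
    assume *: "\<not> ?thesis"
    have "emeasure \<mu> (\<Union>n. outside (1 / real (Suc n))) = 0"
      using * outside_in_sets by (intro emeasure_UN_eq_0) (auto simp: sets_Mp[OF \<mu>(1)])
    moreover have "E \<subseteq> (\<Union>n. outside (1 / real (Suc n)))"
    proof
      fix t assume t: "t \<in> E"
      show "t \<in> (\<Union>n. outside (1 / real (Suc n)))"
      proof (cases t)
        case (real r)
        then have "\<bar>r\<bar> > 0" using t by (auto simp: E_def)
        then obtain n where "1 / real (Suc n) < \<bar>r\<bar>" using nat_approx_posE by blast
        then show ?thesis using t real by (auto simp: outside_def)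
      qed (use t in \<open>auto simp: outside_def\<close>)
    qed
    moreover have "(\<Union>n. outside (1 / real (Suc n))) \<in> sets borel_E"
      using outside_in_sets by auto
    ultimately have z: "emeasure \<mu> E = 0"
      using emeasure_eq_0_mono[OF \<mu>(1)] by blast
    have "\<mu> = null_measure borel_E"
    proof (rule measure_eqI)
      fix A assume "A \<in> sets \<mu>"
      then have "A \<subseteq> E" using sets_Mp[OF \<mu>(1)] sets_borel_E_iff by auto
      then show "emeasure \<mu> A = emeasure (null_measure borel_E) A"
        using emeasure_eq_0_mono[OF \<mu>(1) _ z] sets.top[of borel_E] by simp
    qed (simp add: sets_Mp[OF \<mu>(1)])
    with \<mu> show False by simp
  qed
  with \<mu> show "\<mu> \<in> Mp \<and> (\<exists>c>0. emeasure \<mu> (outside c) \<noteq> 0)" by simp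
qed (auto simp: M0_def)

lemma Mfin_iff:
  "\<mu> \<in> Mfin \<longleftrightarrow> \<mu> \<in> Mp \<and> (\<exists>c>0. emeasure \<mu> (outside c) \<noteq> 0) \<and> (\<exists>c>0. emeasure \<mu> (away c) = 0)"
proof -
  have "emeasure \<mu> {\<infinity>, -\<infinity>} = 0" if "\<mu> \<in> Mp" "c > 0" "emeasure \<mu> (away c) = 0" for c
    using that(3) by (rule emeasure_eq_0_mono[OF that(1) away_in_sets[OF that(2)]]) (auto simp: away_def)
  then show ?thesis using away_zero_at_infinity by (auto simp: Mfin_def M0_iff)
qed

text \<open>The two comparisons involve different sets, open for the lower bound and closed for the
  upper one, and each gives a vaguely open condition. The last one is strict because a null
  \<open>away c\<close> can be enlarged to a null \<open>away d\<close> with d < c, which rests on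
  integrality.\<close>

lemma max_modulus_less_iff:
  assumes "\<mu> \<in> Mfin"
  shows "0 < max_modulus \<mu>"
    and "0 < c \<Longrightarrow> c < max_modulus \<mu> \<longleftrightarrow> emeasure \<mu> (outside c) \<noteq> 0"
    and "0 < c \<Longrightarrow> max_modulus \<mu> < c \<longleftrightarrow> emeasure \<mu> (away c) = 0"
proof -
  let ?A = "{c. 0 < c \<and> emeasure \<mu> (outside c) \<noteq> 0}"
  have \<mu>: "\<mu> \<in> Mp" using assms by (simp add: Mfin_iff)
  obtain a b where a: "a > 0" "emeasure \<mu> (outside a) \<noteq> 0" and b: "b > 0" "emeasure \<mu> (away b) = 0"
    using assms by (auto simp: Mfin_iff)
  have ub: "x \<le> d" if x: "x \<in> ?A" and "d > 0" "emeasure \<mu> (away d) = 0" for x d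
  proof (rule ccontr)
    assume "\<not> x \<le> d"
    then have "outside x \<subseteq> away d" using outside_subset_away[of x] away_mono[of d x] by auto
    then show False using emeasure_eq_0_mono[OF \<mu> away_in_sets[OF that(2)] that(3)] x by blast
  qed
  then have bdd: "bdd_above ?A" using b by (intro bdd_aboveI[of _ b]) blast
  have "a \<in> ?A" using a by simp
  then have "a \<le> max_modulus \<mu>" unfolding max_modulus_def using bdd by (rule cSup_upper)
  then show pos: "0 < max_modulus \<mu>" using a by simp
  have out: "emeasure \<mu> (outside d) \<noteq> 0" if d: "0 < d" "d < max_modulus \<mu>" for d
  proof -
    obtain x where "x \<in> ?A" "d < x"
      using d(2) \<open>a \<in> ?A\<close> bdd unfolding max_modulus_def by (subst (asm) less_cSup_iff) auto
    then show ?thesis using emeasure_eq_0_mono[OF \<mu> outside_in_sets _ outside_mono[of d x]] by auto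
  qed
  have out0: "emeasure \<mu> (outside d) = 0" if "0 < d" "max_modulus \<mu> < d" for d
    using that cSup_upper[OF _ bdd, of d] unfolding max_modulus_def by auto
  \<comment> \<open>The supremum itself is not in the set: \<open>outside\<close> at the supremum is
    a countable union of null sets with larger radii.\<close>
  have out_max: "emeasure \<mu> (outside (max_modulus \<mu>)) = 0"
  proof -
    have "outside (max_modulus \<mu>) \<subseteq> (\<Union>n. outside (max_modulus \<mu> + 1 / real (Suc n)))"
    proof
      fix t assume t: "t \<in> outside (max_modulus \<mu>)"
      show "t \<in> (\<Union>n. outside (max_modulus \<mu> + 1 / real (Suc n)))"
      proof (cases t)
        case (real r)
        then have "\<bar>r\<bar> - max_modulus \<mu> > 0" using t by (auto simp: outside_def)
        then obtain n where "1 / real (Suc n) < \<bar>r\<bar> - max_modulus \<mu>" using nat_approx_posE by blast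
        then show ?thesis using t real by (auto simp: outside_def intro!: exI[of _ n])
      qed (use t in \<open>auto simp: outside_def\<close>)
    qed
    moreover have "emeasure \<mu> (\<Union>n. outside (max_modulus \<mu> + 1 / real (Suc n))) = 0"
      using out0 pos outside_in_sets
      by (intro emeasure_UN_eq_0) (auto simp: sets_Mp[OF \<mu>] add_pos_pos)
    moreover have "(\<Union>n. outside (max_modulus \<mu> + 1 / real (Suc n))) \<in> sets borel_E"
      using outside_in_sets by auto
    ultimately show ?thesis using emeasure_eq_0_mono[OF \<mu>] by blast
  qed
  show "c < max_modulus \<mu> \<longleftrightarrow> emeasure \<mu> (outside c) \<noteq> 0" if c: "0 < c"
    using out out0 out_max c by (metis linorder_neqE_linordered_idom)
  show "max_modulus \<mu> < c \<longleftrightarrow> emeasure \<mu> (away c) = 0" if c: "0 < c"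
  proof
    assume "max_modulus \<mu> < c"
    then show "emeasure \<mu> (away c) = 0"
      using emeasure_eq_0_mono[OF \<mu> outside_in_sets out_max] away_subset_outside c by blast
  next
    assume "emeasure \<mu> (away c) = 0"
    then obtain d where d: "0 < d" "d < c" "emeasure \<mu> (away d) = 0"
      using away_zero_smaller[OF \<mu> c] by blast
    have "max_modulus \<mu> \<le> d"
      unfolding max_modulus_def using \<open>a \<in> ?A\<close> ub d by (intro cSup_least) blast+
    with d show "max_modulus \<mu> < c" by simp
  qed
qed

section \<open>Continuity of the polar coordinates\<close>

lemma openin_outside_pos:
  assumes "c > 0"
  shows "openin vague {\<mu> \<in> Mp. emeasure \<mu> (outside c) \<noteq> 0}"
proof -
  have r: "ramp c (c + 1) \<in> CK_plus" "\<And>t. 0 \<le> ramp c (c + 1) t"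
     "\<And>t. ramp c (c + 1) t = 0 \<longleftrightarrow> \<not> ereal c < \<bar>t\<bar>"
    using ramp_props[of c "c + 1"] assms by (auto simp: not_less) (metis not_less less_irrefl)
  have "emeasure \<mu> (outside c) \<noteq> 0 \<longleftrightarrow> (\<integral>t. ramp c (c + 1) t \<partial>\<mu>) \<in> {0<..}" if \<mu>: "\<mu> \<in> Mp" for \<mu>
  proof -
    have eq: "{t \<in> space \<mu>. \<not> ramp c (c + 1) t = 0} = outside c"
      using r(3) by (auto simp: space_Mp[OF \<mu>] outside_def)
    have "emeasure \<mu> (outside c) = 0 \<longleftrightarrow> (AE t in \<mu>. ramp c (c + 1) t = 0)"
      using AE_iff_measurable[of "outside c" \<mu> "\<lambda>t. ramp c (c + 1) t = 0", OF _ eq] outside_in_sets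
      by (auto simp: sets_Mp[OF \<mu>])
    also have "\<dots> \<longleftrightarrow> (\<integral>t. ramp c (c + 1) t \<partial>\<mu>) = 0"
      using CK_plus_integrable[OF \<mu> r(1)] r(2) by (subst integral_nonneg_eq_0_iff_AE) auto
    finally show ?thesis
      using Bochner_Integration.integral_nonneg[of \<mu> "ramp c (c + 1)"] r(2) by (simp add: less_le)
  qed
  then have "{\<mu> \<in> Mp. emeasure \<mu> (outside c) \<noteq> 0} = {\<mu> \<in> Mp. (\<integral>t. ramp c (c + 1) t \<partial>\<mu>) \<in> {0<..}}"
    by blast
  then show ?thesis using vague_integral_open[OF r(1), of "{0<..}"] by simp
qed

text \<open>An indicator of a closed set has no continuous minorant to work with, so a majorant
  \<open>ramp b c\<close> is used: an integral below 1 bounds the integer mass of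
  \<open>away c\<close> below 1. Conversely a null \<open>away c\<close> extends to a null
  \<open>away b\<close>, where the ramp integrates to 0.\<close>

lemma openin_away_zero:
  assumes "c > 0"
  shows "openin vague {\<mu> \<in> Mp. emeasure \<mu> (away c) = 0}"
proof -
  let ?U = "\<lambda>b. {\<mu> \<in> Mp. (\<integral>t. ramp b c t \<partial>\<mu>) \<in> {..<1}}"
  have "{\<mu> \<in> Mp. emeasure \<mu> (away c) = 0} = (\<Union>b\<in>{0<..<c}. ?U b)"
  proof (intro equalityI subsetI)
    fix \<mu> assume "\<mu> \<in> {\<mu> \<in> Mp. emeasure \<mu> (away c) = 0}"
    then have \<mu>: "\<mu> \<in> Mp" "emeasure \<mu> (away c) = 0" by auto
    then obtain b where b: "0 < b" "b < c" "emeasure \<mu> (away b) = 0"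
      using away_zero_smaller assms by blast
    have "away b \<in> null_sets \<mu>" using b away_in_sets by (simp add: null_sets_def sets_Mp[OF \<mu>(1)])
    then have "AE t in \<mu>. t \<notin> away b" by (rule AE_not_in)
    then have "AE t in \<mu>. ramp b c t = 0"
      by eventually_elim (use b ramp_props(4)[of b c] in \<open>auto simp: away_def\<close>)
    then have "(\<integral>t. ramp b c t \<partial>\<mu>) = 0" by (rule integral_eq_zero_AE)
    then show "\<mu> \<in> (\<Union>b\<in>{0<..<c}. ?U b)" using b \<mu> by (auto intro!: bexI[of _ b])
  next
    fix \<mu> assume "\<mu> \<in> (\<Union>b\<in>{0<..<c}. ?U b)"
    then obtain b where b: "0 < b" "b < c" and \<mu>: "\<mu> \<in> Mp" "(\<integral>t. ramp b c t \<partial>\<mu>) < 1" by auto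
    note r = ramp_props[OF b]
    have "emeasure \<mu> (away c) = (\<integral>\<^sup>+ t. indicator (away c) t \<partial>\<mu>)"
      using away_in_sets[OF assms] by (simp add: sets_Mp[OF \<mu>(1)])
    also have "\<dots> \<le> (\<integral>\<^sup>+ t. ennreal (ramp b c t) \<partial>\<mu>)"
      using r(2,5) by (intro nn_integral_mono) (auto simp: indicator_def away_def)
    also have "\<dots> = ennreal (\<integral>t. ramp b c t \<partial>\<mu>)"
      using CK_plus_integrable[OF \<mu>(1) r(1)] r(2) by (intro nn_integral_eq_integral) auto
    also have "\<dots> < 1" using \<mu>(2) by (metis ennreal_1 ennreal_less_iff ennreal_lessI less_numeral_extra(1))
    finally show "\<mu> \<in> {\<mu> \<in> Mp. emeasure \<mu> (away c) = 0}"
      using Mp_less_one_imp_zero[OF \<mu>(1) assms away_in_sets[OF assms]] \<mu>(1) by auto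
  qed
  moreover have "openin vague (\<Union>b\<in>{0<..<c}. ?U b)"
    using ramp_props(1) by (intro openin_Union) (auto intro!: vague_integral_open[of _ "{..<1}", simplified])
  ultimately show ?thesis by simp
qed

lemma openin_Mfin: "openin vague Mfin"
proof -
  have "Mfin = (\<Union>c\<in>{0<..}. {\<mu> \<in> Mp. emeasure \<mu> (outside c) \<noteq> 0}) \<inter>
      (\<Union>c\<in>{0<..}. {\<mu> \<in> Mp. emeasure \<mu> (away c) = 0})"
    using Mfin_iff by auto
  also have "openin vague \<dots>"
    by (intro openin_Int openin_Union) (auto intro: openin_outside_pos openin_away_zero)
  finally show ?thesis .
qed

lemma Mfin_subset: "Mfin \<subseteq> M0" "M0 \<subseteq> Mp"
  by (auto simp: Mfin_def M0_def)

lemma topspace_Mfin: "topspace (subtopology vague Mfin) = Mfin"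
  using Mfin_subset by (auto simp: topspace_vague)

lemma continuous_map_max_modulus:
  "continuous_map (subtopology vague Mfin) euclideanreal max_modulus"
  unfolding continuous_map_upper_lower_semicontinuous_lt topspace_Mfin
proof (intro conjI allI)
  have op: "openin (subtopology vague Mfin) A" if "openin vague B" "A = B \<inter> Mfin" for A B
    using that by (auto simp: openin_subtopology)
  fix c :: real
  have all: "openin (subtopology vague Mfin) Mfin" by (rule op[OF openin_Mfin]) simp
  show "openin (subtopology vague Mfin) {\<mu> \<in> Mfin. c < max_modulus \<mu>}"
  proof (cases "c > 0")
    case True
    have "{\<mu> \<in> Mfin. c < max_modulus \<mu>} = {\<mu> \<in> Mp. emeasure \<mu> (outside c) \<noteq> 0} \<inter> Mfin"
      using max_modulus_less_iff(2)[OF _ True] Mfin_subset by auto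
    then show ?thesis using op[OF openin_outside_pos[OF True]] by blast
  next
    case False
    then have "{\<mu> \<in> Mfin. c < max_modulus \<mu>} = Mfin"
      using max_modulus_less_iff(1) by fastforce
    then show ?thesis using all by simp
  qed
  show "openin (subtopology vague Mfin) {\<mu> \<in> Mfin. max_modulus \<mu> < c}"
  proof (cases "c > 0")
    case True
    have "{\<mu> \<in> Mfin. max_modulus \<mu> < c} = {\<mu> \<in> Mp. emeasure \<mu> (away c) = 0} \<inter> Mfin"
      using max_modulus_less_iff(3)[OF _ True] Mfin_subset by auto
    then show ?thesis using op[OF openin_away_zero[OF True]] by blast
  next
    case False
    then have "{\<mu> \<in> Mfin. max_modulus \<mu> < c} = {}"
      using max_modulus_less_iff(1) by fastforce
    then show ?thesis by (simp only: openin_empty)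
  qed
qed

lemma away_1_eq: "away 1 = outside 1 \<union> {-1, 1}"
proof (intro set_eqI)
  fix t :: ereal
  show "t \<in> away 1 \<longleftrightarrow> t \<in> outside 1 \<union> {-1, 1}"
    by (cases t) (auto simp: away_def outside_def E_def one_ereal_def)
qed

text \<open>\<open>away 1\<close> is the disjoint union of \<open>outside 1\<close> and
  \<open>{-1, 1}\<close>; largest modulus 1 says that the first part is null while the whole is
  not.\<close>

lemma Mtilde_iff: "\<mu> \<in> Mtilde \<longleftrightarrow> \<mu> \<in> Mfin \<and> max_modulus \<mu> = 1"
proof -
  have pm: "{-1, 1} \<in> sets borel_E" by (simp add: sets_borel_E_iff E_def)
  have split: "emeasure \<mu> (away 1) = emeasure \<mu> (outside 1) + emeasure \<mu> {-1, 1}" if "\<mu> \<in> Mp"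
    unfolding away_1_eq using that pm outside_in_sets
    by (intro plus_emeasure[symmetric]) (simp add: sets_Mp, simp add: sets_Mp, auto simp: outside_def)
  show ?thesis
  proof
    assume "\<mu> \<in> Mtilde"
    then have \<mu>: "\<mu> \<in> Mp" "emeasure \<mu> (outside 1) = 0" "emeasure \<mu> {-1, 1} \<noteq> 0"
      by (auto simp: Mtilde_def)
    have "emeasure \<mu> (away 1) \<noteq> 0" using split \<mu> by auto
    then have "emeasure \<mu> (outside (1/2)) \<noteq> 0"
      using emeasure_eq_0_mono[OF \<mu>(1) outside_in_sets, of "1/2" "away 1"] away_subset_outside by auto
    moreover have "emeasure \<mu> (away 2) = 0"
      using emeasure_eq_0_mono[OF \<mu>(1) outside_in_sets \<mu>(2), of "away 2"] away_subset_outside by auto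
    ultimately have fin: "\<mu> \<in> Mfin" using \<mu>(1) unfolding Mfin_iff
      by (auto intro: exI[of _ "1/2"] exI[of _ 2])
    then show "\<mu> \<in> Mfin \<and> max_modulus \<mu> = 1"
      using max_modulus_less_iff(2,3)[OF fin, of 1] \<mu>(2) \<open>emeasure \<mu> (away 1) \<noteq> 0\<close> by auto
  next
    assume *: "\<mu> \<in> Mfin \<and> max_modulus \<mu> = 1"
    then have \<mu>: "\<mu> \<in> Mp" using Mfin_subset by auto
    have "emeasure \<mu> (outside 1) = 0" "emeasure \<mu> (away 1) \<noteq> 0"
      using max_modulus_less_iff(2,3)[of \<mu> 1] * by auto
    then show "\<mu> \<in> Mtilde" using split[OF \<mu>] \<mu> by (auto simp: Mtilde_def zero_less_iff_neq_zero)
  qed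
qed

lemma Mtilde_subset: "Mtilde \<subseteq> Mfin" "Mtilde \<subseteq> Mp"
  using Mtilde_iff Mfin_subset by auto

lemma emeasure_scale_outside:
  assumes "\<mu> \<in> Mp" "y > 0"
  shows "emeasure (scale y \<mu>) (outside c) = emeasure \<mu> (outside (c / y))"
proof -
  have "{t \<in> E. ereal y * t \<in> outside c} = outside (c / y)"
    using outside_scale_iff[OF assms(2)] by (auto simp: outside_def)
  then show ?thesis using emeasure_scale[OF assms outside_in_sets] by simp
qed

lemma emeasure_scale_away:
  assumes "\<mu> \<in> Mp" "y > 0" "c > 0"
  shows "emeasure (scale y \<mu>) (away c) = emeasure \<mu> (away (c / y))"
proof -
  have "{t \<in> E. ereal y * t \<in> away c} = away (c / y)"
    using away_scale_iff[OF assms(2)] away_subset_E[of "c / y"] assms by auto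
  then show ?thesis using emeasure_scale[OF assms(1,2) away_in_sets[OF assms(3)]] by simp
qed

lemma scale_Mfin:
  assumes "\<mu> \<in> Mfin" "y > 0"
  shows "scale y \<mu> \<in> Mfin" and "max_modulus (scale y \<mu>) = y * max_modulus \<mu>"
proof -
  have \<mu>: "\<mu> \<in> Mp" using assms Mfin_subset by auto
  obtain a b where ab: "a > 0" "emeasure \<mu> (outside a) \<noteq> 0" "b > 0" "emeasure \<mu> (away b) = 0"
    using assms by (auto simp: Mfin_iff)
  have "emeasure (scale y \<mu>) (outside (y * a)) \<noteq> 0" "emeasure (scale y \<mu>) (away (y * b)) = 0"
    using ab assms(2) \<mu> by (auto simp: emeasure_scale_outside emeasure_scale_away)
  moreover have "y * a > 0" "y * b > 0" using ab assms(2) by auto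
  ultimately show fin: "scale y \<mu> \<in> Mfin"
    unfolding Mfin_iff using scale_Mp[OF \<mu> assms(2)] by blast
  have "c < max_modulus (scale y \<mu>) \<longleftrightarrow> c < y * max_modulus \<mu>" if "c > 0" for c
    using max_modulus_less_iff(2)[OF fin that] max_modulus_less_iff(2)[OF assms(1), of "c / y"] that assms(2)
    by (simp add: emeasure_scale_outside[OF \<mu>] field_simps)
  moreover have "max_modulus (scale y \<mu>) > 0" "y * max_modulus \<mu> > 0"
    using max_modulus_less_iff(1) fin assms by auto
  ultimately show "max_modulus (scale y \<mu>) = y * max_modulus \<mu>"
    by (metis linorder_neqE_linordered_idom less_irrefl)
qed

lemma normalized_in_Mtilde:
  assumes "\<mu> \<in> Mfin"
  shows "normalized \<mu> \<in> Mtilde"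
  unfolding Mtilde_iff normalized_def
  using scale_Mfin[OF assms, of "1 / max_modulus \<mu>"] max_modulus_less_iff(1)[OF assms] by simp

lemma scale_Mtilde:
  assumes "\<mu> \<in> Mtilde" "y > 0"
  shows "scale y \<mu> \<in> Mfin" "max_modulus (scale y \<mu>) = y" "normalized (scale y \<mu>) = \<mu>"
proof -
  have \<mu>: "\<mu> \<in> Mfin" "max_modulus \<mu> = 1" "\<mu> \<in> Mp" using assms Mtilde_iff Mtilde_subset by auto
  show "scale y \<mu> \<in> Mfin" "max_modulus (scale y \<mu>) = y"
    using scale_Mfin[OF \<mu>(1) assms(2)] \<mu>(2) by auto
  then show "normalized (scale y \<mu>) = \<mu>"
    using assms(2) \<mu>(3) by (simp add: normalized_def scale_scale scale_1)
qed

lemma scale_normalized: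
  assumes "\<mu> \<in> Mfin"
  shows "scale (max_modulus \<mu>) (normalized \<mu>) = \<mu>"
proof -
  have "\<mu> \<in> Mp" "max_modulus \<mu> > 0" using assms Mfin_subset max_modulus_less_iff(1) by auto
  then show ?thesis by (simp add: normalized_def scale_scale scale_1)
qed

text \<open>The factor \<open>1 / max_modulus \<mu>\<close> moves with \<mu>, so this is where joint
  continuity of \<open>scale\<close> is required.\<close>

lemma continuous_map_normalized:
  "continuous_map (subtopology vague Mfin) (subtopology vague Mtilde) normalized"
  unfolding continuous_map_in_subtopology
proof
  let ?X = "subtopology vague Mfin"
  have "continuous_map ?X euclideanreal (\<lambda>\<mu>. 1 / max_modulus \<mu>)"
    using continuous_map_max_modulus max_modulus_less_iff(1)
    by (intro continuous_map_real_divide) (auto simp: topspace_Mfin, force)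
  then have "continuous_map ?X (top_of_set {0<..}) (\<lambda>\<mu>. 1 / max_modulus \<mu>)"
    using max_modulus_less_iff(1) Mfin_subset by (auto simp: continuous_map_in_subtopology)
  moreover have "continuous_map ?X vague (\<lambda>\<mu>. \<mu>)"
    using continuous_map_from_subtopology continuous_map_id[of vague, unfolded id_def] by blast
  ultimately have "continuous_map ?X (prod_topology (top_of_set {0<..}) vague) (\<lambda>\<mu>. (1 / max_modulus \<mu>, \<mu>))"
    by (rule continuous_map_pairedI)
  from continuous_map_compose[OF this continuous_map_scale]
  show "continuous_map ?X vague normalized"
    by (simp add: o_def normalized_def[abs_def])
  show "normalized \<in> topspace ?X \<rightarrow> Mtilde"
    using normalized_in_Mtilde by (auto simp: topspace_Mfin)
qed

lemma M_exceed_scale_iff: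
  assumes "\<mu> \<in> Mtilde" "y > 0" "x > 0"
  shows "scale y \<mu> \<in> M_exceed x \<longleftrightarrow> x < y"
  using scale_Mtilde[OF assms(1,2)] Mfin_subset max_modulus_less_iff(2)[of "scale y \<mu>" x] assms(3)
  by (auto simp: M_exceed_def zero_less_iff_neq_zero)

section \<open>The limiting intensity\<close>

lemma space_nu: "space (nu \<theta> \<alpha>) = {0<..}"
  by (simp add: nu_def space_restrict_space)

lemma measurable_nu: "f \<in> borel_measurable borel \<Longrightarrow> f \<in> borel_measurable (nu \<theta> \<alpha>)"
  by (simp add: nu_def measurable_restrict_space1)

lemma sets_nu: "A \<in> sets borel \<Longrightarrow> A \<subseteq> {0<..} \<Longrightarrow> A \<in> sets (nu \<theta> \<alpha>)"
  by (auto simp: nu_def sets_restrict_space_iff)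

lemma emeasure_nu_greaterThan:
  assumes "\<theta> > 0" "\<alpha> > 0" "x > 0"
  shows "emeasure (nu \<theta> \<alpha>) {x<..} = ennreal (\<theta> * x powr (- \<alpha>))"
proof -
  let ?f = "\<lambda>y. \<theta> * \<alpha> * y powr (- \<alpha> - 1)"
  have "emeasure (nu \<theta> \<alpha>) {x<..} =
      (\<integral>\<^sup>+ y. ennreal (?f y) * indicator {x<..} y \<partial>restrict_space lborel {0<..})"
    unfolding nu_def using assms
    by (intro emeasure_density) (auto simp: sets_restrict_space_iff intro!: measurable_restrict_space1)
  also have "\<dots> = (\<integral>\<^sup>+ y. ennreal (?f y) * indicator {x<..} y * indicator {0<..} y \<partial>lborel)"
    by (intro nn_integral_restrict_space) simp
  also have "\<dots> = (\<integral>\<^sup>+ y. ennreal (?f y) * indicator {x..} y \<partial>lborel)"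
    using AE_lborel_singleton[of x] assms
    by (intro nn_integral_cong_AE) (auto elim!: eventually_mono simp: indicator_def)
  also have "\<dots> = ennreal (0 - (- \<theta> * x powr (- \<alpha>)))"
  proof (intro nn_integral_FTC_atLeast[where F = "\<lambda>y. - \<theta> * y powr (- \<alpha>)"])
    show "((\<lambda>y. - \<theta> * y powr - \<alpha>) \<longlongrightarrow> 0) at_top"
      using tendsto_mult[OF tendsto_const tendsto_neg_powr[OF _ filterlim_ident], of "- \<alpha>" "- \<theta>"] assms
      by simp
    show "((\<lambda>y. - \<theta> * y powr - \<alpha>) has_real_derivative ?f y) (at y)" if "x \<le> y" for y
      using that assms by (auto intro!: derivative_eq_intros)
  qed (use assms in auto)
  finally show ?thesis by simp
qed

lemma emeasure_nu_interval:
  assumes "\<theta> > 0" "\<alpha> > 0" "a > 0" "a \<le> b"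
  shows "emeasure (nu \<theta> \<alpha>) {a<..b} = ennreal (\<theta> * a powr (- \<alpha>) - \<theta> * b powr (- \<alpha>))"
proof -
  have "{a<..b} = {a<..} - {b<..}" using assms by auto
  moreover have "emeasure (nu \<theta> \<alpha>) ({a<..} - {b<..}) = emeasure (nu \<theta> \<alpha>) {a<..} - emeasure (nu \<theta> \<alpha>) {b<..}"
  proof (rule emeasure_Diff)
    show "emeasure (nu \<theta> \<alpha>) {b<..} \<noteq> \<infinity>" using assms by (simp add: emeasure_nu_greaterThan)
    show "{a<..} \<in> sets (nu \<theta> \<alpha>)" "{b<..} \<in> sets (nu \<theta> \<alpha>)"
      using assms by (auto intro!: sets_nu)
    show "{b<..} \<subseteq> {a<..}" using assms by auto
  qed
  ultimately show ?thesis using assms by (simp add: emeasure_nu_greaterThan ennreal_minus)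
qed

text \<open>\<open>K\<close> seen as a function of \<open>y\<close>; as \<open>Mtilde\<close> lies
  in \<open>M0\<close>, the intersection with \<open>M0\<close> in \<open>K\<close>
  disappears.\<close>

definition hit :: "ereal measure measure \<Rightarrow> ereal measure set \<Rightarrow> real \<Rightarrow> ennreal" where
  "hit Q M y = emeasure Q {\<mu> \<in> Mtilde. scale y \<mu> \<in> M}"

text \<open>An element of \<open>Mtilde\<close> scaled by y has largest modulus y, so intersecting
  with \<open>M_exceed x\<close> truncates the integral to y > x.\<close>

lemma lam_Int_M_exceed:
  assumes "x > 0"
  shows "lam \<theta> \<alpha> Q (M \<inter> M_exceed x) = (\<integral>\<^sup>+ y. indicator {x<..} y * hit Q M y \<partial>nu \<theta> \<alpha>)"
  unfolding lam_def
proof (rule nn_integral_cong)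
  fix y assume "y \<in> space (nu \<theta> \<alpha>)"
  then have y: "y > 0" by (simp add: space_nu)
  have "{\<mu> \<in> M0. scale y \<mu> \<in> M \<inter> M_exceed x} \<inter> Mtilde =
      (if x < y then {\<mu> \<in> Mtilde. scale y \<mu> \<in> M} else {})"
    using M_exceed_scale_iff[OF _ y assms] Mtilde_subset Mfin_subset by auto
  then show "K Q y (M \<inter> M_exceed x) = indicator {x<..} y * hit Q M y"
    by (auto simp: K_def hit_def)
qed

lemma topspace_Mtilde: "topspace (subtopology vague Mtilde) = Mtilde"
  using Mtilde_subset by (auto simp: topspace_vague)

lemma measurable_scale_vague:
  assumes "y > 0"
  shows "scale y \<in> measurable (borel_of (subtopology vague Mtilde)) (borel_of vague)"
proof (rule continuous_map_measurable_borel_of)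
  have "continuous_map (subtopology vague Mtilde) (prod_topology (top_of_set {0<..}) vague) (\<lambda>\<mu>. (y, \<mu>))"
    using assms continuous_map_from_subtopology[OF continuous_map_id[of vague, unfolded id_def]]
    by (intro continuous_map_pairedI) (auto simp: continuous_map_in_subtopology)
  from continuous_map_compose[OF this continuous_map_scale]
  show "continuous_map (subtopology vague Mtilde) vague (scale y)" by (simp add: o_def)
qed

lemma hit_sets:
  assumes "sets Q = sets (borel_of (subtopology vague Mtilde))" "M \<in> sets (borel_of vague)" "y > 0"
  shows "{\<mu> \<in> Mtilde. scale y \<mu> \<in> M} \<in> sets Q"
proof -
  have "scale y -` M \<inter> space (borel_of (subtopology vague Mtilde)) \<in> sets Q"
    unfolding assms(1) using measurable_scale_vague[OF assms(3)] assms(2) by (rule measurable_sets)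
  moreover have "scale y -` M \<inter> space (borel_of (subtopology vague Mtilde)) = {\<mu> \<in> Mtilde. scale y \<mu> \<in> M}"
    by (auto simp: topspace_Mtilde simp del: topspace_subtopology)
  ultimately show ?thesis by simp
qed

section \<open>Dyadic slabs and integrals over open sets\<close>

text \<open>Half-open on the left so that the cells of one level partition {x<..}, and so that the
  mass of each is a difference of two tails with strict inequality, as in the hypothesis
  \<open>tail\<close> below.\<close>

definition cell :: "real \<Rightarrow> nat \<Rightarrow> nat \<Rightarrow> real set" where
  "cell x m j = {x + real j / 2 ^ m <.. x + (real j + 1) / 2 ^ m}"

text \<open>Among the sets \<open>A\<close> for which scaling maps \<open>I \<times> A\<close> into \<open>G\<close>, the largest open one.\<close>

definition core :: "ereal measure set \<Rightarrow> real set \<Rightarrow> ereal measure set" where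
  "core G I = \<Union>{U. openin (subtopology vague Mtilde) U \<and> (\<forall>y\<in>I. \<forall>\<mu>\<in>U. scale y \<mu> \<in> G)}"

text \<open>A step function of \<open>y\<close>: on each cell it is the Q-measure of the part of
  \<open>Mtilde\<close> that the whole cell scales into G. It increases with \<open>m\<close>
  because cells are nested.\<close>

definition slab_sum :: "ereal measure measure \<Rightarrow> ereal measure set \<Rightarrow> real \<Rightarrow> nat \<Rightarrow> real \<Rightarrow> ennreal" where
  "slab_sum Q G x m y = (\<Sum>j. indicator (cell x m j) y * emeasure Q (core G (cell x m j)))"

lemma openin_core: "openin (subtopology vague Mtilde) (core G I)"
  unfolding core_def by (rule openin_Union) auto

lemma core_subset: "core G I \<subseteq> Mtilde"
  using openin_subset[OF openin_core] topspace_Mtilde by metis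

lemma core_antimono: "I \<subseteq> J \<Longrightarrow> core G J \<subseteq> core G I"
  unfolding core_def by blast

lemma scale_core: "\<mu> \<in> core G I \<Longrightarrow> y \<in> I \<Longrightarrow> scale y \<mu> \<in> G"
  unfolding core_def by blast

lemma cell_iff: "y \<in> cell x m j \<longleftrightarrow> real j < (y - x) * 2 ^ m \<and> (y - x) * 2 ^ m \<le> real j + 1"
  by (auto simp: cell_def field_simps)

lemma cell_ex:
  assumes "x < y"
  shows "\<exists>j. y \<in> cell x m j"
proof -
  define z where "z = (y - x) * 2 ^ m"
  have "z > 0" using assms by (simp add: z_def)
  then have "real (nat (\<lceil>z\<rceil> - 1)) < z" "z \<le> real (nat (\<lceil>z\<rceil> - 1)) + 1" by linarith+
  then show ?thesis unfolding cell_iff z_def by blast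
qed

lemma cell_disjoint:
  assumes "y \<in> cell x m i" "y \<in> cell x m j"
  shows "i = j"
proof -
  have "real i < real j + 1" "real j < real i + 1" using assms by (auto simp: cell_iff)
  then show ?thesis by linarith
qed

lemma cell_greater: "y \<in> cell x m j \<Longrightarrow> x < y"
  by (auto simp: cell_def intro: le_less_trans[rotated])

lemma cell_Suc_subset: "cell x (Suc m) j \<subseteq> cell x m (j div 2)"
proof
  fix y assume "y \<in> cell x (Suc m) j"
  then have *: "real j < 2 * ((y - x) * 2 ^ m)" "2 * ((y - x) * 2 ^ m) \<le> real j + 1"
    by (auto simp: cell_iff)
  have "2 * (j div 2) \<le> j" "j \<le> 2 * (j div 2) + 1" by auto
  then have "2 * real (j div 2) \<le> real j" "real j \<le> 2 * real (j div 2) + 1"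
    by linarith+
  then show "y \<in> cell x m (j div 2)" unfolding cell_iff using * by linarith
qed

lemma slab_sum_eq:
  assumes "y \<in> cell x m j"
  shows "slab_sum Q G x m y = emeasure Q (core G (cell x m j))"
proof -
  have "slab_sum Q G x m y = (\<Sum>i\<in>{j}. indicator (cell x m i) y * emeasure Q (core G (cell x m i)))"
    unfolding slab_sum_def using cell_disjoint[OF assms] by (intro suminf_finite) (auto simp: indicator_def)
  then show ?thesis using assms by simp
qed

lemma slab_sum_0:
  assumes "y \<le> x"
  shows "slab_sum Q G x m y = 0"
proof -
  have "y \<notin> cell x m j" for j using cell_greater[of y x m j] assms by auto
  then show ?thesis by (simp add: slab_sum_def)
qed

lemma slab_sum_mono:
  assumes "sets Q = sets (borel_of (subtopology vague Mtilde))"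
  shows "slab_sum Q G x m y \<le> slab_sum Q G x (Suc m) y"
proof (cases "x < y")
  case True
  then obtain j where j: "y \<in> cell x (Suc m) j" using cell_ex by blast
  then have j': "y \<in> cell x m (j div 2)" using cell_Suc_subset by blast
  have "core G (cell x m (j div 2)) \<subseteq> core G (cell x (Suc m) j)"
    by (intro core_antimono cell_Suc_subset)
  then show ?thesis unfolding slab_sum_eq[OF j] slab_sum_eq[OF j']
    by (intro emeasure_mono) (auto simp: assms intro!: borel_of_open openin_core)
qed (simp add: slab_sum_0)

text \<open>If y scales \<mu> into the open set G, joint continuity gives a product neighbourhood of
  (y, \<mu>) that is mapped into G; a cell around y of length 2^(-m) below its radius then puts
  \<mu> into the core at level m. So the cores increase to the full section, and continuity of Q
  from below finishes.\<close>

lemma slab_sum_SUP: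
  assumes Q: "sets Q = sets (borel_of (subtopology vague Mtilde))" and G: "openin vague G" and "x > 0"
  shows "(SUP m. slab_sum Q G x m y) = indicator {x<..} y * hit Q G y"
proof (cases "x < y")
  case True
  then have "\<forall>m. \<exists>j. y \<in> cell x m j" using cell_ex by blast
  then obtain J where J: "\<And>m. y \<in> cell x m (J m)" by metis
  define A where "A m = core G (cell x m (J m))" for m
  have cells: "cell x (Suc m) (J (Suc m)) \<subseteq> cell x m (J m)" for m
  proof -
    have "y \<in> cell x m (J (Suc m) div 2)" using cell_Suc_subset J[of "Suc m"] by (rule subsetD)
    then have "J m = J (Suc m) div 2" by (rule cell_disjoint[OF J[of m]])
    then show ?thesis using cell_Suc_subset[of x m "J (Suc m)"] by simp
  qed
  have "incseq A"
    unfolding A_def by (intro incseq_SucI core_antimono cells)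
  moreover have "range A \<subseteq> sets Q"
    unfolding A_def Q by (auto intro!: borel_of_open openin_core)
  ultimately have "(SUP m. emeasure Q (A m)) = emeasure Q (\<Union>m. A m)"
    by (intro SUP_emeasure_incseq)
  also have "(\<Union>m. A m) = {\<mu> \<in> Mtilde. scale y \<mu> \<in> G}"
  proof (intro equalityI subsetI)
    fix \<mu> assume "\<mu> \<in> (\<Union>m. A m)"
    then show "\<mu> \<in> {\<mu> \<in> Mtilde. scale y \<mu> \<in> G}"
      using core_subset scale_core J unfolding A_def by blast
  next
    fix \<mu> assume "\<mu> \<in> {\<mu> \<in> Mtilde. scale y \<mu> \<in> G}"
    then have \<mu>: "\<mu> \<in> Mtilde" "\<mu> \<in> Mp" "scale y \<mu> \<in> G" using Mtilde_subset by auto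
    let ?X = "prod_topology (top_of_set {0<..}) vague"
    define W where "W = {p \<in> topspace ?X. (case p of (y, \<mu>) \<Rightarrow> scale y \<mu>) \<in> G}"
    have W: "openin ?X W"
      unfolding W_def using continuous_map_scale G by (rule openin_continuous_map_preimage)
    have yW: "(y, \<mu>) \<in> W"
      using \<mu> True \<open>x > 0\<close> by (auto simp: topspace_vague W_def)
    obtain U V where UV: "openin (top_of_set {0<..}) U" "openin vague V" "y \<in> U" "\<mu> \<in> V" "U \<times> V \<subseteq> W"
      using iffD1[OF openin_prod_topology_alt W, rule_format, OF yW] by blast
    obtain e where e: "e > 0" "ball y e \<inter> {0<..} \<subseteq> U"
      using UV(1,3) unfolding openin_contains_ball by blast
    obtain m where m: "(1 / 2) ^ m < e" using real_arch_pow_inv[OF e(1), of "1/2"] by auto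
    have "cell x m (J m) \<subseteq> U"
    proof
      fix y' assume y': "y' \<in> cell x m (J m)"
      then have "\<bar>(y' - x) * 2 ^ m - (y - x) * 2 ^ m\<bar> < 1"
        using J[of m] unfolding cell_iff by linarith
      then have "\<bar>y' - y\<bar> * 2 ^ m < 1" by (simp add: left_diff_distrib[symmetric] abs_mult)
      then have "\<bar>y' - y\<bar> < (1 / 2) ^ m" by (simp add: field_simps power_divide)
      then have "y' \<in> ball y e" using m by (simp add: dist_real_def abs_minus_commute)
      moreover have "y' > 0" using cell_greater[OF y'] \<open>x > 0\<close> by simp
      ultimately show "y' \<in> U" using e(2) by auto
    qed
    then have "\<forall>y\<in>cell x m (J m). \<forall>\<mu>\<in>V \<inter> Mtilde. (y, \<mu>) \<in> W" using UV(5) by blast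
    then have "\<forall>y\<in>cell x m (J m). \<forall>\<mu>\<in>V \<inter> Mtilde. scale y \<mu> \<in> G" by (simp add: W_def)
    moreover have "openin (subtopology vague Mtilde) (V \<inter> Mtilde)"
      using UV(2) by (auto simp: openin_subtopology)
    ultimately have "V \<inter> Mtilde \<subseteq> A m" unfolding A_def core_def by blast
    then show "\<mu> \<in> (\<Union>m. A m)" using UV(4) \<mu>(1) by blast
  qed
  finally have "(SUP m. emeasure Q (A m)) = hit Q G y" by (simp add: hit_def)
  then show ?thesis using True slab_sum_eq[OF J] by (simp add: A_def)
qed (simp add: slab_sum_0)

lemma measurable_slab_sum: "slab_sum Q G x m \<in> borel_measurable (nu \<theta> \<alpha>)"
proof -
  have "cell x m j \<in> sets borel" for j by (simp add: cell_def)
  then show ?thesis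
    unfolding slab_sum_def
    by (intro measurable_nu borel_measurable_suminf_order borel_measurable_times borel_measurable_indicator) auto
qed

text \<open>Obtained as a supremum of step functions, which works for open sets; the frontier is
  treated later as a complement of two open sets.\<close>

lemma measurable_hit_open:
  assumes "sets Q = sets (borel_of (subtopology vague Mtilde))" "openin vague G" "x > 0"
  shows "(\<lambda>y. indicator {x<..} y * hit Q G y) \<in> borel_measurable (nu \<theta> \<alpha>)"
  unfolding slab_sum_SUP[OF assms, symmetric]
  by (intro borel_measurable_SUP) (auto simp: measurable_slab_sum)

lemma nn_integral_hit_open:
  assumes "sets Q = sets (borel_of (subtopology vague Mtilde))" "openin vague G" "x > 0"
  shows "(\<integral>\<^sup>+ y. indicator {x<..} y * hit Q G y \<partial>nu \<theta> \<alpha>) =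
    (SUP m. \<Sum>j. emeasure (nu \<theta> \<alpha>) (cell x m j) * emeasure Q (core G (cell x m j)))"
proof -
  have "(\<integral>\<^sup>+ y. slab_sum Q G x m y \<partial>nu \<theta> \<alpha>) =
      (\<Sum>j. emeasure (nu \<theta> \<alpha>) (cell x m j) * emeasure Q (core G (cell x m j)))" for m
  proof -
    have "0 < y" if "y \<in> cell x m j" for j y using cell_greater[OF that] assms(3) by simp
    then have c: "cell x m j \<in> sets (nu \<theta> \<alpha>)" for j
      by (intro sets_nu) (auto simp: cell_def)
    have "(\<integral>\<^sup>+ y. slab_sum Q G x m y \<partial>nu \<theta> \<alpha>) =
        (\<Sum>j. \<integral>\<^sup>+ y. indicator (cell x m j) y * emeasure Q (core G (cell x m j)) \<partial>nu \<theta> \<alpha>)"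
      unfolding slab_sum_def using c by (intro nn_integral_suminf) auto
    also have "\<dots> = (\<Sum>j. emeasure (nu \<theta> \<alpha>) (cell x m j) * emeasure Q (core G (cell x m j)))"
      using c by (simp add: nn_integral_multc)
    finally show ?thesis .
  qed
  then show ?thesis
    unfolding slab_sum_SUP[OF assms, symmetric]
    using slab_sum_mono[OF assms(1)] measurable_slab_sum
    by (subst nn_integral_monotone_convergence_SUP) (auto intro!: incseq_SucI le_funI)
qed

section \<open>Convergence of exceedances\<close>

lemma lam_M_exceed:
  assumes "prob_space Q" "sets Q = sets (borel_of (subtopology vague Mtilde))"
    and "\<theta> > 0" "\<alpha> > 0" "x > 0"
  shows "lam \<theta> \<alpha> Q (M_exceed x) = ennreal (\<theta> * x powr (- \<alpha>))"
proof -
  have "space Q = Mtilde"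
    using sets_eq_imp_space_eq[OF assms(2)] topspace_Mtilde by simp
  then have hit1: "hit Q UNIV y = 1" for y
    using prob_space.emeasure_space_1[OF assms(1)] by (simp add: hit_def)
  have "lam \<theta> \<alpha> Q (M_exceed x) = (\<integral>\<^sup>+ y. indicator {x<..} y * hit Q UNIV y \<partial>nu \<theta> \<alpha>)"
    using lam_Int_M_exceed[OF assms(5), of \<theta> \<alpha> Q UNIV] by simp
  also have "\<dots> = (\<integral>\<^sup>+ y. indicator {x<..} y \<partial>nu \<theta> \<alpha>)"
    by (simp add: hit1)
  also have "\<dots> = emeasure (nu \<theta> \<alpha>) {x<..}"
    using assms by (intro nn_integral_indicator sets_nu) auto
  finally show ?thesis using emeasure_nu_greaterThan[OF assms(3-5)] by simp
qed

text \<open>Here \<open>N n\<close> stands for the point process of the first block and \<open>c n\<close> for the number of blocks.\<close>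

locale exceedance = prob_space P for P :: "'a measure" +
  fixes Q :: "ereal measure measure" and \<theta> \<alpha> :: real
    and N :: "nat \<Rightarrow> 'a \<Rightarrow> ereal measure" and c :: "nat \<Rightarrow> real"
  assumes prob_Q: "prob_space Q"
    and sets_Q: "sets Q = sets (borel_of (subtopology vague Mtilde))"
    and theta: "\<theta> > 0" and alpha: "\<alpha> > 0" and c_nonneg: "\<And>n. c n \<ge> 0"
    and N: "\<And>n. N n \<in> measurable P (borel_of (subtopology vague Mfin))"
    and tail: "\<And>x. x > 0 \<Longrightarrow>
      (\<lambda>n. c n * prob {\<omega> \<in> space P. x < max_modulus (N n \<omega>)}) \<longlonglongrightarrow> \<theta> * x powr (- \<alpha>)"
begin

sublocale Q: prob_space Q by (rule prob_Q)

abbreviation XT :: "ereal measure topology" where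
  "XT \<equiv> subtopology vague Mtilde"

text \<open>If the exceedance has probability 0 this is the null measure. By \<open>tail\<close>,
  whose limit is positive, that happens for finitely many n at each x > 0.\<close>

definition law :: "nat \<Rightarrow> real \<Rightarrow> ereal measure measure" where
  "law n x = distr (uniform_measure P {\<omega> \<in> space P. x < max_modulus (N n \<omega>)}) (borel_of XT)
     (\<lambda>\<omega>. normalized (N n \<omega>))"

lemma N_Mfin: "\<omega> \<in> space P \<Longrightarrow> N n \<omega> \<in> Mfin"
  using measurable_space[OF N] topspace_Mfin by (metis space_borel_of)

lemma measurable_top [measurable]: "(\<lambda>\<omega>. max_modulus (N n \<omega>)) \<in> borel_measurable P"
  using measurable_compose[OF N continuous_map_real_measurable[OF continuous_map_max_modulus]] .

lemma measurable_norm: "(\<lambda>\<omega>. normalized (N n \<omega>)) \<in> measurable P (borel_of XT)"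
  using measurable_compose[OF N continuous_map_measurable_borel_of[OF continuous_map_normalized]] .

lemma measurable_N: "N n \<in> measurable P (borel_of vague)"
  using measurable_compose[OF N continuous_map_measurable_borel_of[OF
      continuous_map_from_subtopology[OF continuous_map_id[of vague, unfolded id_def]]]] .

lemma norm_Mtilde: "\<omega> \<in> space P \<Longrightarrow> normalized (N n \<omega>) \<in> Mtilde"
  using N_Mfin normalized_in_Mtilde by blast

lemma space_Q: "space Q = Mtilde"
  using sets_eq_imp_space_eq[OF sets_Q] topspace_Mtilde by simp

lemma exceed_sets [measurable]: "{\<omega> \<in> space P. x < max_modulus (N n \<omega>)} \<in> events"
  by measurable

lemma hit_events:
  assumes "M \<in> sets (borel_of vague)"
  shows "{\<omega> \<in> space P. x < max_modulus (N n \<omega>) \<and> N n \<omega> \<in> M} \<in> events"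
proof -
  have "N n -` M \<inter> space P \<in> events" using measurable_N assms by (rule measurable_sets)
  then have "{\<omega> \<in> space P. x < max_modulus (N n \<omega>)} \<inter> (N n -` M \<inter> space P) \<in> events"
    using exceed_sets by blast
  also have "{\<omega> \<in> space P. x < max_modulus (N n \<omega>)} \<inter> (N n -` M \<inter> space P) =
     {\<omega> \<in> space P. x < max_modulus (N n \<omega>) \<and> N n \<omega> \<in> M}" by auto
  finally show ?thesis .
qed

lemma measurable_g:
  fixes g :: "ereal measure \<Rightarrow> real"
  assumes "continuous_map XT euclideanreal g"
  shows "(\<lambda>\<omega>. g (normalized (N n \<omega>))) \<in> borel_measurable P" "g \<in> borel_measurable Q"
  using measurable_compose[OF measurable_norm continuous_map_real_measurable[OF assms]]
    continuous_map_real_measurable[OF assms] measurable_cong_sets[OF sets_Q refl] by auto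

text \<open>Stated as a product and not as a quotient so that it also holds, with both sides 0, when
  the conditioning event has probability 0.\<close>

lemma integral_law:
  fixes g :: "ereal measure \<Rightarrow> real"
  assumes g: "continuous_map XT euclideanreal g"
  shows "prob {\<omega> \<in> space P. x < max_modulus (N n \<omega>)} * (\<integral>\<mu>. g \<mu> \<partial>law n x) =
     (\<integral>\<omega>. indicator {x<..} (max_modulus (N n \<omega>)) * g (normalized (N n \<omega>)) \<partial>P)"
proof -
  define A where "A = {\<omega> \<in> space P. x < max_modulus (N n \<omega>)}"
  have A: "A \<in> events" unfolding A_def by (rule exceed_sets)
  have ind: "(\<integral>\<omega>. indicator {x<..} (max_modulus (N n \<omega>)) * g (normalized (N n \<omega>)) \<partial>P) =
      (\<integral>\<omega>. indicator A \<omega> * g (normalized (N n \<omega>)) \<partial>P)"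
    by (intro Bochner_Integration.integral_cong) (auto simp: A_def indicator_def)
  show ?thesis
  proof (cases "prob A = 0")
    case True
    then have "A \<in> null_sets P" using A by (simp add: null_sets_def emeasure_eq_measure)
    then have "AE \<omega> in P. indicator A \<omega> * g (normalized (N n \<omega>)) = 0"
      by (rule AE_not_in[THEN eventually_mono]) simp
    then have "(\<integral>\<omega>. indicator A \<omega> * g (normalized (N n \<omega>)) \<partial>P) = 0"
      by (rule integral_eq_zero_AE)
    then show ?thesis using True by (simp add: ind A_def)
  next
    case False
    then have pos: "prob A > 0" by (simp add: zero_less_measure_iff)
    have "(\<integral>\<mu>. g \<mu> \<partial>law n x) = (\<integral>\<omega>. g (normalized (N n \<omega>)) \<partial>uniform_measure P A)"
      unfolding law_def A_def[symmetric]
      using measurable_norm continuous_map_real_measurable[OF g]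
      by (intro integral_distr) (auto simp: measurable_cong_sets[OF sets_uniform_measure refl])
    also have "uniform_measure P A = density P (\<lambda>\<omega>. ennreal (indicator A \<omega> / prob A))"
    proof -
      have "indicator A \<omega> / emeasure P A = ennreal (indicator A \<omega> / prob A)" for \<omega>
        using pos divide_ennreal[of 1 "prob A"] by (auto simp: emeasure_eq_measure indicator_def)
      then show ?thesis unfolding uniform_measure_def by simp
    qed
    also have "(\<integral>\<omega>. g (normalized (N n \<omega>)) \<partial>\<dots>) = (\<integral>\<omega>. (indicator A \<omega> / prob A) *\<^sub>R g (normalized (N n \<omega>)) \<partial>P)"
      using measurable_g[OF g] A by (intro integral_density) auto
    also have "\<dots> = (\<integral>\<omega>. indicator A \<omega> * g (normalized (N n \<omega>)) \<partial>P) / prob A"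
      by simp
    finally show ?thesis using pos by (simp add: ind A_def)
  qed
qed

lemma weak_tail:
  fixes g :: "ereal measure \<Rightarrow> real"
  assumes W: "\<And>x. x > 0 \<Longrightarrow> weak_convergence_on XT (\<lambda>n. law n x) Q"
    and g: "continuous_map XT euclideanreal g" "bounded (g ` Mtilde)" and "x > 0"
  shows "(\<lambda>n. c n * (\<integral>\<omega>. indicator {x<..} (max_modulus (N n \<omega>)) * g (normalized (N n \<omega>)) \<partial>P))
    \<longlonglongrightarrow> \<theta> * x powr (- \<alpha>) * (\<integral>\<mu>. g \<mu> \<partial>Q)"
proof -
  have "(\<lambda>n. \<integral>\<mu>. g \<mu> \<partial>law n x) \<longlonglongrightarrow> (\<integral>\<mu>. g \<mu> \<partial>Q)"
    using W[OF \<open>x > 0\<close>] g unfolding weak_convergence_on_def topspace_Mtilde by blast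
  from tendsto_mult[OF tail[OF \<open>x > 0\<close>] this] show ?thesis
    by (simp add: mult.assoc integral_law[OF g(1)])
qed

text \<open>The slab {a<..b} is a difference of two exceedances, and its limiting mass is the
  corresponding difference of the two limits; boundedness of \<open>g\<close> makes both integrals
  finite.\<close>

lemma weak_slab:
  fixes g :: "ereal measure \<Rightarrow> real"
  assumes W: "\<And>x. x > 0 \<Longrightarrow> weak_convergence_on XT (\<lambda>n. law n x) Q"
    and g: "continuous_map XT euclideanreal g" "bounded (g ` Mtilde)" and ab: "0 < a" "a \<le> b"
  shows "(\<lambda>n. c n * (\<integral>\<omega>. indicator {a<..b} (max_modulus (N n \<omega>)) * g (normalized (N n \<omega>)) \<partial>P))
    \<longlonglongrightarrow> (\<theta> * a powr (- \<alpha>) - \<theta> * b powr (- \<alpha>)) * (\<integral>\<mu>. g \<mu> \<partial>Q)"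
proof -
  obtain B where B: "\<And>\<mu>. \<mu> \<in> Mtilde \<Longrightarrow> \<bar>g \<mu>\<bar> \<le> B" using g(2) by (auto simp: bounded_iff)
  have int: "integrable P (\<lambda>\<omega>. indicator {x<..} (max_modulus (N n \<omega>)) * g (normalized (N n \<omega>)))" for x n
  proof (rule integrable_const_bound[where B = B])
    show "AE \<omega> in P. norm (indicator {x<..} (max_modulus (N n \<omega>)) * g (normalized (N n \<omega>))) \<le> B"
    proof (rule AE_I2)
      fix \<omega> assume "\<omega> \<in> space P"
      from B[OF norm_Mtilde[OF this, of n]]
      show "norm (indicator {x<..} (max_modulus (N n \<omega>)) * g (normalized (N n \<omega>))) \<le> B"
        by (auto simp: indicator_def)
    qed
  qed (use measurable_g[OF g(1)] in measurable)
  have "(\<integral>\<omega>. indicator {a<..b} (max_modulus (N n \<omega>)) * g (normalized (N n \<omega>)) \<partial>P) =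
     (\<integral>\<omega>. indicator {a<..} (max_modulus (N n \<omega>)) * g (normalized (N n \<omega>)) \<partial>P) -
     (\<integral>\<omega>. indicator {b<..} (max_modulus (N n \<omega>)) * g (normalized (N n \<omega>)) \<partial>P)" for n
    using ab by (subst Bochner_Integration.integral_diff[symmetric, OF int int])
      (auto intro!: Bochner_Integration.integral_cong simp: indicator_def)
  moreover have "b > 0" using ab by simp
  ultimately show ?thesis
    using tendsto_diff[OF weak_tail[OF W g ab(1)] weak_tail[OF W g \<open>b > 0\<close>]]
    by (simp add: right_diff_distrib left_diff_distrib)
qed

section \<open>Lower bounds for open sets, and the passage between (2) and (b)\<close>

text \<open>Weak convergence is directly usable for products of a slab with a continuous function.
  Finitely many such products, one per cell and each below the indicator of its core, sum to at most
  the indicator of the event. The limits are taken in the order n, then the continuous functions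
  towards the cores, then the number of cells, then the dyadic level.\<close>

lemma liminf_open:
  assumes W: "\<And>x. x > 0 \<Longrightarrow> weak_convergence_on XT (\<lambda>n. law n x) Q"
    and G: "openin vague G" and x: "x > 0"
  shows "(\<integral>\<^sup>+ y. indicator {x<..} y * hit Q G y \<partial>nu \<theta> \<alpha>) \<le>
     liminf (\<lambda>n. ennreal (c n * prob {\<omega> \<in> space P. x < max_modulus (N n \<omega>) \<and> N n \<omega> \<in> G}))"
    (is "_ \<le> ?L")
proof -
  let ?u = "\<lambda>n. c n * prob {\<omega> \<in> space P. x < max_modulus (N n \<omega>) \<and> N n \<omega> \<in> G}"
  let ?A = "\<lambda>m j. core G (cell x m j)"
  let ?v = "\<lambda>m j. \<theta> * (x + real j / 2 ^ m) powr (- \<alpha>) - \<theta> * (x + (real j + 1) / 2 ^ m) powr (- \<alpha>)"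
  have bounds: "0 < x + real j / 2 ^ m" "x + real j / 2 ^ m \<le> x + (real j + 1) / 2 ^ m" for m j
    using x by (auto intro: add_pos_nonneg divide_right_mono)
  have nu_cell: "emeasure (nu \<theta> \<alpha>) (cell x m j) = ennreal (?v m j)" for m j
    unfolding cell_def using theta alpha bounds by (rule emeasure_nu_interval)
  have v_nonneg: "0 \<le> ?v m j" for m j
    using bounds[of j m] theta alpha by (simp add: powr_mono2')
  \<comment> \<open>The limit in n, with the level, the number of cells and the minorants of the
    cores all fixed.\<close>
  have approx: "ennreal (\<Sum>j<J. ?v m j * (\<integral>\<mu>. g j \<mu> \<partial>Q)) \<le> ?L"
    if g: "\<And>j. continuous_map XT euclideanreal (g j)"
      "\<And>j \<mu>. \<mu> \<in> Mtilde \<Longrightarrow> 0 \<le> g j \<mu> \<and> g j \<mu> \<le> indicator (?A m j) \<mu>" for m J and g :: "nat \<Rightarrow> ereal measure \<Rightarrow> real"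
  proof -
    let ?h = "\<lambda>n j \<omega>. indicator (cell x m j) (max_modulus (N n \<omega>)) * g j (normalized (N n \<omega>))"
    have g1: "0 \<le> g j \<mu>" "g j \<mu> \<le> 1" if "\<mu> \<in> Mtilde" for j \<mu>
    proof -
      have "indicator (?A m j) \<mu> \<le> (1::real)" by (rule indicator_le_1)
      with g(2)[OF that, of j] show "0 \<le> g j \<mu>" "g j \<mu> \<le> 1" by linarith+
    qed
    have bdd: "bounded (g j ` Mtilde)" for j
      using g1 by (auto simp: bounded_iff intro!: exI[of _ 1])
    have lim: "(\<lambda>n. \<Sum>j<J. c n * (\<integral>\<omega>. ?h n j \<omega> \<partial>P)) \<longlonglongrightarrow> (\<Sum>j<J. ?v m j * (\<integral>\<mu>. g j \<mu> \<partial>Q))"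
      unfolding cell_def using weak_slab[OF W g(1) bdd bounds] by (intro tendsto_sum)
    have int: "integrable P (?h n j)" for n j
    proof (rule integrable_const_bound[where B = 1])
      show "AE \<omega> in P. norm (?h n j \<omega>) \<le> 1"
        using g1[OF norm_Mtilde] by (intro AE_I2) (auto simp: indicator_def)
    qed (use measurable_g[OF g(1)] in \<open>simp add: cell_def\<close>)
    have le: "(\<Sum>j<J. c n * (\<integral>\<omega>. ?h n j \<omega> \<partial>P)) \<le> ?u n" for n
    proof -
      let ?B = "{\<omega> \<in> space P. x < max_modulus (N n \<omega>) \<and> N n \<omega> \<in> G}"
      have B: "?B \<in> events" using G by (intro hit_events borel_of_open)
      have "(\<Sum>j<J. \<integral>\<omega>. ?h n j \<omega> \<partial>P) = (\<integral>\<omega>. (\<Sum>j<J. ?h n j \<omega>) \<partial>P)"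
        using int by (intro Bochner_Integration.integral_sum[symmetric])
      also have "\<dots> \<le> (\<integral>\<omega>. indicator ?B \<omega> \<partial>P)"
      proof (rule integral_mono)
        show "integrable P (\<lambda>\<omega>. \<Sum>j<J. ?h n j \<omega>)"
          by (intro Bochner_Integration.integrable_sum int)
        show "integrable P (indicator ?B :: 'a \<Rightarrow> real)"
          using B by (intro integrable_real_indicator) (simp_all add: emeasure_eq_measure)
        fix \<omega> assume \<omega>: "\<omega> \<in> space P"
        let ?y = "max_modulus (N n \<omega>)" and ?z = "normalized (N n \<omega>)"
        have z: "?z \<in> Mtilde" using norm_Mtilde[OF \<omega>] .
        \<comment> \<open>If the modulus lies in the cell and the normalized measure in its core,
          multiplying them back together lands in G, and the product is \<open>N n \<omega>\<close>
          itself. The cells being disjoint, at most one summand is nonzero.\<close>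
        have hB: "?h n j \<omega> \<le> indicator (cell x m j) ?y * indicator ?B \<omega>" for j
        proof (cases "?y \<in> cell x m j \<and> ?z \<in> ?A m j")
          case True
          then have "scale ?y ?z \<in> G" using scale_core by blast
          then have "\<omega> \<in> ?B" using \<omega> True cell_greater scale_normalized[OF N_Mfin[OF \<omega>]] by auto
          then show ?thesis using True g1[OF z, of j] by simp
        next
          case False
          then show ?thesis using g(2)[OF z, of j] by (auto simp: indicator_def)
        qed
        have "(\<Sum>j<J. ?h n j \<omega>) \<le> (\<Sum>j<J. indicator (cell x m j) ?y * indicator ?B \<omega>)"
          using hB by (intro sum_mono)
        also have "\<dots> = indicator (\<Union>j<J. cell x m j) ?y * indicator ?B \<omega>"
          using cell_disjoint by (subst indicator_UN_disjoint) (auto simp: disjoint_family_on_def sum_distrib_right)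
        also have "\<dots> \<le> indicator ?B \<omega>" by (auto simp: indicator_def)
        finally show "(\<Sum>j<J. ?h n j \<omega>) \<le> indicator ?B \<omega>" .
      qed
      also have "\<dots> = prob ?B" using B by simp
      finally show ?thesis
        using c_nonneg[of n] by (simp add: sum_distrib_left[symmetric] mult_left_mono)
    qed
    have "ennreal (\<Sum>j<J. ?v m j * (\<integral>\<mu>. g j \<mu> \<partial>Q)) =
        liminf (\<lambda>n. ennreal (\<Sum>j<J. c n * (\<integral>\<omega>. ?h n j \<omega> \<partial>P)))"
      by (rule lim_imp_Liminf[symmetric]) (auto intro!: tendsto_ennrealI lim)
    also have "\<dots> \<le> ?L" using le by (intro Liminf_mono always_eventually allI ennreal_leI)
    finally show ?thesis .
  qed
  have core_sets: "?A m j \<in> sets Q" for m j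
    unfolding sets_Q by (intro borel_of_open openin_core)
  have partial: "ennreal (\<Sum>j<J. ?v m j * measure Q (?A m j)) \<le> ?L" for m J
  proof -
    have "\<forall>j. \<exists>g :: nat \<Rightarrow> ereal measure \<Rightarrow> real.
      (\<forall>k. continuous_map XT euclideanreal (g k)) \<and>
      (\<forall>k \<mu>. \<mu> \<in> Mp \<inter> Mtilde \<longrightarrow> 0 \<le> g k \<mu> \<and> g k \<mu> \<le> indicator (?A m j) \<mu>) \<and>
      (\<forall>\<mu>\<in>Mp \<inter> Mtilde. (\<lambda>k. g k \<mu>) \<longlonglongrightarrow> indicator (?A m j) \<mu>)"
      using vague_open_approx[OF openin_core] by blast
    then obtain g :: "nat \<Rightarrow> nat \<Rightarrow> ereal measure \<Rightarrow> real" where g: "\<forall>j.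
      (\<forall>k. continuous_map XT euclideanreal (g j k)) \<and>
      (\<forall>k \<mu>. \<mu> \<in> Mp \<inter> Mtilde \<longrightarrow> 0 \<le> g j k \<mu> \<and> g j k \<mu> \<le> indicator (?A m j) \<mu>) \<and>
      (\<forall>\<mu>\<in>Mp \<inter> Mtilde. (\<lambda>k. g j k \<mu>) \<longlonglongrightarrow> indicator (?A m j) \<mu>)"
      by (rule choice[THEN exE])
    have g_cont: "continuous_map XT euclideanreal (g j k)" for j k using g by blast
    have g_le: "0 \<le> g j k \<mu> \<and> g j k \<mu> \<le> indicator (?A m j) \<mu>" if "\<mu> \<in> Mtilde" for j k \<mu>
      using g that Mtilde_subset by blast
    have g_lim: "(\<lambda>k. g j k \<mu>) \<longlonglongrightarrow> indicator (?A m j) \<mu>" if "\<mu> \<in> Mtilde" for j \<mu>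
      using g that Mtilde_subset by blast
    have "(\<lambda>k. \<integral>\<mu>. g j k \<mu> \<partial>Q) \<longlonglongrightarrow> (\<integral>\<mu>. indicator (?A m j) \<mu> \<partial>Q)" for j
    proof (rule integral_dominated_convergence[where w = "\<lambda>_. 1"])
      show "AE \<mu> in Q. (\<lambda>k. g j k \<mu>) \<longlonglongrightarrow> indicator (?A m j) \<mu>"
        by (intro AE_I2 g_lim) (simp add: space_Q)
      have "norm (g j k \<mu>) \<le> 1" if "\<mu> \<in> Mtilde" for k \<mu>
      proof -
        have "indicator (?A m j) \<mu> \<le> (1::real)" by (rule indicator_le_1)
        with g_le[OF that, of j k] show ?thesis unfolding real_norm_def by linarith
      qed
      then show "AE \<mu> in Q. norm (g j k \<mu>) \<le> 1" for k
        by (intro AE_I2) (simp add: space_Q)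
    qed (use core_sets measurable_g[OF g_cont] in auto)
    then have "(\<lambda>k. \<integral>\<mu>. g j k \<mu> \<partial>Q) \<longlonglongrightarrow> measure Q (?A m j)" for j
      using core_sets by simp
    then have "(\<lambda>k. \<Sum>j<J. ?v m j * (\<integral>\<mu>. g j k \<mu> \<partial>Q)) \<longlonglongrightarrow> (\<Sum>j<J. ?v m j * measure Q (?A m j))"
      by (intro tendsto_intros)
    then have lim: "(\<lambda>k. ennreal (\<Sum>j<J. ?v m j * (\<integral>\<mu>. g j k \<mu> \<partial>Q))) \<longlonglongrightarrow>
        ennreal (\<Sum>j<J. ?v m j * measure Q (?A m j))"
      by (rule tendsto_ennrealI)
    show ?thesis
      by (rule LIMSEQ_le_const2[OF lim]) (intro exI allI impI approx g_cont g_le)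
  qed
  have "(\<Sum>j. emeasure (nu \<theta> \<alpha>) (cell x m j) * emeasure Q (?A m j)) \<le> ?L" for m
  proof (rule suminf_le_const[OF summableI])
    fix J
    have "(\<Sum>j<J. emeasure (nu \<theta> \<alpha>) (cell x m j) * emeasure Q (?A m j)) =
        (\<Sum>j<J. ennreal (?v m j * measure Q (?A m j)))"
      unfolding nu_cell Q.emeasure_eq_measure using v_nonneg by (simp add: ennreal_mult)
    also have "\<dots> = ennreal (\<Sum>j<J. ?v m j * measure Q (?A m j))"
      using v_nonneg by (intro sum_ennreal mult_nonneg_nonneg) auto
    finally show "(\<Sum>j<J. emeasure (nu \<theta> \<alpha>) (cell x m j) * emeasure Q (?A m j)) \<le> ?L"
      using partial by simp
  qed
  then show ?thesis
    unfolding nn_integral_hit_open[OF sets_Q G x] by (intro SUP_least)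
qed

text \<open>Interior, exterior and frontier of M partition \<open>Mp\<close>, and the frontier
  carries no mass of the limit. The lower bound for the interior bounds M from below; the lower
  bound for the exterior, subtracted from the convergent total mass, bounds it from above.\<close>

lemma weak_imp_set_convergence:
  assumes W: "\<And>x. x > 0 \<Longrightarrow> weak_convergence_on XT (\<lambda>n. law n x) Q"
    and x: "x > 0" and M: "M \<in> sets (borel_of vague)"
    and null: "lam \<theta> \<alpha> Q ((vague frontier_of M) \<inter> M_exceed x) = 0"
  shows "(\<lambda>n. ennreal (c n * prob {\<omega> \<in> space P. x < max_modulus (N n \<omega>) \<and> N n \<omega> \<in> M}))
    \<longlonglongrightarrow> lam \<theta> \<alpha> Q (M \<inter> M_exceed x)"
proof -
  define u where "u B n = c n * prob {\<omega> \<in> space P. x < max_modulus (N n \<omega>) \<and> N n \<omega> \<in> B}" for B n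
  define I where "I B = (\<integral>\<^sup>+ y. indicator {x<..} y * hit Q B y \<partial>nu \<theta> \<alpha>)" for B
  define t where "t = \<theta> * x powr (- \<alpha>)"
  have t: "0 \<le> t" unfolding t_def using theta by simp
  define S where "S = vague interior_of M"
  define R where "R = Mp - vague closure_of M"
  define F where "F = vague frontier_of M"
  have M_Mp: "M \<subseteq> Mp" using M sets.sets_into_space by (fastforce simp: topspace_vague)
  have opS: "openin vague S" by (simp add: S_def)
  have opR: "openin vague R"
    unfolding R_def topspace_vague[symmetric] by (intro openin_diff) auto
  have F_eq: "F = Mp - S - R"
    unfolding F_def R_def S_def frontier_of_def using closure_of_subset_topspace[of vague M]
    by (auto simp: topspace_vague)
  have SM: "S \<subseteq> M" unfolding S_def by (rule interior_of_subset)
  have RM: "R \<inter> M = {}"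
    unfolding R_def using closure_of_subset[of M vague] M_Mp by (auto simp: topspace_vague)
  have sS: "S \<in> sets (borel_of vague)" and sR: "R \<in> sets (borel_of vague)"
    using opS opR by (auto intro: borel_of_open)
  have sF: "F \<in> sets (borel_of vague)"
    unfolding F_eq using sS sR sets.top[of "borel_of vague"] by (auto simp: topspace_vague)
  have lam_I: "lam \<theta> \<alpha> Q (B \<inter> M_exceed x) = I B" for B
    unfolding I_def by (rule lam_Int_M_exceed[OF x])
  have SR: "S \<inter> R = {}" and SF: "S \<inter> F = {}" and RF: "R \<inter> F = {}"
    using RM SM F_eq by auto
  have split3: "hit Q S y + hit Q R y + hit Q F y = 1" if "y > 0" for y
  proof -
    have [simp]: "{\<mu> \<in> Mtilde. scale y \<mu> \<in> B} \<in> sets Q" if "B \<in> sets (borel_of vague)" for B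
      using hit_sets[OF sets_Q that \<open>y > 0\<close>] .
    have "hit Q S y + hit Q R y + hit Q F y =
      emeasure Q (({\<mu> \<in> Mtilde. scale y \<mu> \<in> S} \<union> {\<mu> \<in> Mtilde. scale y \<mu> \<in> R}) \<union> {\<mu> \<in> Mtilde. scale y \<mu> \<in> F})"
      unfolding hit_def using sS sR sF SR SF RF by (subst plus_emeasure; (subst plus_emeasure)?) auto
    also have "({\<mu> \<in> Mtilde. scale y \<mu> \<in> S} \<union> {\<mu> \<in> Mtilde. scale y \<mu> \<in> R}) \<union> {\<mu> \<in> Mtilde. scale y \<mu> \<in> F} = space Q"
      using scale_Mp[OF _ \<open>y > 0\<close>] Mtilde_subset unfolding F_eq space_Q by blast
    finally show ?thesis using Q.emeasure_space_1 by simp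
  qed
  let ?i = "\<lambda>B y. indicator {x<..} y * hit Q B y"
  have mS: "?i S \<in> borel_measurable (nu \<theta> \<alpha>)" and mR: "?i R \<in> borel_measurable (nu \<theta> \<alpha>)"
    using measurable_hit_open[OF sets_Q _ x] opS opR by auto
  have sum3: "?i S y + ?i R y + ?i F y = indicator {x<..} y" for y
    using split3[of y] x by (auto simp: indicator_def)
  \<comment> \<open>The frontier term is what remains after subtracting the two open terms; the
    subtraction in \<open>ennreal\<close> is legitimate because their sum is at most 1.\<close>
  have mF: "?i F \<in> borel_measurable (nu \<theta> \<alpha>)"
  proof -
    have le1: "?i S y + ?i R y \<le> 1" for y
    proof -
      have "?i S y + ?i R y \<le> ?i S y + ?i R y + ?i F y" by (rule add_increasing2) simp_all
      also have "\<dots> \<le> 1" unfolding sum3 by (simp add: indicator_def)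
      finally show ?thesis .
    qed
    have "?i F y = indicator {x<..} y - (?i S y + ?i R y)" for y
    proof -
      have "?i S y + ?i R y \<noteq> \<top>" using le1[of y] by (metis ennreal_one_less_top leD)
      then have "(?i S y + ?i R y + ?i F y) - (?i S y + ?i R y) = ?i F y"
        by (rule ennreal_add_diff_cancel_left)
      then show ?thesis unfolding sum3 ..
    qed
    moreover have "(indicator {x<..} :: real \<Rightarrow> ennreal) \<in> borel_measurable (nu \<theta> \<alpha>)"
      by (intro measurable_nu) simp
    ultimately show ?thesis
      using borel_measurable_minus_ennreal[OF _ borel_measurable_add[OF mS mR]] by (simp only:)
  qed
  have total: "I S + I R + I F = ennreal t"
  proof -
    have "I S + I R + I F = (\<integral>\<^sup>+ y. ?i S y + ?i R y + ?i F y \<partial>nu \<theta> \<alpha>)"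
      unfolding I_def using mS mR mF by (simp add: nn_integral_add)
    also have "\<dots> = emeasure (nu \<theta> \<alpha>) {x<..}"
      unfolding sum3 using x by (intro nn_integral_indicator sets_nu) auto
    finally show ?thesis unfolding t_def using emeasure_nu_greaterThan[OF theta alpha x] by simp
  qed
  have IF: "I F = 0" using null lam_I unfolding F_def by simp
  \<comment> \<open>M is compared pointwise in y with the interior and with interior plus frontier,
    using monotonicity of the integral; measurability in y is available for those bounds.\<close>
  have IM: "I M = I S"
  proof (rule antisym)
    have "I M \<le> (\<integral>\<^sup>+ y. ?i S y + ?i F y \<partial>nu \<theta> \<alpha>)"
      unfolding I_def
    proof (rule nn_integral_mono)
      fix y assume "y \<in> space (nu \<theta> \<alpha>)"
      then have y: "y > 0" by (simp add: space_nu)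
      have "hit Q M y \<le> emeasure Q ({\<mu> \<in> Mtilde. scale y \<mu> \<in> S} \<union> {\<mu> \<in> Mtilde. scale y \<mu> \<in> F})"
        unfolding hit_def using RM M_Mp hit_sets[OF sets_Q sS y] hit_sets[OF sets_Q sF y]
        by (intro emeasure_mono) (auto simp: F_eq)
      also have "\<dots> \<le> hit Q S y + hit Q F y"
        unfolding hit_def using hit_sets[OF sets_Q sS y] hit_sets[OF sets_Q sF y]
        by (intro emeasure_subadditive)
      finally show "?i M y \<le> ?i S y + ?i F y" by (auto simp: indicator_def)
    qed
    also have "\<dots> = I S + I F" unfolding I_def using mS mF by (rule nn_integral_add)
    finally show "I M \<le> I S" using IF by simp
    show "I S \<le> I M"
      unfolding I_def
    proof (rule nn_integral_mono)
      fix y assume "y \<in> space (nu \<theta> \<alpha>)"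
      then have y: "y > 0" by (simp add: space_nu)
      have "hit Q S y \<le> hit Q M y"
        unfolding hit_def using SM hit_sets[OF sets_Q M y] by (intro emeasure_mono) auto
      then show "?i S y \<le> ?i M y" by (auto simp: indicator_def)
    qed
  qed
  have "I S \<noteq> \<top>" "I R \<noteq> \<top>" using total by (metis ennreal_add_eq_top ennreal_neq_top)+
  then obtain i j where ij: "I S = ennreal i" "0 \<le> i" "I R = ennreal j" "0 \<le> j"
    by (metis ennreal_cases)
  then have ij_t: "i + j = t"
    using total IF t by (simp add: ennreal_plus[symmetric] del: ennreal_plus)
  \<comment> \<open>A negative b is truncated to 0 in \<open>ennreal\<close>, where the strict
    inequality b < v could be lost; nonnegativity of \<open>u\<close> settles that case.\<close>
  have ev: "\<forall>\<^sub>F n in sequentially. b < u B n" if "openin vague B" "I B = ennreal v" "b < v" "0 \<le> v" for B v b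
  proof (cases "b < 0")
    case True
    then show ?thesis using c_nonneg by (intro always_eventually allI) (auto simp: u_def intro: less_le_trans)
  next
    case False
    have "ennreal b < ennreal v" using False that by (simp add: ennreal_less_iff)
    also have "\<dots> \<le> liminf (\<lambda>n. ennreal (u B n))"
      using liminf_open[OF W that(1) x] that(2) unfolding I_def u_def by simp
    finally show ?thesis
      using False by (auto dest!: less_LiminfD elim!: eventually_mono simp: ennreal_less_iff)
  qed
  have uM: "u S n \<le> u M n" "u M n + u R n \<le> c n * prob {\<omega> \<in> space P. x < max_modulus (N n \<omega>)}" for n
  proof -
    let ?E = "\<lambda>B. {\<omega> \<in> space P. x < max_modulus (N n \<omega>) \<and> N n \<omega> \<in> B}"
    have "prob (?E S) \<le> prob (?E M)"
      using SM by (intro finite_measure_mono hit_events M) auto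
    then show "u S n \<le> u M n" unfolding u_def using c_nonneg by (intro mult_left_mono)
    have "prob (?E M) + prob (?E R) = prob (?E M \<union> ?E R)"
      using RM by (intro finite_measure_Union[symmetric] hit_events M sR) auto
    also have "\<dots> \<le> prob {\<omega> \<in> space P. x < max_modulus (N n \<omega>)}"
      by (intro finite_measure_mono exceed_sets) auto
    finally show "u M n + u R n \<le> c n * prob {\<omega> \<in> space P. x < max_modulus (N n \<omega>)}"
      unfolding u_def using c_nonneg by (simp add: distrib_left[symmetric] mult_left_mono)
  qed
  have "(\<lambda>n. u M n) \<longlonglongrightarrow> i"
  proof (rule order_tendstoI)
    fix b assume "b < i"
    from ev[OF opS ij(1) this ij(2)] show "\<forall>\<^sub>F n in sequentially. b < u M n"
      by eventually_elim (use uM(1) in \<open>auto intro: less_le_trans\<close>)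
  next
    fix b assume b: "i < b"
    \<comment> \<open>One e is spent on the total mass and one on the exterior: u M < (t + e) - (j -
      e) = i + 2 e = b.\<close>
    define e where "e = (b - i) / 2"
    have e: "e > 0" using b by (simp add: e_def)
    have "\<forall>\<^sub>F n in sequentially. j - e < u R n" using ev[OF opR ij(3) _ ij(4)] e by simp
    moreover have "\<forall>\<^sub>F n in sequentially. c n * prob {\<omega> \<in> space P. x < max_modulus (N n \<omega>)} < t + e"
      using tail[OF x] e unfolding t_def by (intro order_tendstoD(2)) auto
    ultimately show "\<forall>\<^sub>F n in sequentially. u M n < b"
    proof eventually_elim
      case (elim n)
      then show ?case using uM(2)[of n] ij_t unfolding e_def by argo
    qed
  qed
  then have "(\<lambda>n. ennreal (u M n)) \<longlonglongrightarrow> ennreal i" by (rule tendsto_ennrealI)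
  then show ?thesis unfolding u_def lam_I IM ij(1) .
qed

text \<open>For one bounded continuous g, the level sets of g after normalization turn set
  convergence into convergence of distribution functions on the real line, at every t that g attains
  with Q-probability 0. The one-dimensional theory of weak convergence then returns the integral of
  g. Level sets do not depend on the modulus, so their limit is a product of \<open>nu\<close> and
  Q.\<close>

lemma set_convergence_imp_weak:
  assumes S: "\<And>M. M \<in> meas_sets_M0 \<Longrightarrow> lam \<theta> \<alpha> Q ((vague frontier_of M) \<inter> M_exceed x) = 0 \<Longrightarrow>
      (\<lambda>n. ennreal (c n * prob {\<omega> \<in> space P. x < max_modulus (N n \<omega>) \<and> N n \<omega> \<in> M}))
        \<longlonglongrightarrow> lam \<theta> \<alpha> Q (M \<inter> M_exceed x)"
    and x: "x > 0"
  shows "weak_convergence_on XT (\<lambda>n. law n x) Q"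
  unfolding weak_convergence_on_def topspace_Mtilde
proof (intro allI impI, elim conjE)
  fix g :: "ereal measure \<Rightarrow> real"
  assume g: "continuous_map XT euclideanreal g" and "bounded (g ` Mtilde)"
  then obtain B where B: "\<And>\<mu>. \<mu> \<in> Mtilde \<Longrightarrow> \<bar>g \<mu>\<bar> \<le> B" by (auto simp: bounded_iff)
  define p where "p n = prob {\<omega> \<in> space P. x < max_modulus (N n \<omega>)}" for n
  define T where "T = \<theta> * x powr (- \<alpha>)"
  have T: "T > 0" unfolding T_def using theta x by simp
  have cp: "(\<lambda>n. c n * p n) \<longlonglongrightarrow> T" unfolding p_def T_def using tail[OF x] .
  have ev_pos: "\<forall>\<^sub>F n in sequentially. 0 < c n * p n" using order_tendstoD(1)[OF cp T] .
  have gZ: "(\<lambda>\<omega>. g (normalized (N n \<omega>))) \<in> borel_measurable P" for n using measurable_g[OF g] by blast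
  have gQ: "g \<in> borel_measurable Q" using measurable_g[OF g] by blast
  have level_conv: "(\<lambda>n. c n * prob {\<omega> \<in> space P. x < max_modulus (N n \<omega>) \<and> t < g (normalized (N n \<omega>))})
      \<longlonglongrightarrow> T * measure Q {\<mu> \<in> Mtilde. t < g \<mu>}"
    if t: "measure Q {\<mu> \<in> Mtilde. g \<mu> = t} = 0" for t
  proof -
    define M where "M = {\<mu> \<in> Mfin. t < g (normalized \<mu>)}"
    define M' where "M' = {\<mu> \<in> Mfin. g (normalized \<mu>) < t}"
    have cont: "continuous_map (subtopology vague Mfin) euclideanreal (\<lambda>\<mu>. g (normalized \<mu>))"
      using continuous_map_compose[OF continuous_map_normalized g] by (simp add: o_def)
    have "openin (subtopology vague Mfin) M"
      using openin_continuous_map_preimage[OF cont, of "{t<..}"] by (simp add: M_def topspace_Mfin del: topspace_subtopology)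
    then have opM: "openin vague M" using openin_Mfin by (simp add: openin_open_subtopology)
    have "openin (subtopology vague Mfin) M'"
      using openin_continuous_map_preimage[OF cont, of "{..<t}"] by (simp add: M'_def topspace_Mfin del: topspace_subtopology)
    then have opM': "openin vague M'" using openin_Mfin by (simp add: openin_open_subtopology)
    have M: "M \<in> meas_sets_M0"
      using opM Mfin_subset by (auto simp: meas_sets_M0_def M_def intro: borel_of_open)
    \<comment> \<open>The open set \<open>M'\<close> is disjoint from M, hence from its closure. A
      frontier point in \<open>Mfin\<close> therefore has g equal to t after normalization; frontier
      points outside \<open>Mfin\<close> are never of the form \<open>scale y \<mu>\<close> with
      \<mu> in \<open>Mtilde\<close>.\<close>
    have disj: "M' \<inter> vague closure_of M = {}"
      using opM' by (subst openin_Int_closure_of_eq_empty) (auto simp: M_def M'_def)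
    have "lam \<theta> \<alpha> Q ((vague frontier_of M) \<inter> M_exceed x) = 0"
      unfolding lam_Int_M_exceed[OF x]
    proof (rule trans[OF nn_integral_cong])
      fix y assume "y \<in> space (nu \<theta> \<alpha>)"
      then have y: "y > 0" by (simp add: space_nu)
      have "{\<mu> \<in> Mtilde. scale y \<mu> \<in> vague frontier_of M} \<subseteq> {\<mu> \<in> Mtilde. g \<mu> = t}"
      proof safe
        fix \<mu> assume \<mu>: "\<mu> \<in> Mtilde" "scale y \<mu> \<in> vague frontier_of M"
        have "scale y \<mu> \<notin> M" "scale y \<mu> \<notin> M'"
          using \<mu>(2) disj opM by (auto simp: frontier_of_def interior_of_openin)
        then show "g \<mu> = t"
          using scale_Mtilde[OF \<mu>(1) y] by (auto simp: M_def M'_def)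
      qed
      moreover have "{\<mu> \<in> Mtilde. g \<mu> = t} \<in> sets Q"
        using gQ unfolding space_Q[symmetric] by measurable
      ultimately have "hit Q (vague frontier_of M) y \<le> emeasure Q {\<mu> \<in> Mtilde. g \<mu> = t}"
        unfolding hit_def by (rule emeasure_mono)
      also have "\<dots> = 0"
        using t by (simp add: Q.emeasure_eq_measure)
      finally have "hit Q (vague frontier_of M) y = 0" by simp
      then show "indicator {x<..} y * hit Q (vague frontier_of M) y = 0" by simp
    qed simp
    from S[OF M this]
    have "(\<lambda>n. ennreal (c n * prob {\<omega> \<in> space P. x < max_modulus (N n \<omega>) \<and> N n \<omega> \<in> M}))
        \<longlonglongrightarrow> lam \<theta> \<alpha> Q (M \<inter> M_exceed x)" .
    also have "lam \<theta> \<alpha> Q (M \<inter> M_exceed x) = (\<integral>\<^sup>+ y. indicator {x<..} y * emeasure Q {\<mu> \<in> Mtilde. t < g \<mu>} \<partial>nu \<theta> \<alpha>)"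
      unfolding lam_Int_M_exceed[OF x]
    proof (rule nn_integral_cong)
      fix y assume "y \<in> space (nu \<theta> \<alpha>)"
      then have y: "y > 0" by (simp add: space_nu)
      have "{\<mu> \<in> Mtilde. scale y \<mu> \<in> M} = {\<mu> \<in> Mtilde. t < g \<mu>}"
        using scale_Mtilde[OF _ y] by (auto simp: M_def)
      then show "indicator {x<..} y * hit Q M y = indicator {x<..} y * emeasure Q {\<mu> \<in> Mtilde. t < g \<mu>}"
        by (simp add: hit_def)
    qed
    also have "\<dots> = emeasure (nu \<theta> \<alpha>) {x<..} * emeasure Q {\<mu> \<in> Mtilde. t < g \<mu>}"
    proof -
      have s: "{x<..} \<in> sets (nu \<theta> \<alpha>)" using x by (intro sets_nu) auto
      then show ?thesis by (subst nn_integral_multc) auto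
    qed
    also have "\<dots> = ennreal (T * measure Q {\<mu> \<in> Mtilde. t < g \<mu>})"
      using T emeasure_nu_greaterThan[OF theta alpha x] by (simp add: T_def Q.emeasure_eq_measure ennreal_mult)
    finally have "(\<lambda>n. c n * prob {\<omega> \<in> space P. x < max_modulus (N n \<omega>) \<and> N n \<omega> \<in> M})
        \<longlonglongrightarrow> T * measure Q {\<mu> \<in> Mtilde. t < g \<mu>}"
      using T c_nonneg by (subst (asm) tendsto_ennreal_iff) auto
    moreover have "{\<omega> \<in> space P. x < max_modulus (N n \<omega>) \<and> N n \<omega> \<in> M} =
        {\<omega> \<in> space P. x < max_modulus (N n \<omega>) \<and> t < g (normalized (N n \<omega>))}" for n
      using N_Mfin by (auto simp: M_def)
    ultimately show ?thesis by simp
  qed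
  define R where "R = distr Q borel g"
  interpret R: real_distribution R unfolding R_def using gQ by (rule Q.real_distribution_distr)
  have law_prob: "prob_space (law n x)" if "0 < c n * p n" for n
  proof -
    have "p n \<noteq> 0" using that by auto
    then have pp: "p n > 0" by (simp add: p_def zero_less_measure_iff)
    have "prob_space (uniform_measure P {\<omega> \<in> space P. x < max_modulus (N n \<omega>)})"
      using pp by (intro prob_space_uniform_measure) (simp_all add: p_def emeasure_eq_measure)
    then show ?thesis
      unfolding law_def using measurable_norm
      by (intro prob_space.prob_space_distr) (auto simp: measurable_cong_sets[OF sets_uniform_measure refl])
  qed
  have glaw: "g \<in> borel_measurable (law n x)" for n
    using continuous_map_real_measurable[OF g] by (simp add: law_def)
  have space_law: "space (law n x) = Mtilde" for n
    unfolding law_def by (simp add: topspace_Mtilde del: topspace_subtopology)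
  \<comment> \<open>The theorem on weak convergence asks for a probability distribution at every n,
    so the indices at which \<open>law\<close> is null receive the limit itself; they are eventually
    absent.\<close>
  define Rn where "Rn n = (if 0 < c n * p n then distr (law n x) borel g else R)" for n
  have Rn: "real_distribution (Rn n)" for n
    unfolding Rn_def using prob_space.real_distribution_distr[OF law_prob glaw] R.real_distribution_axioms by simp
  have cdf_R: "cdf R t = 1 - measure Q {\<mu> \<in> Mtilde. t < g \<mu>}" for t
  proof -
    have "cdf R t = measure Q {\<mu> \<in> Mtilde. g \<mu> \<le> t}"
      unfolding cdf_def R_def using gQ by (subst measure_distr) (auto simp: space_Q intro!: arg_cong[where f = "measure Q"])
    also have "\<dots> = measure Q (space Q - {\<mu> \<in> Mtilde. t < g \<mu>})"
      by (rule arg_cong[where f = "measure Q"]) (auto simp: space_Q)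
    also have "\<dots> = 1 - measure Q {\<mu> \<in> Mtilde. t < g \<mu>}"
      using gQ unfolding space_Q[symmetric] by (intro Q.prob_compl) measurable
    finally show ?thesis .
  qed
  have cdf_Rn: "cdf (Rn n) t = 1 - (c n * prob {\<omega> \<in> space P. x < max_modulus (N n \<omega>) \<and> t < g (normalized (N n \<omega>))}) / (c n * p n)"
    if n: "0 < c n * p n" for n t
  proof -
    interpret L: prob_space "law n x" using law_prob[OF n] .
    have cn: "c n > 0" "p n > 0" using n c_nonneg[of n] by (auto simp: p_def zero_less_mult_iff not_less measure_le_0_iff)
    let ?A = "{\<omega> \<in> space P. x < max_modulus (N n \<omega>)}"
    have lev: "{\<mu> \<in> space (law n x). t < g \<mu>} \<in> sets (law n x)" using glaw by measurable
    have "cdf (Rn n) t = measure (law n x) {\<mu> \<in> space (law n x). g \<mu> \<le> t}"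
      unfolding cdf_def Rn_def using n glaw
      by (simp add: measure_distr) (rule arg_cong[where f = "measure (law n x)"], auto)
    also have "\<dots> = measure (law n x) (space (law n x) - {\<mu> \<in> space (law n x). t < g \<mu>})"
      by (rule arg_cong[where f = "measure (law n x)"]) auto
    also have "\<dots> = 1 - measure (law n x) {\<mu> \<in> space (law n x). t < g \<mu>}"
      using lev by (rule L.prob_compl)
    also have "measure (law n x) {\<mu> \<in> space (law n x). t < g \<mu>} =
        measure (uniform_measure P ?A) {\<omega> \<in> space P. t < g (normalized (N n \<omega>))}"
    proof -
      have "measure (law n x) {\<mu> \<in> space (law n x). t < g \<mu>} =
        measure (uniform_measure P ?A) ((\<lambda>\<omega>. normalized (N n \<omega>)) -` {\<mu> \<in> space (law n x). t < g \<mu>} \<inter> space (uniform_measure P ?A))"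
        using lev measurable_norm unfolding law_def
        by (intro measure_distr) (auto simp: measurable_cong_sets[OF sets_uniform_measure refl])
      also have "(\<lambda>\<omega>. normalized (N n \<omega>)) -` {\<mu> \<in> space (law n x). t < g \<mu>} \<inter> space (uniform_measure P ?A)
         = {\<omega> \<in> space P. t < g (normalized (N n \<omega>))}"
        using norm_Mtilde by (auto simp: space_law)
      finally show ?thesis .
    qed
    also have "\<dots> = prob (?A \<inter> {\<omega> \<in> space P. t < g (normalized (N n \<omega>))}) / prob ?A"
      using cn gZ by (intro measure_uniform_measure) (auto simp: p_def emeasure_eq_measure)
    also have "?A \<inter> {\<omega> \<in> space P. t < g (normalized (N n \<omega>))} =
       {\<omega> \<in> space P. x < max_modulus (N n \<omega>) \<and> t < g (normalized (N n \<omega>))}" by auto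
    finally show ?thesis using cn by (simp add: p_def)
  qed
  have weak: "weak_conv_m Rn R"
    unfolding weak_conv_m_def weak_conv_def
  proof (intro allI impI)
    fix t assume "isCont (cdf R) t"
    then have "measure R {t} = 0" by (simp add: R.isCont_cdf)
    then have "measure Q {\<mu> \<in> Mtilde. g \<mu> = t} = 0"
      unfolding R_def using gQ by (subst (asm) measure_distr) (auto simp: space_Q vimage_def Int_def conj_commute)
    from tendsto_divide[OF level_conv[OF this] cp] T
    have "(\<lambda>n. 1 - (c n * prob {\<omega> \<in> space P. x < max_modulus (N n \<omega>) \<and> t < g (normalized (N n \<omega>))}) / (c n * p n))
       \<longlonglongrightarrow> cdf R t"
      unfolding cdf_R by (intro tendsto_diff tendsto_const) auto
    then show "(\<lambda>n. cdf (Rn n) t) \<longlonglongrightarrow> cdf R t"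
      by (rule Lim_transform_eventually) (use ev_pos in eventually_elim, simp add: cdf_Rn)
  qed
  \<comment> \<open>The identity is unbounded on the line; truncation at the bound of g makes it
    bounded and continuous without changing it on the values of g.\<close>
  define \<phi> where "\<phi> s = max (- B) (min B s)" for s :: real
  have \<phi>_cont: "isCont \<phi> s" for s unfolding \<phi>_def by (intro continuous_intros)
  then have \<phi>_meas: "\<phi> \<in> borel_measurable borel"
    by (intro borel_measurable_continuous_onI continuous_at_imp_continuous_on) auto
  have \<phi>_g: "\<phi> (g \<mu>) = g \<mu>" if "\<mu> \<in> Mtilde" for \<mu>
    using B[OF that] by (auto simp: \<phi>_def)
  have "(\<lambda>n. integral\<^sup>L (Rn n) \<phi>) \<longlonglongrightarrow> integral\<^sup>L R \<phi>"
    by (rule weak_conv_imp_integral_bdd_continuous_conv[where B = "\<bar>B\<bar>", OF Rn R.real_distribution_axioms weak \<phi>_cont])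
      (auto simp: \<phi>_def)
  also have "integral\<^sup>L R \<phi> = (\<integral>\<mu>. g \<mu> \<partial>Q)"
    unfolding R_def using gQ \<phi>_meas \<phi>_g
    by (subst integral_distr) (auto simp: space_Q intro!: Bochner_Integration.integral_cong)
  finally show "(\<lambda>n. \<integral>\<mu>. g \<mu> \<partial>law n x) \<longlonglongrightarrow> (\<integral>\<mu>. g \<mu> \<partial>Q)"
  proof (rule Lim_transform_eventually)
    show "\<forall>\<^sub>F n in sequentially. integral\<^sup>L (Rn n) \<phi> = (\<integral>\<mu>. g \<mu> \<partial>law n x)"
      using ev_pos
    proof eventually_elim
      case (elim n)
      then show ?case unfolding Rn_def using glaw \<phi>_meas \<phi>_g
        by (simp add: integral_distr) (auto simp: space_law intro!: Bochner_Integration.integral_cong)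
    qed
  qed
qed

end

section \<open>Blocks of a stationary sequence\<close>

lemma emeasure_sum_dirac_card:
  assumes "finite J" "x ` J \<subseteq> E" "A \<in> sets borel_E"
  shows "emeasure (sum_dirac J x) A = of_nat (card {j \<in> J. x j \<in> A})"
  using assms by (simp add: emeasure_sum_dirac indicator_def Int_def)

lemma sum_dirac_Mp:
  assumes "finite J" "x ` J \<subseteq> E"
  shows "sum_dirac J x \<in> Mp"
  unfolding Mp_iff using emeasure_sum_dirac_card[OF assms] by (auto simp: sum_dirac_def)

lemma measurable_count_space_E: "x ` J \<subseteq> E \<Longrightarrow> x \<in> measurable (count_space J) borel_E"
  by auto

lemma integral_sum_dirac:
  assumes "finite J" "x ` J \<subseteq> E" "f \<in> CK_plus"
  shows "(\<integral>t. f t \<partial>sum_dirac J x) = (\<Sum>j\<in>J. f (x j))"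
  unfolding sum_dirac_def
  using integral_distr[OF measurable_count_space_E[OF assms(2)] CK_plus_measurable[OF assms(3)]]
    lebesgue_integral_count_space_finite[OF assms(1), of "\<lambda>j. f (x j)"] by simp

lemma scale_sum_dirac:
  assumes "x ` J \<subseteq> E" "y > 0"
  shows "scale y (sum_dirac J x) = sum_dirac J (\<lambda>j. ereal y * x j)"
  unfolding scale_def sum_dirac_def
  using distr_distr[OF measurable_scale[OF assms(2)] measurable_count_space_E[OF assms(1)]]
  by (simp add: o_def)

lemma sum_dirac_reindex:
  assumes "inj_on h J" "x ` h ` J \<subseteq> E"
  shows "sum_dirac (h ` J) x = sum_dirac J (\<lambda>j. x (h j))"
proof -
  have "sum_dirac (h ` J) x = distr (distr (count_space J) (count_space (h ` J)) h) borel_E x"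
    unfolding sum_dirac_def using assms(1) by (simp add: distr_bij_count_space bij_betw_def)
  also have "\<dots> = sum_dirac J (\<lambda>j. x (h j))"
    unfolding sum_dirac_def using assms(2)
    by (subst distr_distr) (auto simp: o_def)
  finally show ?thesis .
qed

lemma Mfin_sum_dirac:
  fixes z :: "nat \<Rightarrow> real"
  assumes J: "finite J" "J \<noteq> {}" and z: "\<And>j. j \<in> J \<Longrightarrow> z j \<noteq> 0"
  shows "sum_dirac J (\<lambda>j. ereal (z j)) \<in> Mfin"
    and "max_modulus (sum_dirac J (\<lambda>j. ereal (z j))) = Max ((\<lambda>j. \<bar>z j\<bar>) ` J)"
proof -
  let ?\<mu> = "sum_dirac J (\<lambda>j. ereal (z j))" and ?m = "Max ((\<lambda>j. \<bar>z j\<bar>) ` J)"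
  have E: "(\<lambda>j. ereal (z j)) ` J \<subseteq> E" using z by (auto simp: E_def)
  note em = emeasure_sum_dirac_card[OF J(1) E]
  have out: "emeasure ?\<mu> (outside c) \<noteq> 0 \<longleftrightarrow> c < ?m" for c
  proof -
    have "emeasure ?\<mu> (outside c) \<noteq> 0 \<longleftrightarrow> {j \<in> J. ereal (z j) \<in> outside c} \<noteq> {}"
      using J(1) by (simp add: em[OF outside_in_sets])
    also have "\<dots> \<longleftrightarrow> (\<exists>j\<in>J. c < \<bar>z j\<bar>)" using E by (auto simp: outside_def)
    also have "\<dots> \<longleftrightarrow> c < ?m" using J by (simp add: Max_gr_iff)
    finally show ?thesis .
  qed
  have "?m > 0" using J z by (auto simp: Max_gr_iff)
  moreover have "emeasure ?\<mu> (away (?m + 1)) = 0"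
  proof -
    have "away (?m + 1) \<subseteq> outside ?m" using \<open>?m > 0\<close> by (intro away_subset_outside) auto
    moreover have "emeasure ?\<mu> (outside ?m) = 0" using out[of ?m] by simp
    ultimately show ?thesis
      using emeasure_eq_0_mono[OF sum_dirac_Mp[OF J(1) E] outside_in_sets] by blast
  qed
  moreover have "emeasure ?\<mu> (outside (?m / 2)) \<noteq> 0" using \<open>?m > 0\<close> by (simp add: out)
  ultimately show fin: "?\<mu> \<in> Mfin"
    unfolding Mfin_iff using sum_dirac_Mp[OF J(1) E] by (meson add_pos_pos half_gt_zero zero_less_one)
  show "max_modulus ?\<mu> = ?m"
    using max_modulus_less_iff(1,2)[OF fin] out \<open>?m > 0\<close> by (metis linorder_neqE_linordered_idom less_irrefl)
qed

lemma scaled_pp_Mfin: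
  assumes J: "finite J" "J \<noteq> {}" and nz: "\<And>j. j \<in> J \<Longrightarrow> \<xi> j \<omega> \<noteq> 0" and c: "c > 0"
  shows "scaled_pp \<xi> c J \<omega> \<in> Mfin"
    and "max_modulus (scaled_pp \<xi> c J \<omega>) = max_abs \<xi> J \<omega> / c"
proof -
  have z: "\<xi> j \<omega> / c \<noteq> 0" if "j \<in> J" for j using nz[OF that] c by simp
  show "scaled_pp \<xi> c J \<omega> \<in> Mfin"
    unfolding scaled_pp_def by (rule Mfin_sum_dirac(1)[OF J z])
  have "max_modulus (scaled_pp \<xi> c J \<omega>) = Max ((\<lambda>j. \<bar>\<xi> j \<omega> / c\<bar>) ` J)"
    unfolding scaled_pp_def by (rule Mfin_sum_dirac(2)[OF J z])
  also have "(\<lambda>j. \<bar>\<xi> j \<omega> / c\<bar>) ` J = (\<lambda>m. m / c) ` (\<lambda>j. \<bar>\<xi> j \<omega>\<bar>) ` J"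
    using c by (simp add: image_image abs_divide)
  also have "Max \<dots> = Max ((\<lambda>j. \<bar>\<xi> j \<omega>\<bar>) ` J) / c"
    using J c by (intro mono_Max_commute[symmetric]) (auto simp: mono_def divide_right_mono)
  finally show "max_modulus (scaled_pp \<xi> c J \<omega>) = max_abs \<xi> J \<omega> / c" by (simp add: max_abs_def)
qed

text \<open>The scale c cancels against the maximum of the scaled values, so the self-normalized
  process is the same for every c.\<close>

lemma normalized_scaled_pp:
  assumes "r \<ge> 1" and nz: "\<And>j. j \<in> {1..r} \<Longrightarrow> \<xi> j \<omega> \<noteq> 0" and c: "c > 0"
  shows "normalized (scaled_pp \<xi> c {1..r} \<omega>) = self_normalized_pp \<xi> r \<omega>"
proof -
  have J: "finite {1..r}" "{1..r} \<noteq> {}" using assms(1) by auto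
  have S: "scaled_pp \<xi> c {1..r} \<omega> \<in> Mfin"
    by (rule scaled_pp_Mfin(1)[where \<xi> = \<xi> and \<omega> = \<omega>, OF J nz c])
  have S2: "max_modulus (scaled_pp \<xi> c {1..r} \<omega>) = max_abs \<xi> {1..r} \<omega> / c"
    by (rule scaled_pp_Mfin(2)[where \<xi> = \<xi> and \<omega> = \<omega>, OF J nz c])
  have m: "max_abs \<xi> {1..r} \<omega> / c > 0" using max_modulus_less_iff(1)[OF S] S2 by simp
  then have m': "max_abs \<xi> {1..r} \<omega> > 0" using c by (simp add: zero_less_divide_iff)
  have E: "(\<lambda>j. ereal (\<xi> j \<omega> / c)) ` {1..r} \<subseteq> E" using nz c by (auto simp: E_def)
  have "normalized (scaled_pp \<xi> c {1..r} \<omega>) =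
      sum_dirac {1..r} (\<lambda>j. ereal (1 / (max_abs \<xi> {1..r} \<omega> / c)) * ereal (\<xi> j \<omega> / c))"
    unfolding normalized_def S2 unfolding scaled_pp_def
    using c m' by (intro scale_sum_dirac[OF E]) simp
  also have "\<dots> = self_normalized_pp \<xi> r \<omega>"
    unfolding self_normalized_pp_def using c m' by (simp add: mult.commute)
  finally show ?thesis .
qed

lemma measurable_scaled_pp:
  assumes J: "finite J" "J \<noteq> {}" and c: "c > 0"
    and meas: "\<And>j. j \<in> J \<Longrightarrow> \<xi> j \<in> borel_measurable X"
    and nz: "\<And>j \<omega>. j \<in> J \<Longrightarrow> \<omega> \<in> space X \<Longrightarrow> \<xi> j \<omega> \<noteq> 0"
  shows "scaled_pp \<xi> c J \<in> measurable X (borel_of (subtopology vague Mfin))"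
proof (rule measurable_into_vague)
  show "scaled_pp \<xi> c J \<omega> \<in> Mp \<inter> Mfin" if "\<omega> \<in> space X" for \<omega>
    using scaled_pp_Mfin(1)[where \<xi> = \<xi> and \<omega> = \<omega>, OF J nz[OF _ that] c] Mfin_subset by auto
next
  fix f assume f: "f \<in> CK_plus"
  have E: "(\<lambda>j. ereal (\<xi> j \<omega> / c)) ` J \<subseteq> E" if "\<omega> \<in> space X" for \<omega>
    using nz[OF _ that] c by (auto simp: E_def)
  have "(\<lambda>\<omega>. ereal (\<xi> j \<omega> / c)) \<in> measurable X borel_E" if "j \<in> J" for j
    unfolding borel_E_def using meas[OF that] E that by (intro measurable_restrict_space2) auto
  then have "(\<lambda>\<omega>. \<Sum>j\<in>J. f (ereal (\<xi> j \<omega> / c))) \<in> borel_measurable X"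
    using measurable_compose[OF _ CK_plus_measurable[OF f]] by (intro borel_measurable_sum) blast
  moreover have "(\<integral>t. f t \<partial>scaled_pp \<xi> c J \<omega>) = (\<Sum>j\<in>J. f (ereal (\<xi> j \<omega> / c)))" if "\<omega> \<in> space X" for \<omega>
    unfolding scaled_pp_def by (rule integral_sum_dirac[OF J(1) E[OF that] f])
  ultimately show "(\<lambda>\<omega>. \<integral>t. f t \<partial>scaled_pp \<xi> c J \<omega>) \<in> borel_measurable X"
    by (simp cong: measurable_cong)
qed

text \<open>Stated over an arbitrary space because it is applied to the coordinate functions on the
  space of sequences.\<close>

lemma exceedance_event_sets:
  assumes J: "finite J" "J \<noteq> {}" and c: "c > 0"
    and meas: "\<And>j. j \<in> J \<Longrightarrow> \<xi> j \<in> borel_measurable X"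
    and nz: "\<And>j \<omega>. j \<in> J \<Longrightarrow> \<omega> \<in> space X \<Longrightarrow> \<xi> j \<omega> \<noteq> 0"
    and M: "M \<in> sets (borel_of vague)"
  shows "{\<omega> \<in> space X. max_abs \<xi> J \<omega> / c > x \<and> scaled_pp \<xi> c J \<omega> \<in> M} \<in> sets X"
proof -
  have "scaled_pp \<xi> c J \<in> measurable X (borel_of vague)"
    using measurable_compose[OF measurable_scaled_pp[OF J c meas nz] continuous_map_measurable_borel_of[OF
      continuous_map_from_subtopology[OF continuous_map_id[of vague, unfolded id_def]]]] .
  then have "scaled_pp \<xi> c J -` M \<inter> space X \<in> sets X" using M by (rule measurable_sets)
  moreover have "{\<omega> \<in> space X. x * c < \<bar>\<xi> j \<omega>\<bar>} \<in> sets X" if "j \<in> J" for j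
    using meas[OF that] by measurable
  then have "(\<Union>j\<in>J. {\<omega> \<in> space X. x * c < \<bar>\<xi> j \<omega>\<bar>}) \<in> sets X" using J by auto
  ultimately have "(\<Union>j\<in>J. {\<omega> \<in> space X. x * c < \<bar>\<xi> j \<omega>\<bar>}) \<inter> (scaled_pp \<xi> c J -` M \<inter> space X) \<in> sets X"
    by blast
  also have "(\<Union>j\<in>J. {\<omega> \<in> space X. x * c < \<bar>\<xi> j \<omega>\<bar>}) \<inter> (scaled_pp \<xi> c J -` M \<inter> space X) =
      {\<omega> \<in> space X. max_abs \<xi> J \<omega> / c > x \<and> scaled_pp \<xi> c J \<omega> \<in> M}"
    using J c by (auto simp: max_abs_def less_divide_eq Max_gr_iff)
  finally show ?thesis .
qed

lemma block_eq: "i \<ge> 1 \<Longrightarrow> block r i = (\<lambda>j. j + (i - 1) * r) ` {1..r}"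
proof -
  assume "i \<ge> 1"
  then obtain m where i: "i = Suc m" by (cases i) auto
  have "{m * r <.. Suc m * r} = (\<lambda>j. j + m * r) ` {1..r}"
  proof (intro equalityI subsetI)
    fix j assume "j \<in> {m * r <.. Suc m * r}"
    then show "j \<in> (\<lambda>j. j + m * r) ` {1..r}" by (intro image_eqI[of _ _ "j - m * r"]) auto
  qed auto
  then show ?thesis by (simp add: block_def i)
qed

text \<open>Stationarity is an identity of laws on sequence space, so the event has to be the
  preimage of one measurable set of sequences under the shifted process. Shift (i - 1) r gives block
  i and shift 0 the first block.\<close>

lemma stationary_block_prob:
  assumes P: "prob_space P" and meas: "\<And>j. j \<ge> 1 \<Longrightarrow> \<xi> j \<in> borel_measurable P"
    and nz: "\<And>j \<omega>. j \<ge> 1 \<Longrightarrow> \<omega> \<in> space P \<Longrightarrow> \<xi> j \<omega> \<noteq> 0"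
    and st: "stationary P \<xi>" and c: "c > 0" and r: "r \<ge> 1" and i: "i \<ge> 1"
    and M: "M \<in> sets (borel_of vague)"
  shows "emeasure P {\<omega> \<in> space P. max_abs \<xi> (block r i) \<omega> / c > x \<and> scaled_pp \<xi> c (block r i) \<omega> \<in> M} =
    emeasure P {\<omega> \<in> space P. max_abs \<xi> {1..r} \<omega> / c > x \<and> scaled_pp \<xi> c {1..r} \<omega> \<in> M}"
proof -
  let ?X = "PiM {1..} (\<lambda>_. borel :: real measure) :: (nat \<Rightarrow> real) measure"
  let ?\<xi> = "\<lambda>j (z :: nat \<Rightarrow> real). z j"
  \<comment> \<open>Sequence space also contains sequences with zeros, whose points fall outside
    \<open>E\<close>. The event is therefore taken inside the measurable set of sequences without
    zeros up to r, in which the process always lies.\<close>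
  let ?D = "{z \<in> space ?X. \<forall>j\<in>{1..r}. z j \<noteq> 0}"
  define S where "S = {z \<in> ?D. max_abs ?\<xi> {1..r} z / c > x \<and> scaled_pp ?\<xi> c {1..r} z \<in> M}"
  have J: "finite {1..r}" "{1..r} \<noteq> {}" using r by auto
  have proj: "?\<xi> j \<in> borel_measurable ?X" if "j \<in> {1..r}" for j
    using that by (intro measurable_component_singleton) auto
  have D: "?D \<in> sets ?X"
  proof -
    have "{z \<in> space ?X. z j \<noteq> 0} \<in> sets ?X" if "j \<in> {1..r}" for j
      using proj[OF that] by measurable
    then show ?thesis by (intro sets.sets_Collect_finite_All) auto
  qed
  have spD: "space (restrict_space ?X ?D) = ?D" using D by simp
  have "{z \<in> space (restrict_space ?X ?D). max_abs ?\<xi> {1..r} z / c > x \<and> scaled_pp ?\<xi> c {1..r} z \<in> M}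
      \<in> sets (restrict_space ?X ?D)"
  proof (rule exceedance_event_sets[OF J c _ _ M])
    show "?\<xi> j \<in> borel_measurable (restrict_space ?X ?D)" if "j \<in> {1..r}" for j
      using proj[OF that] by (rule measurable_restrict_space1)
    show "z j \<noteq> 0" if "j \<in> {1..r}" "z \<in> space (restrict_space ?X ?D)" for j z
      using that unfolding spD by blast
  qed
  then have "S \<in> sets (restrict_space ?X ?D)" unfolding spD S_def .
  then have S: "S \<in> sets ?X" using D by (simp add: sets_restrict_space_iff)
  define sh where "sh h \<omega> = (\<lambda>j\<in>{1..}. \<xi> (j + h) \<omega>)" for h \<omega>
  have sh: "sh h \<in> measurable P ?X" for h
    unfolding sh_def using meas by (intro measurable_restrict) auto
  have pre: "emeasure P {\<omega> \<in> space P. max_abs \<xi> ((\<lambda>j. j + h) ` {1..r}) \<omega> / c > x \<and>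
      scaled_pp \<xi> c ((\<lambda>j. j + h) ` {1..r}) \<omega> \<in> M} = emeasure (distr P ?X (sh h)) S" for h
  proof -
    have "emeasure (distr P ?X (sh h)) S = emeasure P (sh h -` S \<inter> space P)"
      using sh S by (rule emeasure_distr)
    also have "sh h -` S \<inter> space P = {\<omega> \<in> space P. max_abs \<xi> ((\<lambda>j. j + h) ` {1..r}) \<omega> / c > x \<and>
      scaled_pp \<xi> c ((\<lambda>j. j + h) ` {1..r}) \<omega> \<in> M}"
    proof -
      have "sh h \<omega> \<in> S \<longleftrightarrow> max_abs \<xi> ((\<lambda>j. j + h) ` {1..r}) \<omega> / c > x \<and>
          scaled_pp \<xi> c ((\<lambda>j. j + h) ` {1..r}) \<omega> \<in> M" if \<omega>: "\<omega> \<in> space P" for \<omega>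
      proof -
        have "sh h \<omega> \<in> ?D"
          using measurable_space[OF sh \<omega>] nz[OF _ \<omega>] by (auto simp: sh_def)
        moreover have "max_abs ?\<xi> {1..r} (sh h \<omega>) = max_abs \<xi> ((\<lambda>j. j + h) ` {1..r}) \<omega>"
          unfolding max_abs_def image_image by (intro arg_cong[where f = Max] image_cong) (auto simp: sh_def)
        moreover have "scaled_pp ?\<xi> c {1..r} (sh h \<omega>) = scaled_pp \<xi> c ((\<lambda>j. j + h) ` {1..r}) \<omega>"
        proof -
          have "scaled_pp \<xi> c ((\<lambda>j. j + h) ` {1..r}) \<omega> = sum_dirac {1..r} (\<lambda>j. ereal (\<xi> (j + h) \<omega> / c))"
            unfolding scaled_pp_def using nz[OF _ \<omega>] c by (intro sum_dirac_reindex) (auto simp: E_def)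
          also have "\<dots> = scaled_pp ?\<xi> c {1..r} (sh h \<omega>)"
            unfolding scaled_pp_def sum_dirac_def by (intro distr_cong) (auto simp: sh_def)
          finally show ?thesis by simp
        qed
        ultimately show ?thesis by (simp add: S_def)
      qed
      then show ?thesis by auto
    qed
    finally show ?thesis by simp
  qed
  have "distr P ?X (sh ((i - 1) * r)) = distr P ?X (sh 0)"
    using st unfolding stationary_def sh_def by simp
  then have "emeasure (distr P ?X (sh ((i - 1) * r))) S = emeasure (distr P ?X (sh 0)) S" by (simp only:)
  then show ?thesis
    using pre[of "(i - 1) * r"] pre[of 0] by (simp add: block_eq[OF i])
qed

section \<open>Shift of the index and assembly of the equivalence\<close>

lemma tendsto_offset_iff: "(\<lambda>n. f (n + k)) \<longlonglongrightarrow> l \<longleftrightarrow> f \<longlonglongrightarrow> l"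
  for f :: "nat \<Rightarrow> 'b::topological_space"
  using LIMSEQ_offset LIMSEQ_ignore_initial_segment by blast

lemma weak_convergence_on_offset_iff:
  "weak_convergence_on X (\<lambda>n. \<mu> (n + k)) Q \<longleftrightarrow> weak_convergence_on X \<mu> Q"
  unfolding weak_convergence_on_def
  by (intro all_cong tendsto_offset_iff[where k = k and f = "\<lambda>n. integral\<^sup>L (\<mu> n) g" for g])

theorem proposition3p3:
  fixes P :: "'a measure"
    and \<xi> :: "nat \<Rightarrow> 'a \<Rightarrow> real"
    and a :: "nat \<Rightarrow> real"
    and k r :: "nat \<Rightarrow> nat"
    and L :: "real \<Rightarrow> real"
    and \<alpha> p q \<theta> :: real
    and Q :: "ereal measure measure"
  assumes "prob_space P"
    and "\<And>j. j \<ge> 1 \<Longrightarrow> \<xi> j \<in> borel_measurable P"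
    and "\<And>j \<omega>. j \<ge> 1 \<Longrightarrow> \<omega> \<in> space P \<Longrightarrow> \<xi> j \<omega> \<noteq> 0"
    and "stationary P \<xi>"
    and "\<And>n. n \<ge> 1 \<Longrightarrow> a n > 0"
    and "(\<lambda>n. real n * measure P {\<omega> \<in> space P. \<bar>\<xi> 1 \<omega>\<bar> > a n}) \<longlonglongrightarrow> 1"
    and "\<alpha> > 0"
    and "slowly_varying L"
    and "\<And>x. x > 0 \<Longrightarrow> measure P {\<omega> \<in> space P. \<bar>\<xi> 1 \<omega>\<bar> > x} = x powr (- \<alpha>) * L x"
    and "((\<lambda>x. measure P {\<omega> \<in> space P. \<xi> 1 \<omega> > x} /
               measure P {\<omega> \<in> space P. \<bar>\<xi> 1 \<omega>\<bar> > x}) \<longlongrightarrow> p) at_top"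
    and "((\<lambda>x. measure P {\<omega> \<in> space P. \<xi> 1 \<omega> < - x} /
               measure P {\<omega> \<in> space P. \<bar>\<xi> 1 \<omega>\<bar> > x}) \<longlongrightarrow> q) at_top"
    and "p \<in> {0..1}" and "q = 1 - p"
    and "filterlim k at_top sequentially"
    and "\<And>n. r n = n div k n"
    and "filterlim r at_top sequentially"
    and "\<And>B. B \<in> rel_compact_borel \<Longrightarrow>
           (\<lambda>n. Max ((\<lambda>i. measure P {\<omega> \<in> space P. emeasure (scaled_pp \<xi> (a n) (block (r n) i) \<omega>) B > 0})
                      ` {1..k n})) \<longlonglongrightarrow> 0"
    and "\<And>f. f \<in> CK_plus \<Longrightarrow>
           (\<lambda>n. \<bar>(\<integral>\<omega>. exp (- (\<integral>t. f t \<partial>scaled_pp \<xi> (a n) {1..n} \<omega>)) \<partial>P) -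
                 (\<Prod>i=1..k n. \<integral>\<omega>. exp (- (\<integral>t. f t \<partial>scaled_pp \<xi> (a n) (block (r n) i) \<omega>)) \<partial>P)\<bar>)
             \<longlonglongrightarrow> 0"
    and "\<theta> \<in> {0<..1}"
    and "prob_space Q"
    and "sets Q = sets (borel_of (subtopology vague Mtilde))"
  shows
    "((\<forall>x>0. (\<lambda>n. real (k n) * measure P {\<omega> \<in> space P. max_abs \<xi> {1..r n} \<omega> > a n * x})
                \<longlonglongrightarrow> \<theta> * x powr (- \<alpha>)) \<and>
      (\<forall>x>0. weak_convergence_on (subtopology vague Mtilde)
                (\<lambda>n. cond_law_self_normalized P \<xi> (r n) (a n * x)) Q))
     \<longleftrightarrow>
     ((\<forall>x>0. (\<lambda>n. \<Sum>i=1..k n. emeasure P {\<omega> \<in> space P. max_abs \<xi> (block (r n) i) \<omega> / a n > x})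
                \<longlonglongrightarrow> lam \<theta> \<alpha> Q (M_exceed x)) \<and>
      (\<forall>x>0. lam \<theta> \<alpha> Q (M_exceed x) > 0 \<longrightarrow>
         (\<forall>M\<in>meas_sets_M0. lam \<theta> \<alpha> Q ((vague frontier_of M) \<inter> M_exceed x) = 0 \<longrightarrow>
            (\<lambda>n. \<Sum>i=1..k n. emeasure P {\<omega> \<in> space P. max_abs \<xi> (block (r n) i) \<omega> / a n > x \<and>
                                           scaled_pp \<xi> (a n) (block (r n) i) \<omega> \<in> M})
              \<longlonglongrightarrow> lam \<theta> \<alpha> Q (M \<inter> M_exceed x))))"
    (is "(?tail \<and> ?weak) \<longleftrightarrow> (?sums \<and> ?sets)")
proof -
  interpret P: prob_space P by fact
  note meas = assms(2) and nz = assms(3) and a_pos = assms(5)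
  have \<theta>: "\<theta> > 0" and \<alpha>: "\<alpha> > 0" using assms by auto
  have "\<forall>\<^sub>F n in sequentially. 1 \<le> r n"
    using \<open>filterlim r at_top sequentially\<close> by (simp add: filterlim_at_top)
  \<comment> \<open>For small n the block length may be 0, for instance because
    \<open>n div 0 = 0\<close>, and then \<open>max_abs\<close> is a maximum over an empty set;
    positivity of \<open>a n\<close> also starts at n = 1. All sequences are shifted by
    \<open>n0\<close>, which changes no limit.\<close>
  then obtain n0 where n0: "n0 \<ge> 1" "\<And>n. n \<ge> n0 \<Longrightarrow> 1 \<le> r n"
    unfolding eventually_sequentially by (metis le_trans max.cobounded1 max.cobounded2)
  define N where "N n = scaled_pp \<xi> (a (n + n0)) {1..r (n + n0)}" for n
  define c where "c n = real (k (n + n0))" for n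
  have rn: "1 \<le> r (n + n0)" "a (n + n0) > 0" for n using n0 a_pos by auto
  have J: "finite {1..r (n + n0)}" "{1..r (n + n0)} \<noteq> {}" for n using rn(1)[of n] by auto
  have N: "N n \<in> measurable P (borel_of (subtopology vague Mfin))" for n
    unfolding N_def using meas nz by (intro measurable_scaled_pp J rn) auto
  have top: "max_modulus (N n \<omega>) = max_abs \<xi> {1..r (n + n0)} \<omega> / a (n + n0)" if "\<omega> \<in> space P" for n \<omega>
    unfolding N_def using nz[OF _ that] by (intro scaled_pp_Mfin J rn) auto
  have norm: "normalized (N n \<omega>) = self_normalized_pp \<xi> (r (n + n0)) \<omega>" if "\<omega> \<in> space P" for n \<omega>
    unfolding N_def using nz[OF _ that] by (intro normalized_scaled_pp rn) auto
  have NMp: "N n \<omega> \<in> Mp" if "\<omega> \<in> space P" for n \<omega>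
    using measurable_space[OF N that] by (simp add: topspace_vague)
  have exceed_iff: "{\<omega> \<in> space P. x < max_modulus (N n \<omega>)} =
      {\<omega> \<in> space P. max_abs \<xi> {1..r (n + n0)} \<omega> > a (n + n0) * x}" for n x
    using rn(2)[of n] by (auto simp: top field_simps)
  have tail_iff: "?tail \<longleftrightarrow> (\<forall>x>0. (\<lambda>n. c n * measure P {\<omega> \<in> space P. x < max_modulus (N n \<omega>)})
      \<longlonglongrightarrow> \<theta> * x powr (- \<alpha>))"
    unfolding exceed_iff c_def
    using tendsto_offset_iff[where k = n0 and f = "\<lambda>n. real (k n) * measure P {\<omega> \<in> space P. max_abs \<xi> {1..r n} \<omega> > a n * _}"]
    by simp
  have law_eq: "distr (uniform_measure P {\<omega> \<in> space P. x < max_modulus (N n \<omega>)})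
      (borel_of (subtopology vague Mtilde)) (\<lambda>\<omega>. normalized (N n \<omega>)) =
      cond_law_self_normalized P \<xi> (r (n + n0)) (a (n + n0) * x)" for n x
    unfolding cond_law_self_normalized_def exceed_iff by (intro distr_cong) (auto simp: norm)
  have weak_iff: "?weak \<longleftrightarrow> (\<forall>x>0. weak_convergence_on (subtopology vague Mtilde)
      (\<lambda>n. distr (uniform_measure P {\<omega> \<in> space P. x < max_modulus (N n \<omega>)})
        (borel_of (subtopology vague Mtilde)) (\<lambda>\<omega>. normalized (N n \<omega>))) Q)"
    unfolding law_eq
    using weak_convergence_on_offset_iff[where k = n0 and \<mu> = "\<lambda>n. cond_law_self_normalized P \<xi> (r n) (a n * _)"]
    by simp
  have block_sum: "(\<Sum>i=1..k (n + n0). emeasure P {\<omega> \<in> space P. max_abs \<xi> (block (r (n + n0)) i) \<omega> / a (n + n0) > x \<and>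
        scaled_pp \<xi> (a (n + n0)) (block (r (n + n0)) i) \<omega> \<in> M}) =
      ennreal (c n * measure P {\<omega> \<in> space P. x < max_modulus (N n \<omega>) \<and> N n \<omega> \<in> M})"
    if M: "M \<in> sets (borel_of vague)" for M n x
  proof -
    have "(\<Sum>i=1..k (n + n0). emeasure P {\<omega> \<in> space P. max_abs \<xi> (block (r (n + n0)) i) \<omega> / a (n + n0) > x \<and>
        scaled_pp \<xi> (a (n + n0)) (block (r (n + n0)) i) \<omega> \<in> M}) =
      (\<Sum>i=1..k (n + n0). emeasure P {\<omega> \<in> space P. x < max_modulus (N n \<omega>) \<and> N n \<omega> \<in> M})"
    proof (intro sum.cong refl)
      fix i assume i: "i \<in> {1..k (n + n0)}"
      have "emeasure P {\<omega> \<in> space P. max_abs \<xi> (block (r (n + n0)) i) \<omega> / a (n + n0) > x \<and>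
          scaled_pp \<xi> (a (n + n0)) (block (r (n + n0)) i) \<omega> \<in> M} =
        emeasure P {\<omega> \<in> space P. max_abs \<xi> {1..r (n + n0)} \<omega> / a (n + n0) > x \<and>
          scaled_pp \<xi> (a (n + n0)) {1..r (n + n0)} \<omega> \<in> M}"
        using i by (intro stationary_block_prob assms(1,4) meas nz rn M) auto
      also have "{\<omega> \<in> space P. max_abs \<xi> {1..r (n + n0)} \<omega> / a (n + n0) > x \<and>
          scaled_pp \<xi> (a (n + n0)) {1..r (n + n0)} \<omega> \<in> M} =
          {\<omega> \<in> space P. x < max_modulus (N n \<omega>) \<and> N n \<omega> \<in> M}"
        by (auto simp: top) (auto simp: N_def)
      finally show "emeasure P {\<omega> \<in> space P. max_abs \<xi> (block (r (n + n0)) i) \<omega> / a (n + n0) > x \<and>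
          scaled_pp \<xi> (a (n + n0)) (block (r (n + n0)) i) \<omega> \<in> M} =
        emeasure P {\<omega> \<in> space P. x < max_modulus (N n \<omega>) \<and> N n \<omega> \<in> M}" .
    qed
    also have "\<dots> = ennreal (c n * measure P {\<omega> \<in> space P. x < max_modulus (N n \<omega>) \<and> N n \<omega> \<in> M})"
      by (simp add: P.emeasure_eq_measure c_def ennreal_mult ennreal_of_nat_eq_real_of_nat)
    finally show ?thesis .
  qed
  have block_Mp: "scaled_pp \<xi> (a (n + n0)) (block (r (n + n0)) i) \<omega> \<in> Mp"
    if "i \<ge> 1" "\<omega> \<in> space P" for n i \<omega>
  proof -
    have "j \<ge> 1" if "j \<in> block (r (n + n0)) i" for j using that by (auto simp: block_def)
    then show ?thesis
      unfolding scaled_pp_def using nz[OF _ that(2)] rn(2)[of n]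
      by (intro sum_dirac_Mp) (auto simp: block_def E_def)
  qed
  \<comment> \<open>Condition (a) is the block sum with the vacuous membership in \<open>Mp\<close>
    added, and its limit is evaluated by \<open>lam_M_exceed\<close>.\<close>
  have sums_iff: "?sums \<longleftrightarrow> ?tail"
  proof -
    have "(\<Sum>i=1..k (n + n0). emeasure P {\<omega> \<in> space P. max_abs \<xi> (block (r (n + n0)) i) \<omega> / a (n + n0) > x}) =
       ennreal (c n * measure P {\<omega> \<in> space P. x < max_modulus (N n \<omega>)})" for n x
    proof -
      have "(\<Sum>i=1..k (n + n0). emeasure P {\<omega> \<in> space P. max_abs \<xi> (block (r (n + n0)) i) \<omega> / a (n + n0) > x}) =
        (\<Sum>i=1..k (n + n0). emeasure P {\<omega> \<in> space P. max_abs \<xi> (block (r (n + n0)) i) \<omega> / a (n + n0) > x \<and>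
        scaled_pp \<xi> (a (n + n0)) (block (r (n + n0)) i) \<omega> \<in> Mp})"
        using block_Mp by (intro sum.cong refl arg_cong[where f = "emeasure P"]) auto
      also have "\<dots> = ennreal (c n * measure P {\<omega> \<in> space P. x < max_modulus (N n \<omega>) \<and> N n \<omega> \<in> Mp})"
        using sets.top[of "borel_of vague"] by (intro block_sum) (simp add: topspace_vague)
      also have "{\<omega> \<in> space P. x < max_modulus (N n \<omega>) \<and> N n \<omega> \<in> Mp} = {\<omega> \<in> space P. x < max_modulus (N n \<omega>)}"
        using NMp by auto
      finally show ?thesis .
    qed
    then have "?sums \<longleftrightarrow> (\<forall>x>0. (\<lambda>n. ennreal (c n * measure P {\<omega> \<in> space P. x < max_modulus (N n \<omega>)}))
        \<longlonglongrightarrow> ennreal (\<theta> * x powr (- \<alpha>)))"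
      using tendsto_offset_iff[where k = n0 and f = "\<lambda>n. \<Sum>i=1..k n. emeasure P {\<omega> \<in> space P. max_abs \<xi> (block (r n) i) \<omega> / a n > _}"]
        lam_M_exceed[OF \<open>prob_space Q\<close> \<open>sets Q = _\<close> \<theta> \<alpha>] by simp
    also have "\<dots> \<longleftrightarrow> ?tail"
      unfolding tail_iff using \<theta> by (intro all_cong tendsto_ennreal_iff) (auto simp: c_def)
    finally show ?thesis .
  qed
  have sets_iff: "?sets \<longleftrightarrow> (\<forall>x>0. \<forall>M\<in>meas_sets_M0. lam \<theta> \<alpha> Q ((vague frontier_of M) \<inter> M_exceed x) = 0 \<longrightarrow>
      (\<lambda>n. ennreal (c n * measure P {\<omega> \<in> space P. x < max_modulus (N n \<omega>) \<and> N n \<omega> \<in> M}))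
        \<longlonglongrightarrow> lam \<theta> \<alpha> Q (M \<inter> M_exceed x))"
  proof -
    have "(\<lambda>n. \<Sum>i=1..k n. emeasure P {\<omega> \<in> space P. max_abs \<xi> (block (r n) i) \<omega> / a n > x \<and>
          scaled_pp \<xi> (a n) (block (r n) i) \<omega> \<in> M}) \<longlonglongrightarrow> l \<longleftrightarrow>
        (\<lambda>n. ennreal (c n * measure P {\<omega> \<in> space P. x < max_modulus (N n \<omega>) \<and> N n \<omega> \<in> M})) \<longlonglongrightarrow> l"
      if "M \<in> meas_sets_M0" for M x l
      using that tendsto_offset_iff[where k = n0 and f = "\<lambda>n. \<Sum>i=1..k n. emeasure P {\<omega> \<in> space P. max_abs \<xi> (block (r n) i) \<omega> / a n > x \<and>
          scaled_pp \<xi> (a n) (block (r n) i) \<omega> \<in> M}", of l] block_sum[of M x]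
      by (simp add: meas_sets_M0_def)
    moreover have "lam \<theta> \<alpha> Q (M_exceed x) > 0" if "x > 0" for x
      using lam_M_exceed[OF \<open>prob_space Q\<close> \<open>sets Q = _\<close> \<theta> \<alpha> that] \<theta> that by simp
    ultimately show ?thesis by simp
  qed
  show ?thesis
  \<comment> \<open>The equivalence of (2) and (b) is proved in a locale that assumes (1). When (1)
    fails, (a) fails with it, and both pairs are false.\<close>
  proof (cases ?tail)
    case False
    then show ?thesis using sums_iff by blast
  next
    case True
    interpret exceedance P Q \<theta> \<alpha> N c
    proof (intro exceedance.intro exceedance_axioms.intro)
      show "prob_space P" by fact
      show "(\<lambda>n. c n * P.prob {\<omega> \<in> space P. x < max_modulus (N n \<omega>)}) \<longlonglongrightarrow> \<theta> * x powr - \<alpha>" if "x > 0" for x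
        using True that unfolding tail_iff by blast
      show "prob_space Q" "sets Q = sets (borel_of (subtopology vague Mtilde))" by fact+
    qed (simp_all add: \<theta> \<alpha> N c_def)
    have "?weak \<longleftrightarrow> ?sets"
    proof
      assume ?weak
      then have W: "weak_convergence_on XT (\<lambda>n. law n x) Q" if "x > 0" for x
        using that unfolding weak_iff law_def by blast
      show ?sets unfolding sets_iff
      proof (intro allI impI ballI)
        fix x :: real and M
        assume "x > 0" "M \<in> meas_sets_M0" "lam \<theta> \<alpha> Q (vague frontier_of M \<inter> M_exceed x) = 0"
        then show "(\<lambda>n. ennreal (c n * P.prob {\<omega> \<in> space P. x < max_modulus (N n \<omega>) \<and> N n \<omega> \<in> M}))
            \<longlonglongrightarrow> lam \<theta> \<alpha> Q (M \<inter> M_exceed x)"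
          by (intro weak_imp_set_convergence W) (auto simp: meas_sets_M0_def)
      qed
    next
      assume S: ?sets
      show ?weak unfolding weak_iff
      proof (intro allI impI)
        fix x :: real assume x: "x > 0"
        have "weak_convergence_on XT (\<lambda>n. law n x) Q"
          using S x unfolding sets_iff by (intro set_convergence_imp_weak) blast+
        then show "weak_convergence_on XT (\<lambda>n. distr (uniform_measure P {\<omega> \<in> space P. x < max_modulus (N n \<omega>)})
            (borel_of XT) (\<lambda>\<omega>. normalized (N n \<omega>))) Q" by (simp only: law_def)
      qed
    qed
    then show ?thesis using sums_iff by blast
  qed
qed

end
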